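(* Let $N\ge 1$ and let $(a_n)_{n\ge 0}$ (positive) and $(b_n)_{n\ge 0}$ (real) be the Jacobi parameters of a Jacobi matrix $\mathcal{A}$. Suppose they are $N$-periodically modulated with respect to $N$-periodic sequences $(\alpha_n)_{n\ge0}$ (positive) and $(\beta_n)_{n\ge0}$ (real). Suppose that $\operatorname{tr}\mathfrak{X}_N(0)\in(-2,2)$ and that $$\Big(\frac{a_{n-1}}{a_n}\Big),\quad \Big(\frac{b_n}{a_n}\Big),\quad \Big(\frac1{a_n}\Big)\in\mathcal{D}_1^N .$$ Set $$\rho_n=\sum_{k=0}^n\frac{\alpha_k}{a_k}.$$ If Carleman's condition $\sum_{n=0}^\infty \frac1{a_n}=\infty$ is satisfied, then for every bounded continuous $f:\mathbb{R}\to\mathbb{C}$ satisfying $\sup_{x\in\mathbb{R}}(1+x^2)|f(x)|<\infty$ we have $$\lim_{n\to\infty}\frac1{\rho_n}\int_{\mathbb{R}}f\,d\nu_n=\int_{\mathbb{R}}f\,d\nu,$$ where the measure $\nu$ is purely absolutely continuous with the constant density $$\frac{d\nu}{dx}\equiv\frac1{\pi N}\,\frac{|\operatorname{tr}\mathfrak{X}_N'(0)|}{\sqrt{-\operatorname{discr}\mathfrak{X}_N(0)}} .$$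
   Context: The Jacobi matrix $\mathcal{A}$ is the infinite symmetric tridiagonal matrix with diagonal $b_0,b_1,b_2,\dots$ and off-diagonal $a_0,a_1,a_2,\dots$; $\mathcal{A}_n$ is its upper-left $n\times n$ truncation, and $\nu_n=\sum_{y\in\sigma(\mathcal{A}_{n+1})}\delta_y$, where $\delta_y$ is the Dirac measure at $y$. The parameters are $N$-periodically modulated (with respect to the $N$-periodic sequences $\alpha_n>0$, $\beta_n\in\mathbb{R}$) if $$\lim_{n\to\infty}\Big|\frac{a_{n-1}}{a_n}-\frac{\alpha_{n-1}}{\alpha_n}\Big|=0,\quad \lim_{n\to\infty}\Big|\frac{b_n}{a_n}-\frac{\beta_n}{\alpha_n}\Big|=0,\quad \lim_{n\to\infty}a_n=\infty .$$ For $n\ge1$, $\mathfrak{X}_n(x)=\mathfrak{B}_{n+N-1}(x)\cdots\mathfrak{B}_{n+1}(x)\mathfrak{B}_n(x)$ with $\mathfrak{B}_j(x)=\begin{pmatrix}0&1\\-\frac{\alpha_{j-1}}{\alpha_j}&\frac{x-\beta_j}{\alpha_j}\end{pmatrix}$. $\mathfrak{X}_N'$ is the derivative in $x$. For a $2\times2$ matrix $X$, $\operatorname{discr}X=(\operatorname{tr}X)^2-4\det X$. A sequence $(x_n)_{n\ge1}$ belongs to $\mathcal{D}_1^N$ if $\sum_{n=1}^\infty|x_{n+N}-x_n|<\infty$. *)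

theory Defs
  imports
    "HOL-Analysis.Analysis"
    "HOL-Probability.Giry_Monad"
    "Jordan_Normal_Form.Spectral_Radius"
begin

definition jacobi :: "(nat \<Rightarrow> real) \<Rightarrow> (nat \<Rightarrow> real) \<Rightarrow> nat \<Rightarrow> nat \<Rightarrow> real" where
  "jacobi a b i j =
     (if i = j then b i
      else if j = Suc i then a i
      else if i = Suc j then a j
      else 0)"

definition jacobi_trunc :: "(nat \<Rightarrow> real) \<Rightarrow> (nat \<Rightarrow> real) \<Rightarrow> nat \<Rightarrow> real Matrix.mat" where
  "jacobi_trunc a b n = Matrix.mat n n (\<lambda>(i, j). jacobi a b i j)"

(* return borel y is the Dirac measure at y.  The spectrum of a square matrix over a field is
   finite (card_finite_spectrum), so the finite sum is never a default value.  As a set sum it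
   counts each eigenvalue once, as in the definition of nu_n. *)
definition eig_measure :: "(nat \<Rightarrow> real) \<Rightarrow> (nat \<Rightarrow> real) \<Rightarrow> nat \<Rightarrow> real measure" where
  "eig_measure a b n =
     measure_of UNIV (sets borel)
       (\<lambda>E. \<Sum>y\<in>spectrum (jacobi_trunc a b (n + 1)). emeasure (return borel y) E)"

definition periodic_seq :: "nat \<Rightarrow> (nat \<Rightarrow> real) \<Rightarrow> bool" where
  "periodic_seq N u \<longleftrightarrow> (\<forall>n. u (n + N) = u n)"

(* Natural-number subtraction only affects the index n = 0, which is irrelevant to the limit. *)
definition periodically_modulated ::
  "(nat \<Rightarrow> real) \<Rightarrow> (nat \<Rightarrow> real) \<Rightarrow> (nat \<Rightarrow> real) \<Rightarrow> (nat \<Rightarrow> real) \<Rightarrow> bool" where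
  "periodically_modulated \<alpha> \<beta> a b \<longleftrightarrow>
     (\<lambda>n. \<bar>a (n - 1) / a n - \<alpha> (n - 1) / \<alpha> n\<bar>) \<longlonglongrightarrow> 0 \<and>
     (\<lambda>n. \<bar>b n / a n - \<beta> n / \<alpha> n\<bar>) \<longlonglongrightarrow> 0 \<and>
     filterlim a at_top sequentially"

(* The class concerns sequences indexed from 1: the term at index 0 is ignored. *)
definition D1 :: "nat \<Rightarrow> (nat \<Rightarrow> real) set" where
  "D1 N = {x. summable (\<lambda>n. \<bar>x (Suc n + N) - x (Suc n)\<bar>)}"

(* Used for j \<ge> 1 only. *)
definition transfer_mat ::
  "(nat \<Rightarrow> real) \<Rightarrow> (nat \<Rightarrow> real) \<Rightarrow> nat \<Rightarrow> real \<Rightarrow> real ^ 2 ^ 2" where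
  "transfer_mat \<alpha> \<beta> j x =
     vector [vector [0, 1],
             vector [- (\<alpha> (j - 1) / \<alpha> j), (x - \<beta> j) / \<alpha> j]]"

primrec transfer_prod ::
  "(nat \<Rightarrow> real) \<Rightarrow> (nat \<Rightarrow> real) \<Rightarrow> nat \<Rightarrow> nat \<Rightarrow> real \<Rightarrow> real ^ 2 ^ 2" where
  "transfer_prod \<alpha> \<beta> n 0 x = Finite_Cartesian_Product.mat 1"
| "transfer_prod \<alpha> \<beta> n (Suc k) x = transfer_mat \<alpha> \<beta> (n + k) x ** transfer_prod \<alpha> \<beta> n k x"

definition monodromy ::
  "nat \<Rightarrow> (nat \<Rightarrow> real) \<Rightarrow> (nat \<Rightarrow> real) \<Rightarrow> nat \<Rightarrow> real \<Rightarrow> real ^ 2 ^ 2" where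
  "monodromy N \<alpha> \<beta> n x = transfer_prod \<alpha> \<beta> n N x"

definition discr :: "real ^ 2 ^ 2 \<Rightarrow> real" where
  "discr X = (trace X)\<^sup>2 - 4 * Determinants.det X"

definition rho :: "(nat \<Rightarrow> real) \<Rightarrow> (nat \<Rightarrow> real) \<Rightarrow> nat \<Rightarrow> real" where
  "rho \<alpha> a n = (\<Sum>k=0..n. \<alpha> k / a k)"

definition limit_measure :: "nat \<Rightarrow> (nat \<Rightarrow> real) \<Rightarrow> (nat \<Rightarrow> real) \<Rightarrow> real measure" where
  "limit_measure N \<alpha> \<beta> =
     density lborel (\<lambda>_. ennreal
       (1 / (pi * real N) *
        (\<bar>trace (vector_derivative (monodromy N \<alpha> \<beta> N) (at 0))\<bar> /
         sqrt (- discr (monodromy N \<alpha> \<beta> N 0)))))"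

end

theory Submission
  imports Defs "HOL-Probability.Sinc_Integral" "HOL-Computational_Algebra.Fundamental_Theorem_Algebra"
begin

text \<open>
Let \<open>p\<^sub>n\<close> be the orthonormal polynomials of the Jacobi matrix and \<open>r\<^sub>n = p\<^sub>n\<^sub>+\<^sub>1 / p\<^sub>n\<close>.
The eigenvalues of the truncation of size \<open>n + 1\<close> are the zeros of \<open>p\<^sub>n\<^sub>+\<^sub>1\<close>, all real
and simple. Hence for two points of the upper half-plane on the same vertical line, with imaginary
parts \<open>v\<close> and \<open>v'\<close>, the difference of the values of \<open>ln |p\<^sub>n\<^sub>+\<^sub>1|\<^sup>2\<close> is the sum of
\<open>ln (((y - u)\<^sup>2 + v\<^sup>2) / ((y - u)\<^sup>2 + v'\<^sup>2))\<close> over the eigenvalues \<open>y\<close>. It is therefore enough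
to know the growth of \<open>p\<^sub>n\<close> off the real axis to the precision \<open>o(\<rho>\<^sub>n)\<close>, up to terms that do
not depend on the point.

The imaginary part of the Wronskian of \<open>p\<^sub>n(z)\<close> and its conjugate is increased by
\<open>Im z |p\<^sub>n|\<^sup>2\<close> in each step, and this makes \<open>|p\<^sub>n\<^sub>+\<^sub>1|\<^sup>2\<close>, up to an explicit prefactor, equal to the
product of the numbers \<open>1 + Im z \<kappa>(r\<^sub>k) / a\<^sub>k\<close> with \<open>\<kappa>(r) = |r|\<^sup>2 / Im r\<close> (\<open>cmod_orth_product\<close>).
The factors tend to 1, so only the limits of \<open>r\<^sub>k\<close> matter for the growth.

These limits exist along each residue class modulo \<open>N\<close> (\<open>ratio_asymptotically_periodic\<close>).
The ratios obey a Riccati recursion \<open>r \<mapsto> d - c / r\<close>, which is a hyperbolic isometry followed by a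
shift upwards by \<open>Im z / a\<^sub>k\<close>. One period of it contracts the distance to its fixed point by a factor
\<open>1 - const / a\<^sub>k\<close>, while the fixed point itself moves by summable steps because the coefficients have
bounded variation. Carleman's condition makes the product of the contraction factors zero, so
\<open>r\<^sub>k\<close> follows the fixed points, which converge to the fixed point of the elliptic limiting monodromy
matrix.

A weighted average over one period then gives \<open>ln |p\<^sub>n\<^sub>+\<^sub>1|\<^sup>2 + ln a\<^sub>n \<sim> Im z K \<rho>\<^sub>n\<close>
(\<open>log_orth_asymptotics\<close>). The constant \<open>K\<close> is the mean of \<open>\<kappa> / \<alpha>\<close> along the
periodic orbit of the fixed point, and a Wronskian computation (\<open>trace_monodromy_deriv\<close>) evaluates it as
\<open>2/N\<close> times the quotient of the absolute derivative of the trace by the root of the negative discriminant.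

The logarithmic sums determine the Poisson means of the eigenvalue distributions
(\<open>poisson_means_from_log_means\<close>). All of them converge to those of a multiple of Lebesgue measure.
Poisson kernels are an approximate identity, and the kernel at \<open>\<i>\<close> is the weight \<open>1 / (1 + x\<^sup>2)\<close>
itself, so the convergence extends to all continuous functions dominated by that weight
(\<open>weighted_convergence\<close>).
\<close>

section \<open>Averages with slowly varying weights\<close>

lemma tendsto_zero_if_residues:
  fixes f :: "nat \<Rightarrow> real"
  assumes "N > 0" and "\<And>j. j < N \<Longrightarrow> (\<lambda>k. f (m + j + k * N)) \<longlonglongrightarrow> 0"
  shows "f \<longlonglongrightarrow> 0"
proof (rule LIMSEQ_I)
  fix e :: real assume e: "e > 0"
  have "\<exists>K. \<forall>k\<ge>K. norm (f (m + j + k * N)) < e" if "j < N" for j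
    using LIMSEQ_D[OF assms(2)[OF that] e] by simp
  then obtain K where K: "\<And>j k. j < N \<Longrightarrow> k \<ge> K j \<Longrightarrow> norm (f (m + j + k * N)) < e" by metis
  define K0 where "K0 = Max (K ` {..<N})"
  have "norm (f n) < e" if n: "n \<ge> m + N * (K0 + 1)" for n
  proof -
    let ?j = "(n - m) mod N" and ?k = "(n - m) div N"
    have j: "?j < N" using assms(1) by simp
    then have "K ?j \<le> K0" unfolding K0_def by (intro Max_ge) auto
    also have "K0 \<le> ?k" using n assms(1) 
      by (metis Suc_eq_plus1 add_le_imp_le_diff less_eq_div_iff_mult_less_eq mult.commute Suc_leD add.commute)
    finally have "norm (f (m + ?j + ?k * N)) < e" using K[OF j] by blast
    moreover have "m + ?j + ?k * N = n" using n by simp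
    ultimately show ?thesis by simp
  qed
  then show "\<exists>no. \<forall>n\<ge>no. norm (f n - 0) < e" by auto
qed

lemma weighted_average_null:
  fixes w \<epsilon> :: "nat \<Rightarrow> real"
  assumes w: "\<And>k. w k \<ge> 0" and div: "filterlim (\<lambda>n. \<Sum>k<n. w k) at_top sequentially"
    and \<epsilon>: "\<epsilon> \<longlonglongrightarrow> 0"
  shows "(\<lambda>n. (\<Sum>k<n. w k * \<epsilon> k) / (\<Sum>k<n. w k)) \<longlonglongrightarrow> 0"
proof (rule LIMSEQ_I)
  fix e :: real assume e: "e > 0"
  from LIMSEQ_D[OF \<epsilon>, of "e / 2"] e obtain m where m: "\<And>k. k \<ge> m \<Longrightarrow> \<bar>\<epsilon> k\<bar> < e / 2" by auto
  let ?W = "\<lambda>n. \<Sum>k<n. w k"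
  define A where "A = (\<Sum>k<m. w k * \<bar>\<epsilon> k\<bar>)"
  have A: "A \<ge> 0" using w by (auto simp: A_def intro: sum_nonneg)
  have "\<forall>\<^sub>F n in sequentially. ?W n \<ge> 2 * A / e + 1"
    using div by (simp add: filterlim_at_top)
  then obtain m' where m': "\<And>n. n \<ge> m' \<Longrightarrow> ?W n \<ge> 2 * A / e + 1" by (auto simp: eventually_sequentially)
  have "norm ((\<Sum>k<n. w k * \<epsilon> k) / ?W n - 0) < e" if n: "n \<ge> max m m'" for n
  proof -
    have W: "?W n \<ge> 2 * A / e + 1" using m' n by simp
    moreover have "2 * A / e \<ge> 0" using A e by simp
    ultimately have W0: "?W n > 0" by linarith
    have "\<bar>\<Sum>k<n. w k * \<epsilon> k\<bar> \<le> (\<Sum>k<n. w k * \<bar>\<epsilon> k\<bar>)"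
      by (rule order_trans[OF sum_abs]) (use w in \<open>auto simp: abs_mult intro!: sum_mono\<close>)
    also have "\<dots> \<le> (\<Sum>k<n. (if k < m then w k * \<bar>\<epsilon> k\<bar> else 0) + w k * (e / 2))"
    proof (rule sum_mono)
      fix k
      show "w k * \<bar>\<epsilon> k\<bar> \<le> (if k < m then w k * \<bar>\<epsilon> k\<bar> else 0) + w k * (e / 2)"
        using mult_left_mono[OF less_imp_le[OF m[of k]] w[of k]] w[of k] e by auto
    qed
    also have "\<dots> = A + ?W n * (e / 2)"
    proof -
      have "{..<m} = {..<n} \<inter> {k. k < m}" using n by auto
      then show ?thesis unfolding A_def by (simp add: sum.distrib sum_distrib_right sum.inter_restrict)
    qed
    also have "\<dots> < e * ?W n"
    proof -
      have "2 * A / e * e < ?W n * e" using W e by (intro mult_strict_right_mono) auto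
      then show ?thesis using e by (simp add: field_simps)
    qed
    finally show ?thesis using W0 by (simp add: abs_divide pos_divide_less_eq)
  qed
  then show "\<exists>no. \<forall>n\<ge>no. norm ((\<Sum>k<n. w k * \<epsilon> k) / ?W n - 0) < e" by blast
qed

lemma sum_periodic:
  fixes l :: "nat \<Rightarrow> real"
  assumes per: "\<And>k. l (k + N) = l k"
  shows "(\<Sum>k<m + N. l k) = (\<Sum>k<m. l k) + (\<Sum>k<N. l k)"
proof (induction m)
  case (Suc m)
  then show ?case using per[of m] by simp
qed simp

lemma periodic_bounded:
  fixes l :: "nat \<Rightarrow> real"
  assumes N: "N > 0" and per: "\<And>k. l (k + N) = l k"
  shows "\<exists>B. \<forall>k. \<bar>l k\<bar> \<le> B"
proof -
  have mod: "l k = l (k mod N)" for k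
  proof (induction k rule: less_induct)
    case (less k)
    show ?case
    proof (cases "k < N")
      case False
      then have "k - N + N = k" by simp
      then have "l k = l (k - N)" using per[of "k - N"] by metis
      also have "\<dots> = l ((k - N) mod N)" using False N by (intro less.IH) auto
      also have "(k - N) mod N = k mod N" using False by (simp add: le_mod_geq)
      finally show ?thesis .
    qed simp
  qed
  have "\<bar>l k\<bar> \<le> Max ((\<lambda>k. \<bar>l k\<bar>) ` {..<N})" for k
    unfolding mod[of k] using N by (intro Max_ge) auto
  then show ?thesis by blast
qed

text \<open>Subtracting the mean leaves a periodic sequence whose partial sums are bounded. Summation by parts
moves the difference onto the weights, whose relative increments tend to 0.\<close>

lemma weighted_average_periodic:
  fixes w l :: "nat \<Rightarrow> real"
  assumes N: "N > 0" and w: "\<And>k. w k > 0" and div: "filterlim (\<lambda>n. \<Sum>k<n. w k) at_top sequentially"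
    and slow: "(\<lambda>k. w (Suc k) / w k) \<longlonglongrightarrow> 1" and bdd: "\<And>k. w k \<le> W"
    and per: "\<And>k. l (k + N) = l k"
  shows "(\<lambda>n. (\<Sum>k<n. w k * l k) / (\<Sum>k<n. w k)) \<longlonglongrightarrow> (\<Sum>k<N. l k) / N"
proof -
  define L where "L = (\<Sum>k<N. l k) / N"
  define P where "P k = (\<Sum>j<k. l j - L)" for k
  have "P (k + N) = P k" for k
    unfolding P_def using N by (subst sum_periodic) (auto simp: per sum_subtractf L_def)
  then obtain B where B: "\<And>k. \<bar>P k\<bar> \<le> B" using periodic_bounded[OF N, of P] by blast
  have B0: "B \<ge> 0" using B[of 0] by linarith
  define \<epsilon> where "\<epsilon> k = P (Suc k) * (1 - w (Suc k) / w k)" for k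
  have "\<epsilon> \<longlonglongrightarrow> 0"
  proof (rule tendsto_0_le[where K = B])
    show "(\<lambda>k. 1 - w (Suc k) / w k) \<longlonglongrightarrow> 0" using tendsto_diff[OF tendsto_const slow, of 1] by simp
    show "\<forall>\<^sub>F k in sequentially. norm (\<epsilon> k) \<le> norm (1 - w (Suc k) / w k) * B"
      using B by (auto simp: \<epsilon>_def abs_mult mult.commute intro!: always_eventually mult_right_mono)
  qed
  then have 1: "(\<lambda>n. (\<Sum>k<n. w k * \<epsilon> k) / (\<Sum>k<n. w k)) \<longlonglongrightarrow> 0"
    using w by (intro weighted_average_null div) (auto intro: less_imp_le)
  have abel: "(\<Sum>k<n. w k * (l k - L)) = w n * P n + (\<Sum>k<n. w k * \<epsilon> k)" for n
  proof (induction n)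
    case (Suc n)
    have "P (Suc n) = P n + (l n - L)" by (simp add: P_def)
    then have "l n - L = P (Suc n) - P n" by simp
    then have "w n * (l n - L) = w n * P (Suc n) - w n * P n" by (simp only: right_diff_distrib)
    moreover have "w n * \<epsilon> n = w n * P (Suc n) - w (Suc n) * P (Suc n)"
      using w[of n] by (simp add: \<epsilon>_def field_simps)
    ultimately show ?case using Suc by simp
  qed (simp add: P_def)
  have 2: "(\<lambda>n. w n * P n / (\<Sum>k<n. w k)) \<longlonglongrightarrow> 0"
  proof (rule tendsto_0_le[where K = "W * B"])
    show "(\<lambda>n. 1 / (\<Sum>k<n. w k)) \<longlonglongrightarrow> 0"
      by (rule tendsto_divide_0[OF tendsto_const filterlim_at_top_imp_at_infinity[OF div]])
    have "\<bar>w n * P n\<bar> \<le> W * B" for n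
      unfolding abs_mult using w[of n] bdd[of n] B by (intro mult_mono) auto
    then have "\<bar>w n * P n\<bar> / \<bar>\<Sum>k<n. w k\<bar> \<le> W * B / \<bar>\<Sum>k<n. w k\<bar>" for n
      by (rule divide_right_mono) simp
    then show "\<forall>\<^sub>F n in sequentially. norm (w n * P n / (\<Sum>k<n. w k)) \<le> norm (1 / (\<Sum>k<n. w k)) * (W * B)"
      by (auto intro!: always_eventually simp: abs_divide)
  qed
  have "\<forall>\<^sub>F n in sequentially. (\<Sum>k<n. w k) > 0"
    using div by (rule filterlim_at_top_dense[THEN iffD1, rule_format])
  then have "\<forall>\<^sub>F n in sequentially. w n * P n / (\<Sum>k<n. w k) + (\<Sum>k<n. w k * \<epsilon> k) / (\<Sum>k<n. w k) + L
      = (\<Sum>k<n. w k * l k) / (\<Sum>k<n. w k)"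
  proof eventually_elim
    case (elim n)
    have "w n * P n / (\<Sum>k<n. w k) + (\<Sum>k<n. w k * \<epsilon> k) / (\<Sum>k<n. w k)
        = ((\<Sum>k<n. w k * l k) - L * (\<Sum>k<n. w k)) / (\<Sum>k<n. w k)"
      unfolding add_divide_distrib[symmetric] abel[symmetric]
      by (simp add: right_diff_distrib sum_subtractf sum_distrib_left mult.commute)
    then show ?case using elim by (simp add: diff_divide_distrib)
  qed
  moreover have "(\<lambda>n. w n * P n / (\<Sum>k<n. w k) + (\<Sum>k<n. w k * \<epsilon> k) / (\<Sum>k<n. w k) + L) \<longlonglongrightarrow> 0 + 0 + L"
    by (intro tendsto_intros 1 2)
  ultimately show ?thesis unfolding L_def[symmetric] by (auto intro: Lim_transform_eventually)
qed

lemma weighted_average_asymptotically_periodic: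
  fixes w x l :: "nat \<Rightarrow> real"
  assumes "N > 0" and w: "\<And>k. w k > 0" and div: "filterlim (\<lambda>n. \<Sum>k<n. w k) at_top sequentially"
    and "(\<lambda>k. w (Suc k) / w k) \<longlonglongrightarrow> 1" and "\<And>k. w k \<le> W"
    and "\<And>k. l (k + N) = l k" and lim: "(\<lambda>k. x k - l k) \<longlonglongrightarrow> 0"
  shows "(\<lambda>n. (\<Sum>k<n. w k * x k) / (\<Sum>k<n. w k)) \<longlonglongrightarrow> (\<Sum>k<N. l k) / N"
proof -
  have "(\<lambda>n. (\<Sum>k<n. w k * (x k - l k)) / (\<Sum>k<n. w k) + (\<Sum>k<n. w k * l k) / (\<Sum>k<n. w k))
      \<longlonglongrightarrow> 0 + (\<Sum>k<N. l k) / N"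
    by (intro tendsto_add weighted_average_null weighted_average_periodic[where W = W and N = N and l = l and w = w, OF assms(1-6)] div lim)
      (use w in \<open>auto intro: less_imp_le\<close>)
  moreover have "(\<Sum>k<n. w k * (x k - l k)) / (\<Sum>k<n. w k) + (\<Sum>k<n. w k * l k) / (\<Sum>k<n. w k)
     = (\<Sum>k<n. w k * x k) / (\<Sum>k<n. w k)" for n
    by (simp add: add_divide_distrib[symmetric] right_diff_distrib sum_subtractf)
  ultimately show ?thesis by simp
qed

lemma tendsto_imp_abs_bounded:
  fixes f :: "nat \<Rightarrow> real"
  assumes "f \<longlonglongrightarrow> l"
  obtains B where "\<And>n. \<bar>f n\<bar> \<le> B"
proof -
  have "Bseq f" using assms by (auto intro: convergent_imp_Bseq convergentI)
  then obtain B where "\<forall>n. norm (f n) \<le> B" by (rule BseqE)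
  then show ?thesis by (intro that[of B]) simp
qed

lemma filterlim_sum_at_top:
  fixes w :: "nat \<Rightarrow> real"
  assumes w: "\<And>k. w k \<ge> 0" and div: "\<not> summable w"
  shows "filterlim (\<lambda>n. \<Sum>k<n. w k) at_top sequentially"
  unfolding filterlim_at_top
proof
  fix Z
  have "\<exists>m. Z < (\<Sum>k\<le>m. w k)"
  proof (rule ccontr)
    assume "\<not> ?thesis"
    then have "summable w" by (intro bounded_imp_summable[of w Z] w) (auto simp: not_less)
    with div show False by simp
  qed
  then obtain m where m: "Z < (\<Sum>k\<le>m. w k)" by blast
  have "Z \<le> (\<Sum>k<n. w k)" if "n \<ge> Suc m" for n
  proof -
    have "(\<Sum>k\<le>m. w k) \<le> (\<Sum>k<n. w k)" using that w by (intro sum_mono2) auto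
    then show ?thesis using m by simp
  qed
  then show "\<forall>\<^sub>F n in sequentially. Z \<le> (\<Sum>k<n. w k)" by (auto simp: eventually_sequentially)
qed

section \<open>Measures tested on Poisson kernels\<close>

text \<open>The Poisson kernel of the upper half-plane at the point \<open>u + \<i>v\<close>, normalised to total mass \<open>\<pi>\<close>.\<close>

definition poisson :: "real \<Rightarrow> real \<Rightarrow> real \<Rightarrow> real" where
  "poisson u v x = v / ((x - u)\<^sup>2 + v\<^sup>2)"

lemma tendsto_approx:
  fixes f :: "nat \<Rightarrow> real"
  assumes "\<And>e. e > 0 \<Longrightarrow> \<exists>g l. g \<longlonglongrightarrow> l \<and> (\<forall>\<^sub>F n in sequentially. \<bar>f n - g n\<bar> \<le> e) \<and> \<bar>l - L\<bar> \<le> e"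
  shows "f \<longlonglongrightarrow> L"
proof (rule tendstoI)
  fix e :: real assume e: "e > 0"
  then obtain g l where g: "g \<longlonglongrightarrow> l" "\<forall>\<^sub>F n in sequentially. \<bar>f n - g n\<bar> \<le> e / 4" "\<bar>l - L\<bar> \<le> e / 4"
    using assms[of "e / 4"] by auto
  from tendstoD[OF g(1), of "e / 4"] e have "\<forall>\<^sub>F n in sequentially. dist (g n) l < e / 4" by simp
  with g(2) show "\<forall>\<^sub>F n in sequentially. dist (f n) L < e"
    by eventually_elim (use g(3) e in \<open>unfold dist_real_def, linarith\<close>)
qed

lemma poisson_nonneg: "v > 0 \<Longrightarrow> poisson u v x \<ge> 0"
  by (simp add: poisson_def)

lemma poisson_denominator_pos: "v > 0 \<Longrightarrow> (x - u)\<^sup>2 + v\<^sup>2 > (0::real)"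
  by (simp add: add_nonneg_pos)

lemma poisson_unit: "poisson 0 1 x = 1 / (1 + x\<^sup>2)"
  by (simp add: poisson_def add.commute)

lemma continuous_on_poisson: "v > 0 \<Longrightarrow> continuous_on A (\<lambda>u. poisson u v x)"
  unfolding poisson_def
  by (intro continuous_intros ballI) (metis less_irrefl poisson_denominator_pos)

lemma integral_poisson:
  assumes "v > 0" "p \<le> q"
  shows "integral {p..q} (\<lambda>u. poisson u v x) = arctan ((q - x) / v) - arctan ((p - x) / v)"
proof (intro integral_unique fundamental_theorem_of_calculus)
  fix u assume "u \<in> {p..q}"
  have eq: "(1 / v) * inverse (1 + ((u - x) / v)\<^sup>2) = poisson u v x"
    using assms poisson_denominator_pos[of v x u]
    by (simp add: poisson_def field_simps power2_eq_square add_nonneg_eq_0_iff)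
  show "((\<lambda>u. arctan ((u - x) / v)) has_vector_derivative poisson u v x) (at u within {p..q})"
    unfolding has_real_derivative_iff_has_vector_derivative[symmetric] eq[symmetric]
    using assms by (auto intro!: derivative_eq_intros)
qed (use assms in auto)

lemma poisson_le_weight:
  assumes "v > 0" "\<bar>u\<bar> \<le> Q"
  shows "poisson u v x \<le> (v * (2 + (1 + 2 * Q\<^sup>2) / v\<^sup>2)) * (1 / (1 + x\<^sup>2))"
proof -
  have uQ: "u\<^sup>2 \<le> Q\<^sup>2" using assms(2) by (metis abs_le_square_iff abs_of_nonneg abs_ge_zero order_trans)
  have "0 \<le> (x - 2 * u)\<^sup>2" by simp
  then have "1 + x\<^sup>2 \<le> 2 * (x - u)\<^sup>2 + (1 + 2 * Q\<^sup>2)"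
    using uQ by (simp add: power2_eq_square algebra_simps)
  also have "\<dots> \<le> 2 * ((x - u)\<^sup>2 + v\<^sup>2) + (1 + 2 * Q\<^sup>2) / v\<^sup>2 * ((x - u)\<^sup>2 + v\<^sup>2)"
    using assms(1) by (simp add: field_simps)
  finally have *: "1 + x\<^sup>2 \<le> (2 + (1 + 2 * Q\<^sup>2) / v\<^sup>2) * ((x - u)\<^sup>2 + v\<^sup>2)"
    by (simp add: algebra_simps)
  have p: "1 + x\<^sup>2 > 0" by (simp add: add_pos_nonneg)
  have "v * (1 + x\<^sup>2) \<le> (v * (2 + (1 + 2 * Q\<^sup>2) / v\<^sup>2)) * ((x - u)\<^sup>2 + v\<^sup>2)"
    using mult_left_mono[OF *, of v] assms(1) by (simp add: mult_ac)
  then show ?thesis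
    unfolding poisson_def using p poisson_denominator_pos[OF assms(1), of x u]
    by (simp add: divide_simps mult_ac)
qed

text \<open>The error of the Poisson integral has to be small relative to the weight \<open>1 / (1 + x\<^sup>2)\<close>, since the
measures that it will be integrated against are only bounded on that weight. Near the support this is
the usual approximation of the identity; far from it the kernel itself decays like \<open>v / x\<^sup>2\<close>.\<close>

lemma poisson_smoothing:
  fixes \<phi> :: "real \<Rightarrow> real"
  assumes cont: "continuous_on UNIV \<phi>" and supp: "\<And>x. \<bar>x\<bar> > R \<Longrightarrow> \<phi> x = 0" and R: "R > 0"
    and e: "e > 0" and Q_def: "Q = 2 * R + 3"
  shows "\<exists>v>0. \<forall>x. \<bar>\<phi> x - integral {-Q..Q} (\<lambda>u. \<phi> u * poisson u v x) / pi\<bar> \<le> e / (1 + x\<^sup>2)"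
proof -
  define T where "T = 2 * R + 2"
  have Q: "Q = T + 1" "Q > 0" "T > 0" using R by (auto simp: Q_def T_def)
  have contQ: "continuous_on {-Q..Q} \<phi>" using cont continuous_on_subset by blast
  have "compact (\<phi> ` {-Q..Q})" using contQ by (intro compact_continuous_image) auto
  then obtain M0 where M0: "\<forall>y\<in>\<phi> ` {-Q..Q}. norm y \<le> M0" using compact_imp_bounded bounded_iff by metis
  define M where "M = max M0 1"
  have M: "M > 0" "\<bar>\<phi> u\<bar> \<le> M" if "u \<in> {-Q..Q}" for u using M0 that by (force simp: M_def)+
  have M_pos: "M > 0" by (simp add: M_def)
  define e' where "e' = e / (1 + T\<^sup>2)"
  have T1: "1 + T\<^sup>2 > 0" by (simp add: add_pos_nonneg)
  have e': "e' > 0" using e T1 by (simp add: e'_def)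
  have "uniformly_continuous_on {-Q..Q} \<phi>" by (rule compact_uniformly_continuous[OF contQ]) simp
  then obtain \<delta> where \<delta>: "\<delta> > 0"
    "\<And>u x. u \<in> {-Q..Q} \<Longrightarrow> x \<in> {-Q..Q} \<Longrightarrow> dist u x < \<delta> \<Longrightarrow> dist (\<phi> u) (\<phi> x) < e' / 2"
    unfolding uniformly_continuous_on_def using e' by (metis half_gt_zero)
  define K where "K = 2 * M / \<delta>\<^sup>2"
  have K: "K > 0" using M_pos \<delta> by (simp add: K_def)
  \<comment> \<open>A quadratic modulus of continuity suits the kernel, because \<open>(x - u)\<^sup>2\<close> times the kernel is at most \<open>v\<close>.\<close>
  have mod: "\<bar>\<phi> x - \<phi> u\<bar> \<le> e' / 2 + K * (x - u)\<^sup>2" if "u \<in> {-Q..Q}" "x \<in> {-Q..Q}" for u x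
  proof (cases "\<bar>u - x\<bar> < \<delta>")
    case True
    then have "\<bar>\<phi> x - \<phi> u\<bar> \<le> e' / 2"
      using \<delta>(2)[OF that] by (simp add: dist_real_def abs_minus_commute)
    then show ?thesis using K by (smt (verit) mult_nonneg_nonneg zero_le_power2)
  next
    case False
    then have "\<delta>\<^sup>2 \<le> (x - u)\<^sup>2" using \<delta>(1) by (metis abs_le_square_iff abs_minus_commute abs_of_pos not_less)
    then have "2 * M \<le> K * (x - u)\<^sup>2" using M_pos \<delta>(1) by (simp add: K_def field_simps mult_left_mono)
    moreover have "\<bar>\<phi> x - \<phi> u\<bar> \<le> 2 * M" using M[OF that(1)] M[OF that(2)] by linarith
    ultimately show ?thesis using e' by linarith
  qed
  have "((\<lambda>v. arctan (inverse v)) \<longlongrightarrow> pi / 2) (at_right 0)"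
    by (rule filterlim_compose[OF tendsto_arctan_at_top filterlim_inverse_at_top_right])
  then have "((\<lambda>v. M * (pi - 2 * arctan (inverse v)) + K * v * (2 * Q)) \<longlongrightarrow> M * (pi - 2 * (pi / 2)) + K * 0 * (2 * Q)) (at_right 0)"
    by (intro tendsto_intros)
  then have "\<forall>\<^sub>F v in at_right 0. M * (pi - 2 * arctan (inverse v)) + K * v * (2 * Q) < pi * (e' / 2)"
    using e' by (intro order_tendstoD) auto
  moreover have "((\<lambda>v. 4 * M * v * (2 * Q)) \<longlongrightarrow> 4 * M * 0 * (2 * Q)) (at_right 0)"
    by (intro tendsto_intros)
  then have "\<forall>\<^sub>F v in at_right 0. 4 * M * v * (2 * Q) < pi * e"
    using e by (intro order_tendstoD) auto
  moreover have "\<forall>\<^sub>F v in at_right (0::real). v > 0" by (simp add: eventually_at_right_less)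
  ultimately have "\<forall>\<^sub>F v in at_right 0. v > 0 \<and> M * (pi - 2 * arctan (inverse v)) + K * v * (2 * Q) < pi * (e' / 2)
      \<and> 4 * M * v * (2 * Q) < pi * e"
    by eventually_elim auto
  then obtain v where v: "v > 0" "M * (pi - 2 * arctan (inverse v)) + K * v * (2 * Q) < pi * (e' / 2)"
      "4 * M * v * (2 * Q) < pi * e"
    using eventually_happens trivial_limit_at_right_real by blast
  have contP: "continuous_on {-Q..Q} (\<lambda>u. g u * poisson u v x)" if "continuous_on {-Q..Q} g" for g x
    using that continuous_on_poisson[OF v(1)] by (intro continuous_on_mult) auto
  have "\<bar>\<phi> x - integral {-Q..Q} (\<lambda>u. \<phi> u * poisson u v x) / pi\<bar> \<le> e / (1 + x\<^sup>2)" for x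
  proof (cases "\<bar>x\<bar> \<le> T")
    case True
    then have xQ: "x \<in> {-Q..Q}" using Q by auto
    let ?I = "integral {-Q..Q} (\<lambda>u. poisson u v x)"
    have I: "?I = arctan ((Q - x) / v) + arctan ((Q + x) / v)"
    proof -
      have "(- Q - x) / v = - ((Q + x) / v)" using v(1) by (simp add: field_simps)
      then show ?thesis using integral_poisson[OF v(1), of "-Q" Q x] Q by (simp add: arctan_minus)
    qed
    have "inverse v \<le> (Q - x) / v" "inverse v \<le> (Q + x) / v"
      using True Q v(1) by (auto simp: inverse_eq_divide intro!: divide_right_mono)
    then have I_lb: "2 * arctan (inverse v) \<le> ?I"
      unfolding I using arctan_monotone'[of "inverse v" "(Q - x) / v"] arctan_monotone'[of "inverse v" "(Q + x) / v"]
      by linarith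
    have I_ub: "?I \<le> pi"
      unfolding I using arctan_bounded[of "(Q - x) / v"] arctan_bounded[of "(Q + x) / v"] by linarith
    have int: "(\<lambda>u. (\<phi> x - \<phi> u) * poisson u v x) integrable_on {-Q..Q}"
      by (intro integrable_continuous_interval contP continuous_intros contQ)
    have int2: "(\<lambda>u. \<phi> u * poisson u v x) integrable_on {-Q..Q}" "(\<lambda>u. poisson u v x) integrable_on {-Q..Q}"
      by (intro integrable_continuous_interval contP continuous_on_poisson contQ v)+
    have int3: "(\<lambda>u. c * poisson u v x) integrable_on {-Q..Q}" for c
      by (intro integrable_continuous_interval contP continuous_on_const)
    have "norm (integral {-Q..Q} (\<lambda>u. (\<phi> x - \<phi> u) * poisson u v x))
      \<le> integral {-Q..Q} (\<lambda>u. e' / 2 * poisson u v x + K * v)"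
    proof (rule integral_norm_bound_integral[OF int])
      show "(\<lambda>u. e' / 2 * poisson u v x + K * v) integrable_on {-Q..Q}"
        by (intro integrable_continuous_interval continuous_intros continuous_on_poisson v)
      fix u assume u: "u \<in> {-Q..Q}"
      have "(x - u)\<^sup>2 * poisson u v x \<le> v"
        using v(1) poisson_denominator_pos[OF v(1), of x u] by (simp add: poisson_def field_simps)
      then have "K * ((x - u)\<^sup>2 * poisson u v x) \<le> K * v" using K by (intro mult_left_mono) auto
      moreover have "norm ((\<phi> x - \<phi> u) * poisson u v x) \<le> (e' / 2 + K * (x - u)\<^sup>2) * poisson u v x"
        using mod[OF u xQ] poisson_nonneg[OF v(1)] by (simp add: abs_mult mult_right_mono)
      ultimately show "norm ((\<phi> x - \<phi> u) * poisson u v x) \<le> e' / 2 * poisson u v x + K * v"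
        by (simp add: algebra_simps)
    qed
    also have "\<dots> = e' / 2 * ?I + K * v * (2 * Q)"
      using int3 Q by (subst integral_add) auto
    also have "\<dots> \<le> e' / 2 * pi + K * v * (2 * Q)" using I_ub e' by (simp add: mult_left_mono)
    finally have A: "\<bar>integral {-Q..Q} (\<lambda>u. (\<phi> x - \<phi> u) * poisson u v x)\<bar> \<le> e' / 2 * pi + K * v * (2 * Q)" by simp
    have "integral {-Q..Q} (\<lambda>u. (\<phi> x - \<phi> u) * poisson u v x) = \<phi> x * ?I - integral {-Q..Q} (\<lambda>u. \<phi> u * poisson u v x)"
      using int2 int3 by (simp add: left_diff_distrib integral_diff)
    then have "pi * (\<phi> x - integral {-Q..Q} (\<lambda>u. \<phi> u * poisson u v x) / pi) =
       \<phi> x * (pi - ?I) + integral {-Q..Q} (\<lambda>u. (\<phi> x - \<phi> u) * poisson u v x)"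
      by (simp add: algebra_simps)
    then have "pi * \<bar>\<phi> x - integral {-Q..Q} (\<lambda>u. \<phi> u * poisson u v x) / pi\<bar> =
       \<bar>\<phi> x * (pi - ?I) + integral {-Q..Q} (\<lambda>u. (\<phi> x - \<phi> u) * poisson u v x)\<bar>"
      by (metis abs_mult abs_of_pos pi_gt_zero)
    also have "\<dots> \<le> \<bar>\<phi> x * (pi - ?I)\<bar> + (e' / 2 * pi + K * v * (2 * Q))" using A by linarith
    also have "\<bar>\<phi> x * (pi - ?I)\<bar> \<le> M * (pi - 2 * arctan (inverse v))"
      unfolding abs_mult using M[OF xQ] I_ub I_lb by (intro mult_mono) auto
    finally have "pi * \<bar>\<phi> x - integral {-Q..Q} (\<lambda>u. \<phi> u * poisson u v x) / pi\<bar> \<le> pi * e'"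
      using v(2) mult.commute[of "e' / 2" pi] by linarith
    then have "\<bar>\<phi> x - integral {-Q..Q} (\<lambda>u. \<phi> u * poisson u v x) / pi\<bar> \<le> e'" by simp
    also have "\<dots> \<le> e / (1 + x\<^sup>2)"
    proof -
      have "x\<^sup>2 \<le> T\<^sup>2" using True Q(3) by (metis abs_le_square_iff abs_of_pos)
      then show ?thesis unfolding e'_def using e by (intro divide_left_mono mult_pos_pos) (auto intro: add_pos_nonneg)
    qed
    finally show ?thesis .
  next
    case False
    then have x: "\<bar>x\<bar> > T" by simp
    then have "\<phi> x = 0" using supp R by (simp add: T_def)
    have bnd: "norm (\<phi> u * poisson u v x) \<le> 4 * M * v / (1 + x\<^sup>2)" if u: "u \<in> {-Q..Q}" for u
    proof (cases "\<bar>u\<bar> > R")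
      case True
      then show ?thesis using supp v M_pos by (simp add: add_nonneg_nonneg)
    next
      case False
      then have "\<bar>x - u\<bar> \<ge> \<bar>x\<bar> / 2 + 1" using x T_def by linarith
      then have "(\<bar>x\<bar> / 2 + 1)\<^sup>2 \<le> (x - u)\<^sup>2" by (metis abs_ge_zero abs_le_square_iff abs_of_nonneg add_nonneg_nonneg divide_nonneg_nonneg zero_le_numeral zero_le_one)
      moreover have "(\<bar>x\<bar> / 2 + 1)\<^sup>2 \<ge> (1 + x\<^sup>2) / 4" by (simp add: power2_eq_square algebra_simps)
      ultimately have d: "(1 + x\<^sup>2) / 4 \<le> (x - u)\<^sup>2 + v\<^sup>2" by (smt (verit) zero_le_power2)
      have "poisson u v x \<le> v / ((1 + x\<^sup>2) / 4)"
      proof -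
        have "(1 + x\<^sup>2) / 4 > 0" by (simp add: add_pos_nonneg)
        then show ?thesis unfolding poisson_def
          using d v(1) poisson_denominator_pos[OF v(1), of x u]
          by (intro divide_left_mono mult_pos_pos) auto
      qed
      then have "\<bar>\<phi> u\<bar> * poisson u v x \<le> M * (v / ((1 + x\<^sup>2) / 4))"
        using M[OF u] poisson_nonneg[OF v(1)] by (intro mult_mono) auto
      then show ?thesis using poisson_nonneg[OF v(1)] by (simp add: abs_mult mult_ac)
    qed
    have "norm (integral {-Q..Q} (\<lambda>u. \<phi> u * poisson u v x)) \<le> 4 * M * v / (1 + x\<^sup>2) * (Q - (-Q))"
      by (rule integral_bound[OF _ contP[OF contQ]]) (use Q bnd in auto)
    also have "\<dots> = (4 * M * v * (2 * Q)) / (1 + x\<^sup>2)" by simp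
    also have "\<dots> \<le> pi * e / (1 + x\<^sup>2)" using v(3) by (intro divide_right_mono) (auto intro: add_nonneg_nonneg)
    finally have "\<bar>integral {-Q..Q} (\<lambda>u. \<phi> u * poisson u v x)\<bar> / pi \<le> (pi * e / (1 + x\<^sup>2)) / pi"
      by (intro divide_right_mono) auto
    then show ?thesis using \<open>\<phi> x = 0\<close> by simp
  qed
  then show ?thesis using v(1) by blast
qed

text \<open>Poisson means are what the growth of the orthonormal polynomials controls. The locale extracts from
them the convergence against continuous functions dominated by \<open>1 / (1 + x\<^sup>2)\<close>.\<close>

locale poisson_means =
  fixes S :: "nat \<Rightarrow> real set" and \<rho> :: "nat \<Rightarrow> real" and d :: real
  assumes fin: "finite (S n)" and \<rho>_pos: "\<rho> n > 0"
    and means: "v > 0 \<Longrightarrow> (\<lambda>n. (\<Sum>y\<in>S n. poisson u v y) / \<rho> n) \<longlonglongrightarrow> pi * d"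
begin

lemma density_nonneg: "d \<ge> 0"
proof -
  have "(\<Sum>y\<in>S n. poisson 0 1 y) / \<rho> n \<ge> 0" for n
    using \<rho>_pos[of n] by (auto intro!: divide_nonneg_pos sum_nonneg poisson_nonneg)
  then have "pi * d \<ge> 0" by (intro LIMSEQ_le_const[OF means[of 1 0]]) auto
  then show ?thesis using pi_gt_zero by (simp add: zero_le_mult_iff)
qed

lemma weight_mass_bounded: "\<exists>B>0. \<forall>n. (\<Sum>y\<in>S n. 1 / (1 + y\<^sup>2)) / \<rho> n \<le> B"
proof -
  have "Bseq (\<lambda>n. (\<Sum>y\<in>S n. 1 / (1 + y\<^sup>2)) / \<rho> n)"
    using means[of 1 0] by (auto simp: poisson_unit intro: convergent_imp_Bseq convergentI)
  then obtain B where "B > 0" "\<forall>n. norm ((\<Sum>y\<in>S n. 1 / (1 + y\<^sup>2)) / \<rho> n) \<le> B" by (rule BseqE)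
  then show ?thesis by (metis abs_le_D1 real_norm_def)
qed

text \<open>For the Poisson integral of \<open>\<phi>\<close> the claim is the hypothesis on the means, integrated against \<open>\<phi>\<close>; the
difference to \<open>\<phi>\<close> is small on the weight \<open>1 / (1 + x\<^sup>2)\<close>.\<close>

lemma compactly_supported_convergence:
  fixes \<phi> :: "real \<Rightarrow> real"
  assumes cont: "continuous_on UNIV \<phi>" and supp: "\<And>x. \<bar>x\<bar> > R \<Longrightarrow> \<phi> x = 0" and R: "R > 0"
  shows "(\<lambda>n. (\<Sum>y\<in>S n. \<phi> y) / \<rho> n) \<longlonglongrightarrow> d * (LINT x|lborel. \<phi> x)"
proof -
  define Q where "Q = 2 * R + 3"
  have Q: "Q > 0" "Q > R" using R by (auto simp: Q_def)
  have contQ: "continuous_on {-Q..Q} \<phi>" using cont continuous_on_subset by blast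
  have "compact (\<phi> ` {-Q..Q})" using contQ by (intro compact_continuous_image) auto
  then obtain M where M: "\<And>u. u \<in> {-Q..Q} \<Longrightarrow> \<bar>\<phi> u\<bar> \<le> M" using compact_imp_bounded bounded_iff
    by (metis imageI real_norm_def)
  obtain B where B: "B > 0" "\<And>n. (\<Sum>y\<in>S n. 1 / (1 + y\<^sup>2)) / \<rho> n \<le> B" using weight_mass_bounded by blast
  have "(LINT x|lborel. \<phi> x) = (LINT x:{-Q..Q}|lborel. \<phi> x)"
  proof -
    have "\<phi> x = indicator {-Q..Q} x *\<^sub>R \<phi> x" for x
      using supp[of x] Q by (cases "x \<in> {-Q..Q}") auto
    then show ?thesis unfolding set_lebesgue_integral_def by (intro Bochner_Integration.integral_cong) auto
  qed
  also have "\<dots> = integral {-Q..Q} \<phi>"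
    by (rule set_borel_integral_eq_integral(2)[OF borel_integrable_atLeastAtMost'[OF contQ]])
  finally have L: "(LINT x|lborel. \<phi> x) = integral {-Q..Q} \<phi>" .
  show ?thesis
    unfolding L
  proof (rule tendsto_approx)
    fix e :: real assume e: "e > 0"
    obtain v where v: "v > 0" "\<And>x. \<bar>\<phi> x - integral {-Q..Q} (\<lambda>u. \<phi> u * poisson u v x) / pi\<bar> \<le> (e / B) / (1 + x\<^sup>2)"
      using poisson_smoothing[OF cont supp R _ Q_def, of "e / B"] e B(1) by auto
    let ?s = "\<lambda>x. integral {-Q..Q} (\<lambda>u. \<phi> u * poisson u v x) / pi"
    let ?H = "\<lambda>n u. (\<Sum>y\<in>S n. poisson u v y) / \<rho> n"
    define C where "C = v * (2 + (1 + 2 * Q\<^sup>2) / v\<^sup>2)"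
    have C: "C > 0" using v(1) by (simp add: C_def add_pos_nonneg)
    have contH: "continuous_on {-Q..Q} (\<lambda>u. \<phi> u * ?H n u)" for n
      using \<rho>_pos[of n] by (intro continuous_intros contQ continuous_on_poisson v ballI) auto
    have H_le: "\<bar>?H n u\<bar> \<le> C * B" if "u \<in> {-Q..Q}" for n u
    proof -
      have "0 \<le> ?H n u" using \<rho>_pos[of n] by (auto intro!: divide_nonneg_pos sum_nonneg poisson_nonneg v)
      moreover have "?H n u \<le> (\<Sum>y\<in>S n. C * (1 / (1 + y\<^sup>2))) / \<rho> n"
        using \<rho>_pos[of n] that unfolding C_def
        by (intro divide_right_mono sum_mono poisson_le_weight v) auto
      moreover have "\<dots> = C * ((\<Sum>y\<in>S n. 1 / (1 + y\<^sup>2)) / \<rho> n)"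
        by (subst sum_distrib_left[symmetric]) simp
      moreover have "\<dots> \<le> C * B" using B(2) C by (intro mult_left_mono) auto
      ultimately show ?thesis by linarith
    qed
    have "(\<lambda>n. integral {-Q..Q} (\<lambda>u. \<phi> u * ?H n u)) \<longlonglongrightarrow> integral {-Q..Q} (\<lambda>u. \<phi> u * (pi * d))"
    proof (rule dominated_convergence(2)[where h = "\<lambda>_. M * (C * B)"])
      show "(\<lambda>u. \<phi> u * ?H n u) integrable_on {-Q..Q}" for n
        by (rule integrable_continuous_interval[OF contH])
      show "norm (\<phi> u * ?H n u) \<le> M * (C * B)" if "u \<in> {-Q..Q}" for n u
        unfolding real_norm_def abs_mult using M[OF that] H_le[OF that] by (intro mult_mono) auto
      show "(\<lambda>n. \<phi> u * ?H n u) \<longlonglongrightarrow> \<phi> u * (pi * d)" for u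
        by (intro tendsto_intros means v)
    qed auto
    then have lim: "(\<lambda>n. integral {-Q..Q} (\<lambda>u. \<phi> u * ?H n u) / pi) \<longlonglongrightarrow> integral {-Q..Q} (\<lambda>u. \<phi> u * (pi * d)) / pi"
      by (intro tendsto_intros) auto
    have "integral {-Q..Q} (\<lambda>u. \<phi> u * ?H n u) / pi = (\<Sum>y\<in>S n. ?s y) / \<rho> n" for n
    proof -
      have "integral {-Q..Q} (\<lambda>u. \<phi> u * ?H n u) = integral {-Q..Q} (\<lambda>u. (\<Sum>y\<in>S n. \<phi> u * poisson u v y) / \<rho> n)"
        by (simp add: sum_distrib_left)
      also have "\<dots> = integral {-Q..Q} (\<lambda>u. \<Sum>y\<in>S n. \<phi> u * poisson u v y) / \<rho> n"
        by simp
      also have "integral {-Q..Q} (\<lambda>u. \<Sum>y\<in>S n. \<phi> u * poisson u v y) = (\<Sum>y\<in>S n. integral {-Q..Q} (\<lambda>u. \<phi> u * poisson u v y))"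
        by (intro integral_sum fin integrable_continuous_interval continuous_intros contQ continuous_on_poisson v)
      finally show ?thesis by (simp add: sum_divide_distrib mult.commute)
    qed
    with lim have "(\<lambda>n. (\<Sum>y\<in>S n. ?s y) / \<rho> n) \<longlonglongrightarrow> d * integral {-Q..Q} \<phi>" by (simp add: mult_ac)
    moreover have "\<bar>(\<Sum>y\<in>S n. \<phi> y) / \<rho> n - (\<Sum>y\<in>S n. ?s y) / \<rho> n\<bar> \<le> e" for n
    proof -
      have "\<bar>(\<Sum>y\<in>S n. \<phi> y) / \<rho> n - (\<Sum>y\<in>S n. ?s y) / \<rho> n\<bar> = \<bar>\<Sum>y\<in>S n. \<phi> y - ?s y\<bar> / \<rho> n"
        using \<rho>_pos[of n] by (simp add: sum_subtractf diff_divide_distrib[symmetric])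
      also have "\<dots> \<le> (\<Sum>y\<in>S n. (e / B) / (1 + y\<^sup>2)) / \<rho> n"
        using \<rho>_pos[of n] v(2) by (intro divide_right_mono order_trans[OF sum_abs] sum_mono) auto
      also have "\<dots> = (e / B) * ((\<Sum>y\<in>S n. 1 / (1 + y\<^sup>2)) / \<rho> n)"
        by (simp add: sum_distrib_left)
      also have "\<dots> \<le> (e / B) * B" using B e by (intro mult_left_mono) auto
      finally show ?thesis using B by simp
    qed
    ultimately show "\<exists>g l. g \<longlonglongrightarrow> l \<and> (\<forall>\<^sub>F n in sequentially. \<bar>(\<Sum>y\<in>S n. \<phi> y) / \<rho> n - g n\<bar> \<le> e)
        \<and> \<bar>l - d * integral {-Q..Q} \<phi>\<bar> \<le> e"
      using e by (intro exI[of _ "\<lambda>n. (\<Sum>y\<in>S n. ?s y) / \<rho> n"] exI[of _ "d * integral {-Q..Q} \<phi>"]) auto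
  qed
qed

text \<open>A cutoff reduces to compact support. The mass of the weight \<open>1 / (1 + x\<^sup>2)\<close> outside a large interval is
small in the limit, because this weight is a Poisson kernel: its total mass converges to the mass under \<open>d\<close> times
Lebesgue measure, so nothing escapes to infinity.\<close>

lemma weighted_convergence:
  fixes f :: "real \<Rightarrow> real"
  assumes cont: "continuous_on UNIV f" and bound: "\<And>x. (1 + x\<^sup>2) * \<bar>f x\<bar> \<le> C"
  shows "integrable lborel f" "(\<lambda>n. (\<Sum>y\<in>S n. f y) / \<rho> n) \<longlonglongrightarrow> d * (LINT x|lborel. f x)"
proof -
  define cut where "cut k x = max 0 (min 1 (real k + 1 - \<bar>x\<bar>))" for k :: nat and x :: real
  let ?g = "\<lambda>x::real. 1 / (1 + x\<^sup>2)"
  have den: "1 + x\<^sup>2 > 0" for x :: real by (simp add: add_pos_nonneg)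
  have cut_01: "0 \<le> cut k x" "cut k x \<le> 1" for k x by (auto simp: cut_def)
  have cut_cont: "continuous_on UNIV (cut k)" for k unfolding cut_def by (intro continuous_intros)
  have cut_supp: "cut k x = 0" if "\<bar>x\<bar> > real k + 1" for k x using that by (auto simp: cut_def)
  have cut_lim: "(\<lambda>k. cut k x) \<longlonglongrightarrow> 1" for x
  proof (rule tendsto_eventually)
    obtain m :: nat where "real m \<ge> \<bar>x\<bar>" using real_arch_simple by blast
    then show "\<forall>\<^sub>F k in sequentially. cut k x = 1"
      by (intro eventually_sequentiallyI[of m]) (auto simp: cut_def max_def min_def)
  qed
  have gcont: "continuous_on UNIV ?g" by (intro continuous_intros ballI) (metis den less_irrefl)
  have gint: "integrable lborel ?g" and gval: "(LINT x|lborel. ?g x) = pi"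
    using integrable_inverse_1_plus_square LBINT_inverse_1_plus_square
    by (simp_all add: set_integrable_def interval_lebesgue_integral_def set_lebesgue_integral_def inverse_eq_divide)
  have C: "C \<ge> 0" using bound[of 0] by (smt (verit) abs_ge_zero mult_nonneg_nonneg den)
  have fle: "\<bar>f x\<bar> \<le> C * ?g x" for x using bound[of x] den[of x] by (simp add: field_simps)
  have [measurable]: "f \<in> borel_measurable borel" "?g \<in> borel_measurable borel" "cut k \<in> borel_measurable borel" for k
    using cont gcont cut_cont by (auto intro: borel_measurable_continuous_onI)
  show fint: "integrable lborel f"
    by (rule Bochner_Integration.integrable_bound[OF integrable_mult_right[OF gint, of C]]) (use fle C in auto)
  have gcut: "\<bar>?g x * cut k x\<bar> \<le> ?g x" for k x
  proof -
    have "\<bar>?g x * cut k x\<bar> = ?g x * cut k x" by (simp add: cut_01 less_imp_le[OF den])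
    then show ?thesis using cut_01[of k x] less_imp_le[OF den[of x]] by (metis divide_nonneg_nonneg mult_left_le zero_le_one)
  qed
  have gk: "(\<lambda>k. LINT x|lborel. ?g x * cut k x) \<longlonglongrightarrow> pi"
    unfolding gval[symmetric]
  proof (rule integral_dominated_convergence[where w = ?g])
    show "AE x in lborel. (\<lambda>k. ?g x * cut k x) \<longlonglongrightarrow> ?g x"
    proof (rule AE_I2)
      fix x
      have "(\<lambda>k. ?g x * cut k x) \<longlonglongrightarrow> ?g x * 1" by (intro tendsto_intros cut_lim)
      then show "(\<lambda>k. ?g x * cut k x) \<longlonglongrightarrow> ?g x" by simp
    qed
    show "AE x in lborel. norm (?g x * cut k x) \<le> ?g x" for k
      by (intro AE_I2) (simp only: real_norm_def gcut)
  qed (use gint in auto)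
  have gkint: "integrable lborel (\<lambda>x. ?g x * cut k x)" for k
    by (rule Bochner_Integration.integrable_bound[OF gint])
      (measurable, use gcut in \<open>intro AE_I2, unfold real_norm_def, blast intro: order_trans[OF _ abs_ge_self]\<close>)
  have fkint: "integrable lborel (\<lambda>x. f x * cut k x)" for k
    by (rule Bochner_Integration.integrable_bound[OF fint])
      (use cut_01 in \<open>auto simp: abs_mult intro!: mult_left_le\<close>)
  have tail: "\<bar>f x - f x * cut k x\<bar> \<le> C * (?g x - ?g x * cut k x)" for k x
  proof -
    have "f x - f x * cut k x = f x * (1 - cut k x)" "?g x - ?g x * cut k x = ?g x * (1 - cut k x)"
      by (simp_all only: right_diff_distrib mult_1_right)
    then show ?thesis using mult_right_mono[OF fle[of x], of "1 - cut k x"] cut_01[of k x]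
      by (simp add: abs_mult mult.assoc)
  qed
  show "(\<lambda>n. (\<Sum>y\<in>S n. f y) / \<rho> n) \<longlonglongrightarrow> d * (LINT x|lborel. f x)"
  proof (rule tendsto_approx)
    fix e :: real assume e: "e > 0"
    have "(\<lambda>k. C * (d * (pi - (LINT x|lborel. ?g x * cut k x)))) \<longlonglongrightarrow> C * (d * (pi - pi))"
      by (intro tendsto_intros gk)
    then have "\<forall>\<^sub>F k in sequentially. C * (d * (pi - (LINT x|lborel. ?g x * cut k x))) < e"
      using e by (intro order_tendstoD) auto
    then obtain k where k: "C * (d * (pi - (LINT x|lborel. ?g x * cut k x))) < e"
      by (meson eventually_happens trivial_limit_sequentially)
    let ?G = "\<lambda>n. (\<Sum>y\<in>S n. f y * cut k y) / \<rho> n"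
    have "?G \<longlonglongrightarrow> d * (LINT x|lborel. f x * cut k x)"
      by (rule compactly_supported_convergence[of _ "real k + 1"])
        (use cont cut_cont cut_supp in \<open>auto intro!: continuous_intros\<close>)
    moreover have gk_lim: "(\<lambda>n. (\<Sum>y\<in>S n. ?g y * cut k y) / \<rho> n)
        \<longlonglongrightarrow> d * (LINT x|lborel. ?g x * cut k x)"
      by (rule compactly_supported_convergence[OF continuous_on_mult[OF gcont cut_cont], of "real k + 1"])
        (simp_all add: cut_supp)
    have "(\<lambda>n. C * ((\<Sum>y\<in>S n. ?g y) / \<rho> n - (\<Sum>y\<in>S n. ?g y * cut k y) / \<rho> n))
        \<longlonglongrightarrow> C * (pi * d - d * (LINT x|lborel. ?g x * cut k x))"
      using means[of 1 0] unfolding poisson_unit by (intro tendsto_intros gk_lim) simp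
    then have "\<forall>\<^sub>F n in sequentially. C * ((\<Sum>y\<in>S n. ?g y) / \<rho> n - (\<Sum>y\<in>S n. ?g y * cut k y) / \<rho> n) < e"
      using k by (intro order_tendstoD) (auto simp: algebra_simps)
    then have "\<forall>\<^sub>F n in sequentially. \<bar>(\<Sum>y\<in>S n. f y) / \<rho> n - ?G n\<bar> \<le> e"
    proof eventually_elim
      case (elim n)
      have "\<bar>(\<Sum>y\<in>S n. f y) / \<rho> n - ?G n\<bar> = \<bar>\<Sum>y\<in>S n. f y - f y * cut k y\<bar> / \<rho> n"
        using \<rho>_pos[of n] by (simp add: sum_subtractf diff_divide_distrib[symmetric])
      also have "\<dots> \<le> (\<Sum>y\<in>S n. C * (?g y - ?g y * cut k y)) / \<rho> n"
        using \<rho>_pos[of n] tail by (intro divide_right_mono order_trans[OF sum_abs] sum_mono) auto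
      also have "\<dots> = C * ((\<Sum>y\<in>S n. ?g y) / \<rho> n - (\<Sum>y\<in>S n. ?g y * cut k y) / \<rho> n)"
        by (simp only: sum_distrib_left[symmetric] sum_subtractf diff_divide_distrib[symmetric] times_divide_eq_right)
      finally show ?case using elim by linarith
    qed
    moreover have "\<bar>d * (LINT x|lborel. f x * cut k x) - d * (LINT x|lborel. f x)\<bar> \<le> e"
    proof -
      have "\<bar>(LINT x|lborel. f x) - (LINT x|lborel. f x * cut k x)\<bar> = \<bar>LINT x|lborel. f x - f x * cut k x\<bar>"
        using fint fkint by simp
      also have "\<dots> \<le> (LINT x|lborel. \<bar>f x - f x * cut k x\<bar>)"
        using integral_abs_bound by blast
      also have "\<dots> \<le> (LINT x|lborel. C * (?g x - ?g x * cut k x))"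
        using fint fkint gint gkint tail by (intro integral_mono) auto
      also have "\<dots> = C * (pi - (LINT x|lborel. ?g x * cut k x))"
        using gint gkint by (simp add: gval)
      finally have "d * \<bar>(LINT x|lborel. f x) - (LINT x|lborel. f x * cut k x)\<bar> \<le> d * (C * (pi - (LINT x|lborel. ?g x * cut k x)))"
        using density_nonneg by (intro mult_left_mono)
      then have "\<bar>d * ((LINT x|lborel. f x) - (LINT x|lborel. f x * cut k x))\<bar> \<le> e"
        using k density_nonneg by (simp add: abs_mult mult_ac)
      then show ?thesis by (simp add: right_diff_distrib abs_minus_commute)
    qed
    ultimately show "\<exists>g l. g \<longlonglongrightarrow> l \<and> (\<forall>\<^sub>F n in sequentially. \<bar>(\<Sum>y\<in>S n. f y) / \<rho> n - g n\<bar> \<le> e)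
        \<and> \<bar>l - d * (LINT x|lborel. f x)\<bar> \<le> e" by blast
  qed
qed

end

text \<open>The kernel is half the derivative of \<open>ln ((y - u)\<^sup>2 + v\<^sup>2)\<close> in \<open>v\<close>. No differentiation of a limit
is needed: \<open>ln x \<le> x - 1\<close> bounds the logarithm of a quotient by a multiple of the kernel at \<open>v\<close>,
and the sign of that multiple depends on the side from which \<open>t\<close> approaches \<open>v\<close>. So the Poisson means are
squeezed between difference quotients with \<open>t > v\<close> and with \<open>t < v\<close>.\<close>

lemma poisson_means_from_log_means:
  fixes S :: "nat \<Rightarrow> real set" and \<rho> :: "nat \<Rightarrow> real"
  assumes fin: "\<And>n. finite (S n)" and \<rho>: "\<And>n. \<rho> n > 0"
    and logs: "\<And>v v'. v > 0 \<Longrightarrow> v' > 0 \<Longrightarrow>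
      (\<lambda>n. (\<Sum>y\<in>S n. ln (((y - u)\<^sup>2 + v\<^sup>2) / ((y - u)\<^sup>2 + v'\<^sup>2))) / \<rho> n) \<longlonglongrightarrow> (v - v') * (2 * c)"
    and v: "v > 0"
  shows "(\<lambda>n. (\<Sum>y\<in>S n. poisson u v y) / \<rho> n) \<longlonglongrightarrow> c"
proof -
  let ?P = "\<lambda>n. (\<Sum>y\<in>S n. poisson u v y) / \<rho> n"
  let ?A = "\<lambda>t y. (y - u)\<^sup>2 + t\<^sup>2"
  let ?F = "\<lambda>t n. v / (t\<^sup>2 - v\<^sup>2) * ((\<Sum>y\<in>S n. ln (?A t y / ?A v y)) / \<rho> n)"
  have pos: "?A t y > 0" if "t > 0" for t y using that poisson_denominator_pos[of t y u] by simp
  have F: "?F t \<longlonglongrightarrow> 2 * c * v / (t + v)" if t: "t > 0" "t \<noteq> v" for t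
  proof -
    have "?F t \<longlonglongrightarrow> v / (t\<^sup>2 - v\<^sup>2) * ((t - v) * (2 * c))" by (intro tendsto_intros logs t v)
    also have "v / (t\<^sup>2 - v\<^sup>2) * ((t - v) * (2 * c)) = 2 * c * v / (t + v)"
    proof -
      have "t\<^sup>2 - v\<^sup>2 = (t - v) * (t + v)" by (simp add: power2_eq_square algebra_simps)
      then show ?thesis using t v by simp
    qed
    finally show ?thesis .
  qed
  have point: "ln (?A t y / ?A v y) \<le> (t\<^sup>2 - v\<^sup>2) / v * poisson u v y" if t: "t > 0" for t y
  proof -
    have "ln (?A t y / ?A v y) \<le> ?A t y / ?A v y - 1"
      using pos[OF t, of y] pos[OF v, of y] by (intro ln_le_minus_one) simp
    also have "\<dots> = (?A t y - ?A v y) / ?A v y"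
      using pos[OF v, of y] by (metis diff_divide_distrib divide_self less_irrefl)
    also have "\<dots> = (t\<^sup>2 - v\<^sup>2) / v * poisson u v y"
      using v by (simp add: poisson_def)
    finally show ?thesis .
  qed
  have mean: "(\<Sum>y\<in>S n. ln (?A t y / ?A v y)) / \<rho> n \<le> (t\<^sup>2 - v\<^sup>2) / v * ?P n" if t: "t > 0" for t n
  proof -
    have "(\<Sum>y\<in>S n. ln (?A t y / ?A v y)) / \<rho> n \<le> (\<Sum>y\<in>S n. (t\<^sup>2 - v\<^sup>2) / v * poisson u v y) / \<rho> n"
      using \<rho>[of n] point[OF t] by (intro divide_right_mono sum_mono) auto
    then show ?thesis by (simp only: sum_distrib_left[symmetric] times_divide_eq_right)
  qed
  have lower: "?F t n \<le> ?P n" if t: "t > v" for t n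
  proof -
    have p: "t\<^sup>2 - v\<^sup>2 > 0" using t v by (simp add: power_strict_mono)
    then have "v / (t\<^sup>2 - v\<^sup>2) * ((\<Sum>y\<in>S n. ln (?A t y / ?A v y)) / \<rho> n) \<le> v / (t\<^sup>2 - v\<^sup>2) * ((t\<^sup>2 - v\<^sup>2) / v * ?P n)"
      using t v by (intro mult_left_mono mean) auto
    then show ?thesis using p v by simp
  qed
  have upper: "?P n \<le> ?F t n" if t: "0 < t" "t < v" for t n
  proof -
    have p: "t\<^sup>2 - v\<^sup>2 < 0" using t by (simp add: power_strict_mono)
    then have "v / (t\<^sup>2 - v\<^sup>2) * ((t\<^sup>2 - v\<^sup>2) / v * ?P n) \<le> v / (t\<^sup>2 - v\<^sup>2) * ((\<Sum>y\<in>S n. ln (?A t y / ?A v y)) / \<rho> n)"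
      using t v by (intro mult_left_mono_neg mean) (auto intro: divide_nonneg_neg)
    then show ?thesis using p v by simp
  qed
  have cont: "((\<lambda>t. 2 * c * v / (t + v)) \<longlongrightarrow> c) (at v within A)" for A
  proof -
    have "((\<lambda>t. 2 * c * v / (t + v)) \<longlongrightarrow> 2 * c * v / (v + v)) (at v within A)"
      using v by (intro tendsto_intros) auto
    then show ?thesis using v by simp
  qed
  show ?thesis
  proof (rule order_tendstoI)
    fix x assume "x < c"
    then have "\<forall>\<^sub>F t in at_right v. x < 2 * c * v / (t + v)" using order_tendstoD(1)[OF cont] by blast
    moreover have "\<forall>\<^sub>F t in at_right v. v < t" by (simp add: eventually_at_right_less)
    ultimately have "\<forall>\<^sub>F t in at_right v. x < 2 * c * v / (t + v) \<and> v < t" by (rule eventually_conj)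
    then obtain t where t: "x < 2 * c * v / (t + v)" "v < t"
      using eventually_happens trivial_limit_at_right_real by blast
    have "\<forall>\<^sub>F n in sequentially. x < ?F t n" using order_tendstoD(1)[OF F t(1)] t v by simp
    then show "\<forall>\<^sub>F n in sequentially. x < ?P n"
      by eventually_elim (use lower[OF t(2)] in \<open>blast intro: less_le_trans\<close>)
  next
    fix x assume "c < x"
    then have "\<forall>\<^sub>F t in at_left v. 2 * c * v / (t + v) < x" using order_tendstoD(2)[OF cont] by blast
    moreover have "\<forall>\<^sub>F t in at_left v. t \<in> {0<..<v}" by (rule eventually_at_leftI[OF _ v]) auto
    ultimately have "\<forall>\<^sub>F t in at_left v. 2 * c * v / (t + v) < x \<and> t \<in> {0<..<v}" by (rule eventually_conj)
    then obtain t where t: "2 * c * v / (t + v) < x" "0 < t" "t < v"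
      using eventually_happens trivial_limit_at_left_real by force
    have "\<forall>\<^sub>F n in sequentially. ?F t n < x" using order_tendstoD(2)[OF F t(1)] t by simp
    then show "\<forall>\<^sub>F n in sequentially. ?P n < x"
      by eventually_elim (use upper[OF t(2,3)] in \<open>blast intro: le_less_trans\<close>)
  qed
qed

section \<open>Orthonormal polynomials and the spectrum of the truncations\<close>

fun orthonormal :: "(nat \<Rightarrow> real) \<Rightarrow> (nat \<Rightarrow> real) \<Rightarrow> 'a::real_normed_field \<Rightarrow> nat \<Rightarrow> 'a" where
  "orthonormal a b z 0 = 1"
| "orthonormal a b z (Suc 0) = (z - of_real (b 0)) / of_real (a 0)"
| "orthonormal a b z (Suc (Suc n)) =
     ((z - of_real (b (Suc n))) * orthonormal a b z (Suc n) - of_real (a n) * orthonormal a b z n)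
       / of_real (a (Suc n))"

lemma orthonormal_three_term:
  assumes "a n > 0"
  shows "of_real (a n) * orthonormal a b z (Suc n) =
    (z - of_real (b n)) * orthonormal a b z n - (if n = 0 then 0 else of_real (a (n - 1)) * orthonormal a b z (n - 1))"
  using assms by (cases n) (auto simp: field_simps)

lemma jacobi_row_sum:
  assumes "i \<le> n"
  shows "(\<Sum>j<Suc n. jacobi a b i j * x j) =
    (if i = 0 then 0 else a (i - 1) * x (i - 1)) + b i * x i + (if i < n then a i * x (Suc i) else 0)"
proof -
  have "(\<Sum>j<Suc n. jacobi a b i j * x j) =
    (\<Sum>j<Suc n. (if j = i then b i * x i else 0) + (if j = Suc i then a i * x (Suc i) else 0)
      + (if i = Suc j then a j * x j else 0))"
    by (intro sum.cong) (auto simp: jacobi_def)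
  also have "\<dots> = b i * x i + (if i < n then a i * x (Suc i) else 0)
      + (\<Sum>j<Suc n. if i = Suc j then a j * x j else 0)"
    using assms by (simp add: sum.distrib sum.delta del: sum.lessThan_Suc)
  also have "(\<Sum>j<Suc n. if i = Suc j then a j * x j else 0) =
      (\<Sum>j<Suc n. if j = i - 1 then (if i = 0 then 0 else a (i - 1) * x (i - 1)) else 0)"
    by (intro sum.cong) auto
  also have "\<dots> = (if i = 0 then 0 else a (i - 1) * x (i - 1))"
    using assms by (simp add: sum.delta del: sum.lessThan_Suc)
  finally show ?thesis by simp
qed

text \<open>The rows of the eigenvalue equation are the three-term recurrence, so an eigenvector is a multiple of
\<open>(p\<^sub>0(y), \<dots>, p\<^sub>n(y))\<close>; the last row, in which the next entry is missing, says \<open>p\<^sub>n\<^sub>+\<^sub>1(y) = 0\<close>.\<close>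

lemma spectrum_jacobi_trunc:
  fixes a b :: "nat \<Rightarrow> real"
  assumes a: "\<forall>n. a n > 0"
  shows "spectrum (jacobi_trunc a b (Suc n)) = {y. orthonormal a b y (Suc n) = 0}"
proof -
  let ?J = "jacobi_trunc a b (Suc n)"
  have dim: "dim_row ?J = Suc n" "dim_col ?J = Suc n" by (auto simp: jacobi_trunc_def)
  have row: "vec_index (?J *\<^sub>v v) i = (if i = 0 then 0 else a (i - 1) * vec_index v (i - 1)) + b i * vec_index v i
      + (if i < n then a i * vec_index v (Suc i) else 0)"
    if "v \<in> carrier_vec (Suc n)" "i \<le> n" for v i
  proof -
    have "vec_index (?J *\<^sub>v v) i = (\<Sum>j<Suc n. jacobi a b i j * vec_index v j)"
      using that by (simp add: jacobi_trunc_def scalar_prod_def atLeast0LessThan)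
    then show ?thesis using jacobi_row_sum[OF that(2)] by simp
  qed
  have "eigenvalue ?J y \<longleftrightarrow> orthonormal a b y (Suc n) = 0" for y
  proof
    assume "eigenvalue ?J y"
    then obtain v where v: "v \<in> carrier_vec (Suc n)" "v \<noteq> 0\<^sub>v (Suc n)" "?J *\<^sub>v v = y \<cdot>\<^sub>v v"
      by (auto simp: eigenvalue_def eigenvector_def dim)
    let ?x = "vec_index v"
    have eq: "(if i = 0 then 0 else a (i - 1) * ?x (i - 1)) + b i * ?x i
      + (if i < n then a i * ?x (Suc i) else 0) = y * ?x i" if "i \<le> n" for i
      using row[OF v(1) that] v that by simp
    have *: "j \<le> n \<Longrightarrow> ?x j = ?x 0 * orthonormal a b y j" for j
    proof (induction j rule: less_induct)
      case (less j)
      show ?case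
      proof (cases j)
        case (Suc i)
        have "a i * ?x (Suc i) = (y - b i) * ?x i - (if i = 0 then 0 else a (i - 1) * ?x (i - 1))"
          using eq[of i] less.prems Suc by (auto simp: algebra_simps)
        also have "\<dots> = ?x 0 * ((y - b i) * orthonormal a b y i - (if i = 0 then 0 else a (i - 1) * orthonormal a b y (i - 1)))"
          using less.IH[of i] less.IH[of "i - 1"] less.prems Suc by (cases "i = 0") (auto simp: algebra_simps)
        also have "\<dots> = a i * (?x 0 * orthonormal a b y (Suc i))"
          using orthonormal_three_term[where a=a and b=b and n=i and z=y] a[rule_format, of i]
          by (simp add: mult.left_commute del: orthonormal.simps)
        finally show ?thesis using a[rule_format, of i] Suc by simp
      qed auto
    qed
    have "?x 0 \<noteq> 0"
    proof
      assume "?x 0 = 0"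
      then have "?x j = 0" if "j \<le> n" for j using *[OF that] by simp
      then have "v = 0\<^sub>v (Suc n)" using v(1) by (intro eq_vecI) (auto simp: less_Suc_eq_le)
      with v(2) show False by simp
    qed
    have "a n * (?x 0 * orthonormal a b y (Suc n)) =
       ?x 0 * ((y - b n) * orthonormal a b y n - (if n = 0 then 0 else a (n - 1) * orthonormal a b y (n - 1)))"
      using orthonormal_three_term[where a=a and b=b and n=n and z=y] a[rule_format, of n]
      by (simp add: mult.left_commute del: orthonormal.simps)
    also have "\<dots> = (y - b n) * ?x n - (if n = 0 then 0 else a (n - 1) * ?x (n - 1))"
      using *[of n] *[of "n - 1"] by (cases "n = 0") (auto simp: algebra_simps)
    also have "\<dots> = 0" using eq[of n] by (auto simp: algebra_simps)
    finally show "orthonormal a b y (Suc n) = 0" using \<open>?x 0 \<noteq> 0\<close> a[rule_format, of n] by simp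
  next
    assume z: "orthonormal a b y (Suc n) = 0"
    define v where "v = vec (Suc n) (orthonormal a b y)"
    have vc: "v \<in> carrier_vec (Suc n)" by (auto simp: v_def)
    have "vec_index v 0 = 1" by (simp add: v_def)
    then have v0: "v \<noteq> 0\<^sub>v (Suc n)" by auto
    have "?J *\<^sub>v v = y \<cdot>\<^sub>v v"
    proof (rule eq_vecI)
      fix i assume "i < dim_vec (y \<cdot>\<^sub>v v)"
      then have i: "i \<le> n" by (simp add: v_def)
      have "(if i < n then a i * vec_index v (Suc i) else 0) = a i * orthonormal a b y (Suc i)"
        using i z by (auto simp: v_def not_less)
      then show "vec_index (?J *\<^sub>v v) i = vec_index (y \<cdot>\<^sub>v v) i"
        unfolding row[OF vc i] using orthonormal_three_term[where a=a and b=b and n=i and z=y] a[rule_format, of i] i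
        by (cases "i = 0") (auto simp: v_def algebra_simps simp del: orthonormal.simps(2,3))
    qed (simp add: v_def dim)
    then show "eigenvalue ?J y" using vc v0 by (auto simp: eigenvalue_def eigenvector_def dim)
  qed
  then show ?thesis by (auto simp: spectrum_def)
qed

definition ratio :: "(nat \<Rightarrow> real) \<Rightarrow> (nat \<Rightarrow> real) \<Rightarrow> complex \<Rightarrow> nat \<Rightarrow> complex" where
  "ratio a b z n = orthonormal a b z (Suc n) / orthonormal a b z n"

text \<open>The two claims support each other: the recursion for the ratio maps the upper half-plane into itself,
and a ratio in the upper half-plane keeps the next polynomial away from 0.\<close>

lemma ratio_upper_aux:
  assumes a: "\<forall>n. a n > 0" and z: "Im z > 0"
  shows "orthonormal a b z n \<noteq> 0 \<and> Im (ratio a b z n) > 0"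
proof (induction n)
  case 0
  then show ?case using a[rule_format, of 0] z by (auto simp: ratio_def)
next
  case (Suc n)
  have r0: "ratio a b z n \<noteq> 0" using Suc by auto
  then have p: "orthonormal a b z (Suc n) \<noteq> 0" "orthonormal a b z n \<noteq> 0" by (auto simp: ratio_def)
  have "ratio a b z (Suc n) =
     (z - of_real (b (Suc n))) / of_real (a (Suc n)) - of_real (a n / a (Suc n)) * inverse (ratio a b z n)"
    using p a[rule_format, of "Suc n"] by (simp add: ratio_def field_simps)
  then have "Im (ratio a b z (Suc n)) = Im z / a (Suc n) + a n / a (Suc n) * (Im (ratio a b z n) / (cmod (ratio a b z n))\<^sup>2)"
    by (simp add: complex_inverse Im_divide_of_real cmod_power2 del: of_real_divide)
  also have "\<dots> > 0" using a[rule_format, of n] a[rule_format, of "Suc n"] z Suc r0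
    by (intro add_pos_pos divide_pos_pos mult_pos_pos) auto
  finally show ?case using p by simp
qed

lemma orthonormal_nonzero: "\<forall>n. a n > 0 \<Longrightarrow> Im z > 0 \<Longrightarrow> orthonormal a b z n \<noteq> 0"
  and Im_ratio_pos: "\<forall>n. a n > 0 \<Longrightarrow> Im z > 0 \<Longrightarrow> Im (ratio a b z n) > 0"
  using ratio_upper_aux by blast+

lemma ratio_0: "ratio a b z 0 = (z - of_real (b 0)) / of_real (a 0)"
  by (simp add: ratio_def)

lemma ratio_Suc:
  assumes a: "\<forall>n. a n > 0" and z: "Im z > 0"
  shows "ratio a b z (Suc n) =
    (z - of_real (b (Suc n))) / of_real (a (Suc n)) - of_real (a n / a (Suc n)) / ratio a b z n"
  using orthonormal_nonzero[OF a z, of b n] orthonormal_nonzero[OF a z, of b "Suc n"] a[rule_format, of "Suc n"]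
  by (simp add: ratio_def field_simps)

text \<open>This is the reciprocal of the imaginary part of \<open>- 1 / r\<close>.\<close>

definition recip_height :: "complex \<Rightarrow> real" where
  "recip_height r = (cmod r)\<^sup>2 / Im r"

lemma recip_height_pos: "Im r > 0 \<Longrightarrow> recip_height r > 0"
  by (auto simp: recip_height_def intro!: divide_pos_pos)

text \<open>The energy \<open>a\<^sub>n |p\<^sub>n|\<^sup>2 Im r\<^sub>n\<close>, which is the Wronskian of \<open>p\<close> and its conjugate up to a constant,
starts at \<open>Im z\<close> and is increased by \<open>Im z |p\<^sub>n\<^sub>+\<^sub>1|\<^sup>2\<close> in the step from \<open>n\<close> to \<open>n + 1\<close>. The factors of
the product are the quotients of consecutive energies. The identity is exact, so that it loses none of
the precision needed for the logarithms.\<close>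

lemma cmod_orth_product:
  assumes a: "\<forall>n. a n > 0" and z: "Im z > 0"
  shows "(cmod (orthonormal a b z (Suc n)))\<^sup>2 =
    Im z * recip_height (ratio a b z n) / a n * (\<Prod>k<n. 1 + Im z * recip_height (ratio a b z k) / a k)"
proof (induction n)
  case 0
  have "orthonormal a b z (Suc 0) = ratio a b z 0" by (simp add: ratio_def)
  moreover have "Im (ratio a b z 0) = Im z / a 0" by (simp add: ratio_0 Im_divide_of_real)
  ultimately show ?case using a[rule_format, of 0] z by (simp add: recip_height_def)
next
  case (Suc n)
  let ?r = "ratio a b z"
  have I: "Im (?r n) > 0" "Im (?r (Suc n)) > 0" using Im_ratio_pos[OF a z] by auto
  then have nz: "?r n \<noteq> 0" "?r (Suc n) \<noteq> 0" by auto
  have Im: "Im (?r (Suc n)) = Im z / a (Suc n) + a n / a (Suc n) / recip_height (?r n)"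
    unfolding ratio_Suc[OF a z] divide_inverse[of _ "?r n"] recip_height_def
    by (simp add: complex_inverse Im_divide_of_real cmod_power2 del: of_real_divide)
  have "orthonormal a b z (Suc (Suc n)) = ?r (Suc n) * orthonormal a b z (Suc n)"
    using orthonormal_nonzero[OF a z] by (simp add: ratio_def)
  then have "(cmod (orthonormal a b z (Suc (Suc n))))\<^sup>2 = (cmod (?r (Suc n)))\<^sup>2 * (cmod (orthonormal a b z (Suc n)))\<^sup>2"
    by (simp add: norm_mult power_mult_distrib)
  also have "\<dots> = recip_height (?r (Suc n)) * (Im (?r (Suc n)) * (Im z * recip_height (?r n) / a n)) *
      (\<Prod>k<n. 1 + Im z * recip_height (?r k) / a k)"
    using Suc I by (simp add: recip_height_def)
  also have "Im (?r (Suc n)) * (Im z * recip_height (?r n) / a n) = Im z / a (Suc n) * (1 + Im z * recip_height (?r n) / a n)"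
    unfolding Im using a[rule_format, of n] a[rule_format, of "Suc n"] recip_height_pos[OF I(1)] by (simp add: field_simps)
  finally show ?case by (simp add: mult_ac)
qed

fun orthonormal_poly :: "(nat \<Rightarrow> real) \<Rightarrow> (nat \<Rightarrow> real) \<Rightarrow> nat \<Rightarrow> complex poly" where
  "orthonormal_poly a b 0 = 1"
| "orthonormal_poly a b (Suc 0) = Polynomial.smult (inverse (of_real (a 0))) [:- of_real (b 0), 1:]"
| "orthonormal_poly a b (Suc (Suc n)) = Polynomial.smult (inverse (of_real (a (Suc n))))
     ([:- of_real (b (Suc n)), 1:] * orthonormal_poly a b (Suc n) - Polynomial.smult (of_real (a n)) (orthonormal_poly a b n))"

lemma poly_orthonormal_poly: "poly (orthonormal_poly a b n) z = orthonormal a b z n"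
  by (induction n rule: induct_nat_012) (auto simp: divide_inverse algebra_simps)

lemma orthonormal_of_real: "orthonormal a b (complex_of_real x) n = of_real (orthonormal a b x n)"
  by (induction n rule: induct_nat_012) auto

lemma orthonormal_cnj: "orthonormal a b (cnj z) n = cnj (orthonormal a b z n)"
  by (induction n rule: induct_nat_012) auto

text \<open>At a real zero of \<open>p\<^sub>n\<^sub>+\<^sub>1\<close> the right-hand side is positive, which excludes a double zero.\<close>

lemma christoffel_darboux_confluent:
  assumes a: "\<forall>n. a n > 0"
  shows "of_real (a n) * (poly (pderiv (orthonormal_poly a b (Suc n))) z * orthonormal a b z n
      - orthonormal a b z (Suc n) * poly (pderiv (orthonormal_poly a b n)) z) = (\<Sum>k\<le>n. (orthonormal a b z k)\<^sup>2)"
proof (induction n)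
  case 0
  show ?case using a[rule_format, of 0] by (simp add: pderiv_smult pderiv_pCons)
next
  case (Suc n)
  have a': "complex_of_real (a (Suc n)) \<noteq> 0" using a[rule_format, of "Suc n"] by simp
  have 1: "of_real (a (Suc n)) * poly (pderiv (orthonormal_poly a b (Suc (Suc n)))) z =
    orthonormal a b z (Suc n) + (z - of_real (b (Suc n))) * poly (pderiv (orthonormal_poly a b (Suc n))) z
      - of_real (a n) * poly (pderiv (orthonormal_poly a b n)) z"
    unfolding orthonormal_poly.simps pderiv_smult pderiv_mult pderiv_diff poly_smult poly_add poly_diff
      poly_mult poly_orthonormal_poly
    using a' by (simp add: pderiv_pCons right_diff_distrib distrib_left flip: mult.assoc)
  have 2: "of_real (a (Suc n)) * orthonormal a b z (Suc (Suc n)) =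
     (z - of_real (b (Suc n))) * orthonormal a b z (Suc n) - of_real (a n) * orthonormal a b z n"
    using a' by simp
  have "of_real (a (Suc n)) * (poly (pderiv (orthonormal_poly a b (Suc (Suc n)))) z * orthonormal a b z (Suc n)
      - orthonormal a b z (Suc (Suc n)) * poly (pderiv (orthonormal_poly a b (Suc n))) z) =
     (of_real (a (Suc n)) * poly (pderiv (orthonormal_poly a b (Suc (Suc n)))) z) * orthonormal a b z (Suc n)
      - (of_real (a (Suc n)) * orthonormal a b z (Suc (Suc n))) * poly (pderiv (orthonormal_poly a b (Suc n))) z"
    by (simp only: right_diff_distrib mult_ac)
  also have "\<dots> = (orthonormal a b z (Suc n))\<^sup>2 + of_real (a n) * (poly (pderiv (orthonormal_poly a b (Suc n))) z * orthonormal a b z n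
      - orthonormal a b z (Suc n) * poly (pderiv (orthonormal_poly a b n)) z)"
    unfolding 1 2 by (simp add: algebra_simps power2_eq_square)
  also have "\<dots> = (\<Sum>k\<le>Suc n. (orthonormal a b z k)\<^sup>2)" unfolding Suc by simp
  finally show ?case .
qed

lemma orthonormal_root_real:
  assumes a: "\<forall>n. a n > 0" and "orthonormal a b z n = 0"
  shows "z = of_real (Re z)"
proof -
  have "\<not> Im z > 0" using orthonormal_nonzero[where a = a, OF a] assms(2) by blast
  moreover have "\<not> Im (cnj z) > 0" using orthonormal_nonzero[where a = a and z = "cnj z", OF a] assms(2) by (auto simp: orthonormal_cnj)
  ultimately show ?thesis by (simp add: complex_eq_iff)
qed

lemma rsquarefree_orthonormal_poly:
  assumes a: "\<forall>n. a n > 0"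
  shows "rsquarefree (orthonormal_poly a b (Suc n))"
  unfolding rsquarefree_roots
proof (intro allI notI)
  fix z assume z: "poly (orthonormal_poly a b (Suc n)) z = 0 \<and> poly (pderiv (orthonormal_poly a b (Suc n))) z = 0"
  then have 0: "orthonormal a b z (Suc n) = 0" by (simp add: poly_orthonormal_poly)
  then obtain x where x: "z = of_real x" using orthonormal_root_real[where a = a, OF a] by blast
  have "(\<Sum>k\<le>n. (orthonormal a b z k)\<^sup>2) = 0"
    using christoffel_darboux_confluent[OF a, where b = b and z = z and n = n] z 0 by simp
  then have "complex_of_real (\<Sum>k\<le>n. (orthonormal a b x k)\<^sup>2) = 0" by (simp add: x orthonormal_of_real)
  then have "(\<Sum>k\<le>n. (orthonormal a b x k)\<^sup>2) = 0" by (simp only: of_real_eq_0_iff)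
  then have "\<forall>k\<in>{..n}. (orthonormal a b x k)\<^sup>2 = 0" by (subst (asm) sum_nonneg_eq_0_iff) auto
  then have "(orthonormal a b x 0)\<^sup>2 = 0" by blast
  then show False by simp
qed

text \<open>Zeros are simple, so the product over the set of eigenvalues accounts for the full polynomial.\<close>

lemma orthonormal_eq_prod_spectrum:
  fixes a b :: "nat \<Rightarrow> real"
  assumes a: "\<forall>n. a n > 0"
  shows "orthonormal a b z (Suc n) = lead_coeff (orthonormal_poly a b (Suc n)) *
     (\<Prod>y\<in>spectrum (jacobi_trunc a b (Suc n)). z - complex_of_real y)"
proof -
  let ?P = "orthonormal_poly a b (Suc n)"
  have roots: "{w. poly ?P w = 0} = of_real ` spectrum (jacobi_trunc a b (Suc n))"
  proof (intro equalityI subsetI)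
    fix w assume "w \<in> {w. poly ?P w = 0}"
    then have w0: "orthonormal a b w (Suc n) = 0" by (simp add: poly_orthonormal_poly)
    then have w: "w = of_real (Re w)" using orthonormal_root_real[where a = a, OF a] by blast
    with w0 have "orthonormal a b (Re w) (Suc n) = 0" by (metis orthonormal_of_real of_real_eq_0_iff)
    then show "w \<in> of_real ` spectrum (jacobi_trunc a b (Suc n))"
      using w by (auto simp: spectrum_jacobi_trunc[OF a] intro: image_eqI[of _ _ "Re w"])
  qed (auto simp: spectrum_jacobi_trunc[OF a] poly_orthonormal_poly orthonormal_of_real simp del: orthonormal.simps)
  have "orthonormal a b z (Suc n) = poly (Polynomial.smult (lead_coeff ?P) (\<Prod>w | poly ?P w = 0. [:- w, 1:])) z"
    by (subst complex_poly_decompose_rsquarefree[OF rsquarefree_orthonormal_poly[OF a]]) (simp add: poly_orthonormal_poly)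
  also have "\<dots> = lead_coeff ?P * (\<Prod>w\<in>{w. poly ?P w = 0}. z - w)"
    by (simp add: poly_prod)
  also have "(\<Prod>w\<in>{w. poly ?P w = 0}. z - w) = (\<Prod>y\<in>spectrum (jacobi_trunc a b (Suc n)). z - complex_of_real y)"
    unfolding roots by (subst prod.reindex) (auto simp: inj_on_def)
  finally show ?thesis .
qed

lemma log_orth_quotient:
  fixes a b :: "nat \<Rightarrow> real"
  assumes a: "\<forall>n. a n > 0" and v: "v > 0" "v' > 0"
  shows "ln ((cmod (orthonormal a b (Complex u v) (Suc n)))\<^sup>2) - ln ((cmod (orthonormal a b (Complex u v') (Suc n)))\<^sup>2) =
    (\<Sum>y\<in>spectrum (jacobi_trunc a b (Suc n)). ln (((y - u)\<^sup>2 + v\<^sup>2) / ((y - u)\<^sup>2 + v'\<^sup>2)))"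
proof -
  let ?S = "spectrum (jacobi_trunc a b (Suc n))"
  let ?c = "lead_coeff (orthonormal_poly a b (Suc n))"
  have fin: "finite ?S" by (rule card_finite_spectrum(1)[of _ "Suc n"]) (simp add: jacobi_trunc_def)
  have pos: "(y - u)\<^sup>2 + t\<^sup>2 > 0" if "t > 0" for t y using that poisson_denominator_pos[of t y u] by simp
  have "ln ((cmod (orthonormal a b (Complex u t) (Suc n)))\<^sup>2) = ln ((cmod ?c)\<^sup>2) + (\<Sum>y\<in>?S. ln ((y - u)\<^sup>2 + t\<^sup>2))"
    if t: "t > 0" for t
  proof -
    have nz: "orthonormal a b (Complex u t) (Suc n) \<noteq> 0" using orthonormal_nonzero[OF a] t by simp
    then have c: "?c \<noteq> 0" by (auto simp: orthonormal_eq_prod_spectrum[OF a, of b _ n] simp del: orthonormal.simps)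
    have "(cmod (orthonormal a b (Complex u t) (Suc n)))\<^sup>2 = (cmod ?c)\<^sup>2 * (\<Prod>y\<in>?S. (cmod (Complex u t - of_real y))\<^sup>2)"
      unfolding orthonormal_eq_prod_spectrum[OF a, of b _ n] norm_mult power_mult_distrib
      by (simp add: prod_norm[symmetric] prod_power_distrib)
    also have "(\<Prod>y\<in>?S. (cmod (Complex u t - of_real y))\<^sup>2) = (\<Prod>y\<in>?S. (y - u)\<^sup>2 + t\<^sup>2)"
      by (intro prod.cong) (simp_all add: cmod_power2 power2_commute)
    finally have "ln ((cmod (orthonormal a b (Complex u t) (Suc n)))\<^sup>2) = ln ((cmod ?c)\<^sup>2 * (\<Prod>y\<in>?S. (y - u)\<^sup>2 + t\<^sup>2))"
      by simp
    also have "\<dots> = ln ((cmod ?c)\<^sup>2) + ln (\<Prod>y\<in>?S. (y - u)\<^sup>2 + t\<^sup>2)"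
      using c pos[OF t] by (intro ln_mult_pos prod_pos) auto
    also have "ln (\<Prod>y\<in>?S. (y - u)\<^sup>2 + t\<^sup>2) = (\<Sum>y\<in>?S. ln ((y - u)\<^sup>2 + t\<^sup>2))"
      by (rule ln_prod[OF fin]) (metis pos[OF t] less_irrefl)
    finally show ?thesis .
  qed
  then show ?thesis using v pos by (simp add: sum_subtractf ln_div del: orthonormal.simps)
qed

text \<open>The measure is the push-forward of the counting measure on the spectrum.\<close>

lemma integral_eig_measure:
  fixes f :: "real \<Rightarrow> complex"
  assumes "f \<in> borel_measurable borel"
  shows "integral\<^sup>L (eig_measure a b n) f = (\<Sum>y\<in>spectrum (jacobi_trunc a b (n + 1)). f y)"
proof -
  let ?S = "spectrum (jacobi_trunc a b (n + 1))"
  have fin: "finite ?S" by (rule card_finite_spectrum(1)[of _ "n + 1"]) (simp add: jacobi_trunc_def)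
  let ?M = "distr (count_space ?S) borel (\<lambda>x. x)"
  have "emeasure ?M E = (\<Sum>y\<in>?S. emeasure (return borel y) E)" if E: "E \<in> sets borel" for E
  proof -
    have "emeasure ?M E = emeasure (count_space ?S) (E \<inter> ?S)"
      using E by (subst emeasure_distr) auto
    also have "\<dots> = of_nat (card (E \<inter> ?S))" using fin by (intro emeasure_count_space_finite) auto
    also have "\<dots> = (\<Sum>y\<in>?S. indicator E y)" using fin
      by (simp add: indicator_def sum.If_cases Int_commute)
    finally show ?thesis using E by simp
  qed
  then have "measure_of UNIV (sets borel) (\<lambda>E. \<Sum>y\<in>?S. emeasure (return borel y) E)
      = measure_of UNIV (sets borel) (emeasure ?M)"
    using sets.sigma_sets_eq[of "borel :: real measure"] by (intro measure_of_eq) auto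
  also have "\<dots> = ?M" using measure_of_of_measure[of ?M] by simp
  finally have "eig_measure a b n = ?M" unfolding eig_measure_def .
  then show ?thesis
    using assms fin by (simp add: integral_distr lebesgue_integral_count_space_finite)
qed

section \<open>The derivative of the trace of the monodromy matrix\<close>

lemma entries_2:
  fixes X Y :: "'a::semiring_1 ^ 2 ^ 2"
  shows "vec_nth (vec_nth (X ** Y) i) j =
    vec_nth (vec_nth X i) 1 * vec_nth (vec_nth Y 1) j + vec_nth (vec_nth X i) 2 * vec_nth (vec_nth Y 2) j"
  by (simp add: matrix_matrix_mult_def sum_2)

lemma transfer_mat_entries:
  "vec_nth (vec_nth (transfer_mat \<alpha> \<beta> j x) 1) 1 = 0"
  "vec_nth (vec_nth (transfer_mat \<alpha> \<beta> j x) 1) 2 = 1"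
  "vec_nth (vec_nth (transfer_mat \<alpha> \<beta> j x) 2) 1 = - (\<alpha> (j - 1) / \<alpha> j)"
  "vec_nth (vec_nth (transfer_mat \<alpha> \<beta> j x) 2) 2 = (x - \<beta> j) / \<alpha> j"
  by (simp_all add: transfer_mat_def)

primrec transfer_prod_deriv ::
  "(nat \<Rightarrow> real) \<Rightarrow> (nat \<Rightarrow> real) \<Rightarrow> nat \<Rightarrow> nat \<Rightarrow> real \<Rightarrow> real ^ 2 ^ 2" where
  "transfer_prod_deriv \<alpha> \<beta> n 0 x = 0"
| "transfer_prod_deriv \<alpha> \<beta> n (Suc k) x =
     vector [vector [0, 0], vector [0, 1 / \<alpha> (n + k)]] ** transfer_prod \<alpha> \<beta> n k x
     + transfer_mat \<alpha> \<beta> (n + k) x ** transfer_prod_deriv \<alpha> \<beta> n k x"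

lemma has_real_derivative_transfer_prod:
  assumes \<alpha>: "\<forall>k. \<alpha> k > 0"
  shows "((\<lambda>x. vec_nth (vec_nth (transfer_prod \<alpha> \<beta> n k x) i) j) has_real_derivative
     vec_nth (vec_nth (transfer_prod_deriv \<alpha> \<beta> n k x) i) j) (at x)"
proof (induction k arbitrary: i j)
  case 0
  show ?case by simp
next
  case (Suc k)
  note [derivative_intros] = Suc
  have "i = 1 \<or> i = 2" by (rule exhaust_2)
  then show ?case
  proof
    assume [simp]: "i = 1"
    show ?thesis
      by (simp add: entries_2 transfer_mat_entries) (rule derivative_eq_intros refl | simp)+
  next
    assume [simp]: "i = 2"
    have nz: "\<alpha> (n + k) \<noteq> 0" using \<alpha>[rule_format, of "n + k"] by simp
    have "((\<lambda>x. - (\<alpha> (n + k - 1) / \<alpha> (n + k)) * vec_nth (vec_nth (transfer_prod \<alpha> \<beta> n k x) 1) j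
        + (x - \<beta> (n + k)) / \<alpha> (n + k) * vec_nth (vec_nth (transfer_prod \<alpha> \<beta> n k x) 2) j)
      has_real_derivative
        - (\<alpha> (n + k - 1) / \<alpha> (n + k)) * vec_nth (vec_nth (transfer_prod_deriv \<alpha> \<beta> n k x) 1) j
        + (1 / \<alpha> (n + k) * vec_nth (vec_nth (transfer_prod \<alpha> \<beta> n k x) 2) j
           + (x - \<beta> (n + k)) / \<alpha> (n + k) * vec_nth (vec_nth (transfer_prod_deriv \<alpha> \<beta> n k x) 2) j)) (at x)"
      using nz by (auto intro!: derivative_eq_intros simp: add_divide_distrib mult.commute)
    then show ?thesis by (simp add: entries_2 transfer_mat_entries add_ac)
  qed
qed

lemma has_vector_derivative_matrix:
  fixes X :: "real \<Rightarrow> real ^ 'n ^ 'm"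
  assumes "\<And>i j. ((\<lambda>x. vec_nth (vec_nth (X x) i) j) has_real_derivative vec_nth (vec_nth D i) j) (at x)"
  shows "(X has_vector_derivative D) (at x)"
  unfolding has_vector_derivative_def
proof (subst has_derivative_componentwise_within, intro ballI)
  fix b :: "real ^ 'n ^ 'm" assume "b \<in> Basis"
  then obtain i j where b: "b = axis i (axis j 1)" by (auto simp: Basis_vec_def)
  show "((\<lambda>x. X x \<bullet> b) has_derivative (\<lambda>x. (x *\<^sub>R D) \<bullet> b)) (at x)"
    using assms[of i j] by (simp add: b inner_axis has_field_derivative_def mult_commute_abs)
qed

lemma det_transfer_prod:
  assumes \<alpha>: "\<forall>k. \<alpha> k > 0" and "n \<ge> 1"
  shows "Determinants.det (transfer_prod \<alpha> \<beta> n k x) = \<alpha> (n - 1) / \<alpha> (n + k - 1)"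
proof (induction k)
  case 0
  then show ?case using \<alpha>[rule_format, of "n - 1"] by simp
next
  case (Suc k)
  have "\<alpha> (n + k - 1) \<noteq> 0" using \<alpha>[rule_format, of "n + k - 1"] by simp
  then show ?case using Suc by (simp add: det_mul) (simp add: det_2 transfer_mat_entries)
qed

text \<open>Write \<open>(F\<^sub>j, G\<^sub>j)\<close> for the image of the eigenvector \<open>(1, s\<^sub>0)\<close> under the first \<open>j\<close> transfer matrices
at \<open>0\<close>, so that \<open>s\<^sub>j = G\<^sub>j / F\<^sub>j\<close>, and \<open>(F'\<^sub>j, G'\<^sub>j)\<close> for its derivative in the spectral parameter.
The Wronskian \<open>q\<^sub>j\<close> of \<open>(F, G)\<close> with its conjugate is explicit because each
transfer matrix multiplies it by its determinant. The Wronskian \<open>U\<^sub>j\<close> of the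
derivative with the conjugate of \<open>(F, G)\<close> picks up \<open>- |G\<^sub>j|\<^sup>2 / \<alpha>\<close> in addition, which is proportional to the
\<open>j\<close>-th summand on the right. After a full period \<open>(F, G)\<close> has been multiplied by the eigenvalue \<open>l\<close>, of modulus
1, and \<open>U\<close> becomes the trace of the derivative divided by \<open>Im l\<close>, up to the factor \<open>- Im s\<^sub>0\<close>. The
discriminant is \<open>- 4 (Im l)\<^sup>2\<close>.\<close>

lemma trace_monodromy_deriv:
  fixes \<alpha> \<beta> :: "nat \<Rightarrow> real" and s :: "nat \<Rightarrow> complex"
  assumes \<alpha>: "\<forall>k. \<alpha> k > 0" and n: "n \<ge> 1" and per: "\<alpha> (n + N - 1) = \<alpha> (n - 1)"
    and s0: "Im (s 0) > 0" and sN: "s N = s 0"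
    and s: "\<And>j. s (Suc j) = of_real (- \<beta> (n + j) / \<alpha> (n + j)) - of_real (\<alpha> (n + j - 1) / \<alpha> (n + j)) / s j"
    and neg: "discr (monodromy N \<alpha> \<beta> n 0) < 0"
  shows "\<bar>trace (vector_derivative (monodromy N \<alpha> \<beta> n) (at 0))\<bar> / sqrt (- discr (monodromy N \<alpha> \<beta> n 0))
    = (\<Sum>j<N. recip_height (s j) / \<alpha> (n + j - 1)) / 2"
proof -
  define w where "w = s 0"
  define m where "m j p q = complex_of_real (vec_nth (vec_nth (transfer_prod \<alpha> \<beta> n j 0) p) q)" for j p q
  define m' where "m' j p q = complex_of_real (vec_nth (vec_nth (transfer_prod_deriv \<alpha> \<beta> n j 0) p) q)" for j p q
  define F G F' G' where "F j = m j 1 1 + m j 1 2 * w" and "G j = m j 2 1 + m j 2 2 * w"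
    and "F' j = m' j 1 1 + m' j 1 2 * w" and "G' j = m' j 2 1 + m' j 2 2 * w" for j
  define c d where "c j = \<alpha> (n + j - 1) / \<alpha> (n + j)" and "d j = - \<beta> (n + j) / \<alpha> (n + j)" for j
  have apos: "\<alpha> k > 0" "\<alpha> k \<noteq> 0" for k using \<alpha>[rule_format, of k] by auto
  have F0: "F 0 = 1" "G 0 = w" "F' 0 = 0" "G' 0 = 0"
    by (simp_all add: F_def G_def F'_def G'_def m_def m'_def Finite_Cartesian_Product.mat_def)
  have FS: "F (Suc j) = G j" "G (Suc j) = - of_real (c j) * F j + of_real (d j) * G j"
      "F' (Suc j) = G' j"
      "G' (Suc j) = - of_real (c j) * F' j + of_real (d j) * G' j + G j / of_real (\<alpha> (n + j))" for j
    by (simp_all add: F_def G_def F'_def G'_def m_def m'_def c_def d_def entries_2 transfer_mat_entries)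
      (simp_all add: algebra_simps add_divide_distrib)
  define q where "q j = Im (cnj (F j) * G j)" for j
  have q: "q j = Im w * \<alpha> (n - 1) / \<alpha> (n + j - 1)" for j
  proof (induction j)
    case 0
    then show ?case using apos by (simp add: q_def F0)
  next
    case (Suc j)
    have "q (Suc j) = c j * q j"
      by (simp add: q_def FS algebra_simps)
    then show ?case using Suc apos by (simp add: c_def)
  qed
  have qpos: "q j > 0" for j using q s0 apos by (simp add: w_def)
  have F_nz: "F j \<noteq> 0" for j using qpos[of j] by (auto simp: q_def)
  have sFG: "s j = G j / F j" for j
  proof (induction j)
    case (Suc j)
    have "G j \<noteq> 0" using F_nz[of "Suc j"] by (simp add: FS)
    then show ?case using F_nz[of j] unfolding s Suc
      by (simp add: FS c_def d_def field_simps)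
  qed (simp add: F0 w_def)
  have norm_G: "recip_height (s j) * q j = (cmod (G j))\<^sup>2" for j
  proof -
    have "Im (G j / F j) = q j / (cmod (F j))\<^sup>2"
      by (simp add: q_def Im_divide cmod_power2 algebra_simps)
    then show ?thesis using qpos[of j] F_nz[of j] by (simp add: recip_height_def sFG norm_divide power_divide)
  qed
  define U where "U j = F' j * cnj (G j) - G' j * cnj (F j)" for j
  have U: "of_real (\<alpha> (n + j - 1)) * U j = of_real (- Im w * \<alpha> (n - 1) * (\<Sum>i<j. recip_height (s i) / \<alpha> (n + i - 1)))" for j
  proof (induction j)
    case (Suc j)
    have "U (Suc j) = of_real (c j) * U j - G j * cnj (G j) / of_real (\<alpha> (n + j))"
      by (simp add: U_def FS algebra_simps)
    moreover have "G j * cnj (G j) = of_real (recip_height (s j) * q j)"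
      unfolding norm_G complex_norm_square ..
    ultimately have "of_real (\<alpha> (n + j)) * U (Suc j) = of_real (\<alpha> (n + j - 1)) * U j - of_real (recip_height (s j) * q j)"
      using apos[of "n + j"] by (simp add: c_def field_simps)
    then have "of_real (\<alpha> (n + j)) * U (Suc j) =
        of_real (- Im w * \<alpha> (n - 1) * (\<Sum>i<j. recip_height (s i) / \<alpha> (n + i - 1)) - recip_height (s j) * q j)"
      unfolding Suc by simp
    also have "\<dots> = of_real (- Im w * \<alpha> (n - 1) * (\<Sum>i<Suc j. recip_height (s i) / \<alpha> (n + i - 1)))"
      by (rule arg_cong[of _ _ of_real]) (simp add: q algebra_simps)
    finally show ?case by simp
  qed (simp add: U_def F0)
  define \<Sigma> where "\<Sigma> = (\<Sum>j<N. recip_height (s j) / \<alpha> (n + j - 1))"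
  have "of_real (\<alpha> (n - 1)) * U N = of_real (\<alpha> (n - 1)) * of_real (- Im w * \<Sigma>)"
    using U[of N] unfolding per \<Sigma>_def[symmetric] by simp
  then have UN: "U N = of_real (- Im w * \<Sigma>)" using apos[of "n - 1"] by (metis mult_cancel_left of_real_eq_0_iff)
  define l where "l = F N"
  have GN: "G N = l * w" using sFG[of N] F_nz[of N] by (simp add: sN w_def l_def field_simps)
  have w: "Im w > 0" using s0 by (simp add: w_def)
  have "(cmod l)\<^sup>2 * Im w = Im w"
  proof -
    have e: "cnj l * (l * w) = of_real ((cmod l)\<^sup>2) * w"
      unfolding complex_norm_square by (simp add: mult_ac)
    have "q N = (cmod l)\<^sup>2 * Im w" unfolding q_def GN l_def[symmetric] e by simp
    then show ?thesis using q[of N] per apos by simp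
  qed
  then have l1: "l * cnj l = 1" using w by (metis complex_norm_square mult_cancel_right1 of_real_1 less_irrefl)
  have "l * U N = l * cnj l * (F' N * cnj w - G' N)"
    by (simp add: U_def GN l_def[symmetric] algebra_simps)
  then have "Im (l * U N) = Im (F' N * cnj w - G' N)" by (simp add: l1)
  then have "Im l * Im w * \<Sigma> = trace (transfer_prod_deriv \<alpha> \<beta> n N 0) * Im w"
    by (simp add: UN F'_def G'_def m'_def trace_def sum_2 algebra_simps)
  then have tr: "trace (transfer_prod_deriv \<alpha> \<beta> n N 0) = Im l * \<Sigma>" using w by simp
  have vd: "vector_derivative (monodromy N \<alpha> \<beta> n) (at 0) = transfer_prod_deriv \<alpha> \<beta> n N 0"
    unfolding monodromy_def[abs_def]
    by (intro vector_derivative_at has_vector_derivative_matrix has_real_derivative_transfer_prod \<alpha>)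
  have disc: "discr (monodromy N \<alpha> \<beta> n 0) = - 4 * (Im l)\<^sup>2"
  proof -
    let ?m = "\<lambda>p q. vec_nth (vec_nth (transfer_prod \<alpha> \<beta> n N 0) p) q"
    have e: "(of_real (?m 1 1) + of_real (?m 1 2) * w) * w = of_real (?m 2 1) + of_real (?m 2 2) * w"
      using GN by (simp add: G_def l_def F_def m_def)
    from arg_cong[OF e, of Im] have "(?m 1 1 + 2 * ?m 1 2 * Re w - ?m 2 2) * Im w = 0"
      by (simp add: algebra_simps)
    then have D: "?m 2 2 = ?m 1 1 + 2 * ?m 1 2 * Re w" using w by simp
    from arg_cong[OF e, of Re] have C: "?m 2 1 = - ?m 1 2 * ((Re w)\<^sup>2 + (Im w)\<^sup>2)"
      by (simp add: D algebra_simps power2_eq_square)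
    have "Im l = ?m 1 2 * Im w" by (simp add: l_def F_def m_def)
    then show ?thesis
      by (simp add: discr_def monodromy_def trace_def sum_2 det_2 C D power2_eq_square algebra_simps)
  qed
  then have "Im l \<noteq> 0" using neg by auto
  moreover have "sqrt (- discr (monodromy N \<alpha> \<beta> n 0)) = 2 * \<bar>Im l\<bar>"
    by (simp add: disc real_sqrt_mult)
  moreover have "\<Sigma> \<ge> 0"
  proof -
    have "recip_height (s j) \<ge> 0" for j using norm_G[of j] qpos[of j] by (metis zero_le_mult_iff zero_le_power2 not_less less_imp_le)
    then show ?thesis unfolding \<Sigma>_def using apos by (auto intro!: sum_nonneg divide_nonneg_pos)
  qed
  ultimately show ?thesis unfolding vd tr \<Sigma>_def[symmetric] by (simp add: abs_mult)
qed

lemma periodic_seq_mult: "periodic_seq N u \<Longrightarrow> u (m + k * N) = u m"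
  by (induction k) (auto simp: periodic_seq_def add.assoc[symmetric], metis add.commute add.left_commute)

lemma discr_monodromy_neg:
  assumes N: "N \<ge> 1" and \<alpha>: "\<forall>n. \<alpha> n > 0" and per: "periodic_seq N \<alpha>"
    and elliptic: "trace (monodromy N \<alpha> \<beta> N 0) \<in> {-2<..<2}"
  shows "discr (monodromy N \<alpha> \<beta> N 0) < 0"
proof -
  have "\<alpha> (N + N - 1) = \<alpha> (N - 1)" using periodic_seq_mult[OF per, of "N - 1" 1] N by simp
  then have "Determinants.det (monodromy N \<alpha> \<beta> N 0) = 1"
    unfolding monodromy_def det_transfer_prod[OF \<alpha> N] using \<alpha>[rule_format, of "N - 1"] by simp
  moreover have "(trace (monodromy N \<alpha> \<beta> N 0))\<^sup>2 < 2\<^sup>2"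
    using elliptic by (intro power2_strict_mono) auto
  ultimately show ?thesis by (simp add: discr_def)
qed

section \<open>Sequences of bounded variation\<close>

text \<open>Convergence with summable increments. Unlike convergence it controls the accumulated motion of the
sequence, and it passes to products, quotients and roots.\<close>

definition bv_limit :: "(nat \<Rightarrow> complex) \<Rightarrow> complex \<Rightarrow> bool" where
  "bv_limit x l \<longleftrightarrow> x \<longlonglongrightarrow> l \<and> summable (\<lambda>k. cmod (x (Suc k) - x k))"

lemma bv_limit_const: "bv_limit (\<lambda>_. l) l"
  by (simp add: bv_limit_def)

lemma bv_limit_minus: "bv_limit x l \<Longrightarrow> bv_limit (\<lambda>k. - x k) (- l)"
  by (simp add: bv_limit_def tendsto_minus norm_minus_commute)

lemma bv_limit_add:
  assumes "bv_limit x l" "bv_limit y m"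
  shows "bv_limit (\<lambda>k. x k + y k) (l + m)"
proof -
  have "summable (\<lambda>k. cmod (x (Suc k) - x k) + cmod (y (Suc k) - y k))"
    using assms by (auto simp: bv_limit_def intro: summable_add)
  then have "summable (\<lambda>k. cmod (x (Suc k) + y (Suc k) - (x k + y k)))"
    by (rule summable_comparison_test', subst add_diff_add) (simp add: norm_triangle_ineq)
  then show ?thesis using assms by (auto simp: bv_limit_def intro: tendsto_add)
qed

lemma bv_limit_mult:
  assumes "bv_limit x l" "bv_limit y m"
  shows "bv_limit (\<lambda>k. x k * y k) (l * m)"
proof -
  from assms have "Bseq x" "Bseq y" by (auto simp: bv_limit_def intro: convergent_imp_Bseq convergentI)
  then obtain X Y where X: "\<And>k. cmod (x k) \<le> X" and Y: "\<And>k. cmod (y k) \<le> Y" by (metis BseqE)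
  have "summable (\<lambda>k. X * cmod (y (Suc k) - y k) + Y * cmod (x (Suc k) - x k))"
    using assms by (auto simp: bv_limit_def intro!: summable_add summable_mult)
  then have "summable (\<lambda>k. cmod (x (Suc k) * y (Suc k) - x k * y k))"
  proof (rule summable_comparison_test')
    fix k
    have "x (Suc k) * y (Suc k) - x k * y k = x (Suc k) * (y (Suc k) - y k) + y k * (x (Suc k) - x k)"
      by (simp add: algebra_simps)
    then have "cmod (x (Suc k) * y (Suc k) - x k * y k) \<le>
        cmod (x (Suc k)) * cmod (y (Suc k) - y k) + cmod (y k) * cmod (x (Suc k) - x k)"
      by (metis norm_mult norm_triangle_ineq)
    also have "\<dots> \<le> X * cmod (y (Suc k) - y k) + Y * cmod (x (Suc k) - x k)"
      using X Y by (intro add_mono mult_right_mono) auto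
    finally show "norm (cmod (x (Suc k) * y (Suc k) - x k * y k)) \<le> X * cmod (y (Suc k) - y k) + Y * cmod (x (Suc k) - x k)"
      by simp
  qed
  then show ?thesis using assms by (auto simp: bv_limit_def intro: tendsto_mult)
qed

lemma bv_limit_image:
  assumes x: "bv_limit x l" and cont: "isCont f l"
    and lip: "\<forall>\<^sub>F k in sequentially. cmod (f (x (Suc k)) - f (x k)) \<le> K * cmod (x (Suc k) - x k)"
  shows "bv_limit (\<lambda>k. f (x k)) (f l)"
proof -
  have "summable (\<lambda>k. K * cmod (x (Suc k) - x k))"
    using x by (auto simp: bv_limit_def intro: summable_mult)
  then have "summable (\<lambda>k. cmod (f (x (Suc k)) - f (x k)))"
    by (rule summable_comparison_test_ev[rotated]) (use lip in \<open>auto elim: eventually_mono\<close>)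
  then show ?thesis using x cont by (auto simp: bv_limit_def intro: isCont_tendsto_compose)
qed

lemma bv_limit_inverse:
  assumes x: "bv_limit x l" and "l \<noteq> 0"
  shows "bv_limit (\<lambda>k. inverse (x k)) (inverse l)"
proof (rule bv_limit_image[OF x])
  show "isCont inverse l" using assms by (intro continuous_intros) auto
  define h where "h = cmod l / 2"
  have h: "h > 0" using assms by (simp add: h_def)
  have "(\<lambda>k. cmod (x k)) \<longlonglongrightarrow> cmod l" using x by (auto simp: bv_limit_def intro: tendsto_norm)
  then have "\<forall>\<^sub>F k in sequentially. cmod (x k) > h" using assms by (intro order_tendstoD) (auto simp: h_def)
  moreover from this have "\<forall>\<^sub>F k in sequentially. cmod (x (Suc k)) > h"
    by (subst eventually_sequentially_Suc[where P = "\<lambda>k. h < cmod (x k)"])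
  ultimately show "\<forall>\<^sub>F k in sequentially. cmod (inverse (x (Suc k)) - inverse (x k)) \<le> (1 / (h * h)) * cmod (x (Suc k) - x k)"
  proof eventually_elim
    case (elim k)
    then have nz: "x k \<noteq> 0" "x (Suc k) \<noteq> 0" using h by auto
    have "cmod (inverse (x (Suc k)) - inverse (x k)) = (1 / (cmod (x (Suc k)) * cmod (x k))) * cmod (x (Suc k) - x k)"
      using nz by (simp add: inverse_diff_inverse norm_mult norm_inverse divide_inverse mult_ac)
    also have "\<dots> \<le> (1 / (h * h)) * cmod (x (Suc k) - x k)"
      using elim h by (intro mult_right_mono divide_left_mono mult_mono mult_pos_pos) auto
    finally show ?case .
  qed
qed

lemma bv_limit_csqrt:
  assumes x: "bv_limit x (of_real l)" and l: "l > 0"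
  shows "bv_limit (\<lambda>k. csqrt (x k)) (of_real (sqrt l))"
proof -
  have nonpos: "complex_of_real l \<notin> \<real>\<^sub>\<le>\<^sub>0" using l by (simp add: complex_nonpos_Reals_iff)
  have cont: "isCont csqrt (of_real l)" using nonpos by (rule continuous_at_csqrt)
  have e: "csqrt (of_real l) = of_real (sqrt l)"
    using of_real_sqrt[of l] l by simp
  have lim: "(\<lambda>k. csqrt (x k)) \<longlonglongrightarrow> of_real (sqrt l)"
    using isCont_tendsto_compose[OF cont, of x sequentially] x by (simp add: bv_limit_def e)
  define h where "h = sqrt l / 2"
  have h: "h > 0" using l by (simp add: h_def)
  have "(\<lambda>k. Re (csqrt (x k))) \<longlonglongrightarrow> sqrt l" using tendsto_Re[OF lim] by simp
  then have "\<forall>\<^sub>F k in sequentially. Re (csqrt (x k)) > h" using l by (intro order_tendstoD) (auto simp: h_def)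
  moreover from this have "\<forall>\<^sub>F k in sequentially. Re (csqrt (x (Suc k))) > h"
    by (subst eventually_sequentially_Suc[where P = "\<lambda>k. h < Re (csqrt (x k))"])
  ultimately have "\<forall>\<^sub>F k in sequentially. cmod (csqrt (x (Suc k)) - csqrt (x k)) \<le> (1 / (2 * h)) * cmod (x (Suc k) - x k)"
  proof eventually_elim
    case (elim k)
    let ?p = "csqrt (x (Suc k))" and ?q = "csqrt (x k)"
    have "2 * h \<le> Re (?p + ?q)" using elim by simp
    also have "\<dots> \<le> cmod (?p + ?q)" by (rule complex_Re_le_cmod)
    finally have "2 * h * cmod (?p - ?q) \<le> cmod (?p + ?q) * cmod (?p - ?q)" by (intro mult_right_mono) auto
    also have "\<dots> = cmod (?p\<^sup>2 - ?q\<^sup>2)" by (simp only: norm_mult[symmetric]) (simp add: power2_eq_square algebra_simps)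
    also have "?p\<^sup>2 - ?q\<^sup>2 = x (Suc k) - x k" by simp
    finally show ?case using h by (simp add: field_simps)
  qed
  from bv_limit_image[OF x cont this] show ?thesis by (simp only: e)
qed

text \<open>The limiting equation is real with negative discriminant, so it has a simple root in the open upper
half-plane; the branch of the root formula leading to it is smooth near the limit.\<close>

lemma quadratic_root_bv:
  fixes B0 E0 C0 :: real
  assumes B: "bv_limit B (of_real B0)" and E: "bv_limit E (of_real E0)" and C: "bv_limit C (of_real C0)"
    and neg: "E0\<^sup>2 + 4 * B0 * C0 < 0"
  obtains \<omega> w where "bv_limit \<omega> w" "Im w > 0"
    "\<forall>\<^sub>F k in sequentially. B k * (\<omega> k)\<^sup>2 + E k * \<omega> k - C k = 0"
proof -
  define \<Delta> where "\<Delta> = - (E0\<^sup>2 + 4 * B0 * C0)"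
  have \<Delta>: "\<Delta> > 0" using neg by (simp add: \<Delta>_def)
  have B0: "B0 \<noteq> 0" using neg by (auto simp: not_less[symmetric])
  define \<sigma> :: complex where "\<sigma> = \<i> * of_real (sgn B0)"
  define \<omega> where "\<omega> k = (- E k + \<sigma> * csqrt (- (E k * E k + 4 * (B k * C k)))) * inverse (2 * B k)" for k
  define w where "w = (- of_real E0 + \<sigma> * of_real (sqrt \<Delta>)) * inverse (2 * complex_of_real B0)"
  have "bv_limit (\<lambda>k. - (E k * E k + 4 * (B k * C k)))
     (- (of_real E0 * of_real E0 + 4 * (of_real B0 * of_real C0)))"
    by (intro bv_limit_minus bv_limit_add bv_limit_mult B E C bv_limit_const)
  also have "- (of_real E0 * of_real E0 + 4 * (of_real B0 * of_real C0)) = complex_of_real \<Delta>"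
    by (simp add: \<Delta>_def power2_eq_square)
  finally have "bv_limit \<omega> w"
    unfolding \<omega>_def[abs_def] w_def using B0
    by (intro bv_limit_mult bv_limit_add bv_limit_minus bv_limit_inverse bv_limit_csqrt B E C bv_limit_const \<Delta>) auto
  moreover have "Im w > 0"
  proof -
    have "w = of_real (- E0 / (2 * B0)) + \<i> * of_real (sgn B0 * sqrt \<Delta> / (2 * B0))"
      using B0 by (simp add: w_def \<sigma>_def field_simps)
    then have "Im w = sgn B0 * sqrt \<Delta> / (2 * B0)" by simp
    also have "\<dots> = sqrt \<Delta> / (2 * \<bar>B0\<bar>)" using B0 by (simp add: sgn_if)
    finally show ?thesis using B0 \<Delta> by simp
  qed
  moreover have "\<forall>\<^sub>F k in sequentially. B k * (\<omega> k)\<^sup>2 + E k * \<omega> k - C k = 0"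
  proof -
    have "\<forall>\<^sub>F k in sequentially. B k \<noteq> 0"
      using B B0 unfolding bv_limit_def by (intro tendsto_imp_eventually_ne) auto
    then show ?thesis
    proof eventually_elim
      case (elim k)
      have "\<sigma>\<^sup>2 = -1" using B0 by (simp add: \<sigma>_def power_mult_distrib sgn_if)
      moreover have "2 * B k * \<omega> k + E k = \<sigma> * csqrt (- (E k * E k + 4 * (B k * C k)))"
        using elim by (simp add: \<omega>_def field_simps)
      ultimately have "(2 * B k * \<omega> k + E k)\<^sup>2 = E k * E k + 4 * (B k * C k)"
        by (simp add: power_mult_distrib)
      then have "4 * B k * (B k * (\<omega> k)\<^sup>2 + E k * \<omega> k - C k) = 0"
        by (simp add: power2_eq_square algebra_simps)
      then show ?case using elim by simp
    qed
  qed
  ultimately show ?thesis by (rule that)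
qed

text \<open>Membership in \<^const>\<open>D1\<close> is bounded variation along every residue class modulo \<open>N\<close>.\<close>

lemma D1_bv_limit:
  assumes x: "x \<in> D1 N" and m: "m \<ge> 1" and N: "N \<ge> 1"
    and lim: "(\<lambda>n. \<bar>x n - y n\<bar>) \<longlonglongrightarrow> 0" and per: "\<And>k. y (m + k * N) = y m"
  shows "bv_limit (\<lambda>k. of_real (x (m + k * N))) (of_real (y m))"
proof -
  have "summable (\<lambda>n. \<bar>x (Suc n + N) - x (Suc n)\<bar>)" using x by (simp add: D1_def)
  then have "summable ((\<lambda>n. \<bar>x (Suc n + N) - x (Suc n)\<bar>) \<circ> (\<lambda>k. m - 1 + k * N))"
    using N by (intro summable_reindex) (auto simp: inj_on_def)
  then have "summable (\<lambda>k. \<bar>x (m + Suc k * N) - x (m + k * N)\<bar>)"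
    using m by (simp add: o_def add_ac)
  then have sum: "summable (\<lambda>k. cmod (of_real (x (m + Suc k * N)) - of_real (x (m + k * N))))"
    by (simp flip: of_real_diff)
  have "(\<lambda>n. x n - y n) \<longlonglongrightarrow> 0" using lim by (simp add: tendsto_rabs_zero_iff)
  moreover have "strict_mono (\<lambda>k. m + k * N)" using N by (simp add: strict_mono_def)
  ultimately have "(\<lambda>k. x (m + k * N) - y (m + k * N)) \<longlonglongrightarrow> 0"
    using LIMSEQ_subseq_LIMSEQ[of "\<lambda>n. x n - y n" 0 "\<lambda>k. m + k * N"] by (simp add: o_def)
  then have "(\<lambda>k. x (m + k * N)) \<longlonglongrightarrow> y m" by (simp add: per LIM_zero_iff)
  then show ?thesis unfolding bv_limit_def using sum by (auto intro: tendsto_of_real)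
qed

section \<open>Riccati maps as contractions of the hyperbolic plane\<close>

text \<open>The errors are summable, so \<open>D\<close> is bounded, converges, and \<open>\<theta> D\<close> is summable by telescoping. As \<open>\<theta>\<close> is
not summable, the limit of \<open>D\<close> can only be 0.\<close>

lemma perturbed_contraction_tendsto_zero:
  fixes D \<theta> e :: "nat \<Rightarrow> real"
  assumes D: "\<And>k. D k \<ge> 0" and \<theta>: "\<And>k. 0 \<le> \<theta> k" "\<And>k. \<theta> k \<le> 1" and div: "\<not> summable \<theta>"
    and e: "\<And>k. e k \<ge> 0" "summable e"
    and step: "\<And>k. D (Suc k) \<le> (1 + e k) * ((1 - \<theta> k) * D k) + e k"
  shows "D \<longlonglongrightarrow> 0"
proof -
  have bound: "D k + 1 \<le> (D 0 + 1) * exp (\<Sum>j<k. e j)" for k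
  proof (induction k)
    case (Suc k)
    have "(1 + e k) * ((1 - \<theta> k) * D k) \<le> (1 + e k) * D k"
      using \<theta> D e by (intro mult_left_mono) (auto intro: mult_left_le_one_le)
    then have "D (Suc k) + 1 \<le> (1 + e k) * (D k + 1)" using step[of k] by (simp add: algebra_simps)
    also have "\<dots> \<le> exp (e k) * ((D 0 + 1) * exp (\<Sum>j<k. e j))"
      using Suc e D exp_ge_add_one_self[of "e k"] by (intro mult_mono) (auto intro: add_nonneg_nonneg)
    finally show ?case by (simp add: exp_add mult_ac)
  qed simp
  define M where "M = (D 0 + 1) * exp (suminf e)"
  have M: "D k + 1 \<le> M" for k
  proof -
    have "(D 0 + 1) * exp (\<Sum>j<k. e j) \<le> M"
      unfolding M_def using D e by (intro mult_left_mono) (auto intro: sum_le_suminf add_nonneg_nonneg)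
    then show ?thesis using bound[of k] by linarith
  qed
  have step': "\<theta> k * D k \<le> D k - D (Suc k) + M * e k" for k
  proof -
    have "e k * ((1 - \<theta> k) * D k) \<le> e k * D k"
      using \<theta> D e by (intro mult_left_mono) (auto intro: mult_left_le_one_le)
    moreover have "e k * (D k + 1) \<le> e k * M" using M e by (intro mult_left_mono) auto
    ultimately show ?thesis using step[of k] by (simp add: algebra_simps)
  qed
  have tele: "(\<Sum>k<n. \<theta> k * D k) \<le> D 0 - D n + M * (\<Sum>k<n. e k)" for n
  proof (induction n)
    case (Suc n)
    then show ?case using step'[of n] by (simp add: algebra_simps)
  qed simp
  have M0: "M \<ge> 0" using M[of 0] D[of 0] by linarith
  have "summable (\<lambda>k. \<theta> k * D k)"
  proof (rule bounded_imp_summable[of _ "D 0 + M * suminf e"])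
    show "0 \<le> \<theta> k * D k" for k using \<theta> D by simp
    show "(\<Sum>k\<le>n. \<theta> k * D k) \<le> D 0 + M * suminf e" for n
    proof -
      have "M * (\<Sum>k<Suc n. e k) \<le> M * suminf e" using M0 e by (intro mult_left_mono sum_le_suminf) auto
      then show ?thesis using tele[of "Suc n"] D[of "Suc n"] unfolding lessThan_Suc_atMost by linarith
    qed
  qed
  \<comment> \<open>Subtracting the accumulated errors makes the sequence decreasing.\<close>
  define y where "y k = D k - M * (\<Sum>j<k. e j)" for k
  have "y (Suc k) \<le> y k" for k
    using step'[of k] \<theta>[of k] D[of k] by (simp add: y_def algebra_simps) (smt (verit) mult_nonneg_nonneg)
  then have "decseq y" by (rule decseq_SucI)
  moreover have "- (M * suminf e) \<le> y k" for k
  proof -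
    have "M * (\<Sum>j<k. e j) \<le> M * suminf e" using M0 e by (intro mult_left_mono sum_le_suminf) auto
    then show ?thesis using D[of k] by (simp add: y_def)
  qed
  ultimately obtain L where "y \<longlonglongrightarrow> L" using decseq_convergent by metis
  then have "(\<lambda>k. y k + M * (\<Sum>j<k. e j)) \<longlonglongrightarrow> L + M * suminf e"
    using summable_LIMSEQ[OF e(2)] by (intro tendsto_intros)
  then have lim: "D \<longlonglongrightarrow> L + M * suminf e" by (simp add: y_def)
  have "L + M * suminf e \<le> 0"
  proof (rule ccontr)
    assume "\<not> ?thesis"
    then have pos: "(L + M * suminf e) / 2 > 0" "(L + M * suminf e) / 2 < L + M * suminf e" by auto
    define h where "h = (L + M * suminf e) / 2"
    have h: "h > 0" using pos by (simp add: h_def)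
    have "\<forall>\<^sub>F k in sequentially. D k > h" using order_tendstoD(1)[OF lim] pos unfolding h_def by blast
    then have "\<forall>\<^sub>F k in sequentially. norm (\<theta> k) \<le> (1 / h) * (\<theta> k * D k)"
    proof eventually_elim
      case (elim k)
      then have "\<theta> k * h \<le> \<theta> k * D k" using \<theta>[of k] by (intro mult_left_mono) auto
      then show ?case using h \<theta>[of k] by (simp add: field_simps)
    qed
    then have "summable \<theta>"
      by (rule summable_comparison_test_ev) (intro summable_mult \<open>summable (\<lambda>k. \<theta> k * D k)\<close>)
    with div show False by simp
  qed
  moreover have "0 \<le> L + M * suminf e" using D by (intro LIMSEQ_le_const[OF lim]) auto
  ultimately show ?thesis using lim by simp
qed

text \<open>This is \<open>4 sinh\<^sup>2(\<delta> / 2)\<close> for the hyperbolic distance \<open>\<delta>\<close> of the two points.\<close>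

definition hyp_gap :: "complex \<Rightarrow> complex \<Rightarrow> real" where
  "hyp_gap r s = (cmod (r - s))\<^sup>2 / (Im r * Im s)"

lemma hyp_gap_nonneg: "Im r > 0 \<Longrightarrow> Im s > 0 \<Longrightarrow> hyp_gap r s \<ge> 0"
  by (simp add: hyp_gap_def)

lemma Im_riccati: "Im (d - of_real c / r) = Im d + c * (Im r / (cmod r)\<^sup>2)"
  by (simp add: Im_divide cmod_power2)

lemma riccati_upper:
  assumes "Im r > 0" "c > 0" "Im d \<ge> 0"
  shows "Im (d - of_real c / r) > 0" "Im d < Im (d - of_real c / r)"
proof -
  have "r \<noteq> 0" using assms(1) by auto
  then have "c * (Im r / (cmod r)\<^sup>2) > 0" using assms by simp
  then show "Im (d - of_real c / r) > 0" "Im d < Im (d - of_real c / r)"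
    unfolding Im_riccati using assms by auto
qed

text \<open>The map is a real Moebius transformation, which preserves the hyperbolic distance, followed by the
upward shift by \<open>Im d\<close>, which keeps Euclidean distances and increases heights. Only the height of
the second point is used, because the first one is not bounded a priori.\<close>

lemma hyp_gap_riccati_contraction:
  assumes r: "Im r > 0" and s: "Im s > 0" and c: "c > 0" and d: "Im d \<ge> 0"
  defines "r' \<equiv> d - of_real c / r" and "s' \<equiv> d - of_real c / s"
  shows "hyp_gap r' s' \<le> (1 - Im d / Im s') * hyp_gap r s"
proof -
  define R S where "R = c * (Im r / (cmod r)\<^sup>2)" and "S = c * (Im s / (cmod s)\<^sup>2)"
  have nz: "r \<noteq> 0" "s \<noteq> 0" using r s by auto
  have RS: "R > 0" "S > 0" using nz r s c by (auto simp: R_def S_def)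
  have I: "Im r' = Im d + R" "Im s' = Im d + S" by (simp_all only: r'_def s'_def Im_riccati R_def S_def)
  have "r' - s' = of_real c * (r - s) / (r * s)" using nz by (simp add: r'_def s'_def field_simps)
  then have n: "(cmod (r' - s'))\<^sup>2 = c\<^sup>2 * (cmod (r - s))\<^sup>2 / ((cmod r)\<^sup>2 * (cmod s)\<^sup>2)"
    by (simp add: norm_divide norm_mult power_divide power_mult_distrib)
  have h: "hyp_gap r s = (cmod (r' - s'))\<^sup>2 / (R * S)"
    unfolding n hyp_gap_def R_def S_def using nz r s c by (simp add: field_simps power2_eq_square)
  have "hyp_gap r' s' \<le> (cmod (r' - s'))\<^sup>2 / (R * (Im d + S))"
    unfolding hyp_gap_def I using RS d by (intro divide_left_mono mult_right_mono mult_pos_pos) auto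
  also have "\<dots> = (1 - Im d / Im s') * hyp_gap r s"
  proof -
    have "1 - Im d / Im s' = S / (Im d + S)" unfolding I using RS d by (simp add: field_simps)
    then show ?thesis unfolding h using RS by simp
  qed
  finally show ?thesis .
qed

text \<open>Moving the reference point costs a factor and a summand that are linear in the Euclidean displacement.
The point \<open>r\<close> is arbitrary, also near the real axis: there \<open>1 / Im r\<close> is controlled by the gap itself.\<close>

lemma hyp_gap_change_reference:
  assumes r: "Im r > 0" and h: "h > 0" and s: "Im s \<ge> h" "Im s' \<ge> h" and \<delta>: "cmod (s - s') \<le> 1"
  defines "A \<equiv> 1 + 2 / h" and "B \<equiv> 4 / h\<^sup>2"
  shows "hyp_gap r s' \<le> (1 + (A + B + A * B) * cmod (s - s')) * hyp_gap r s + (A + B + A * B) * cmod (s - s')"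
proof -
  define \<delta> where "\<delta> = cmod (s - s')"
  have \<delta>: "0 \<le> \<delta>" "\<delta> \<le> 1" using \<delta> by (auto simp: \<delta>_def)
  have AB: "A \<ge> 0" "B \<ge> 0" using h by (auto simp: A_def B_def)
  have Is: "Im s > 0" "Im s' > 0" using s h by auto
  let ?H = "hyp_gap r s"
  have H: "?H \<ge> 0" using hyp_gap_nonneg r Is by blast
  have "cmod (r - s') \<le> cmod (r - s) + \<delta>"
    unfolding \<delta>_def by (metis diff_add_cancel add_diff_eq norm_triangle_ineq)
  then have "(cmod (r - s'))\<^sup>2 \<le> (cmod (r - s) + \<delta>)\<^sup>2" by (intro power_mono) auto
  also have "\<dots> \<le> (1 + \<delta>) * ((cmod (r - s))\<^sup>2 + \<delta>)"
  proof -
    have "0 \<le> \<delta> * (cmod (r - s) - 1)\<^sup>2" using \<delta> by simp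
    then show ?thesis by (simp add: power2_eq_square algebra_simps)
  qed
  finally have 1: "(cmod (r - s'))\<^sup>2 \<le> (1 + \<delta>) * ((cmod (r - s))\<^sup>2 + \<delta>)" .
  have "Im s \<le> Im s' + \<delta>"
    using abs_Im_le_cmod[of "s - s'"] unfolding \<delta>_def by simp
  also have "\<dots> \<le> Im s' * (1 + \<delta> / h)"
    using s h \<delta> by (simp add: field_simps mult_left_mono)
  finally have 2: "1 / Im s' \<le> (1 + \<delta> / h) / Im s"
    using Is by (simp add: field_simps)
  have 3: "1 / Im r \<le> (4 / h) * (1 + ?H)"
  proof (cases "Im r \<ge> Im s / 2")
    case True
    then have "1 / Im r \<le> 2 / h" using s h r by (simp add: field_simps)
    also have "\<dots> \<le> (4 / h) * (1 + ?H)" using H h by (simp add: field_simps)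
    finally show ?thesis .
  next
    case False
    then have "Im s / 2 \<le> \<bar>Im (r - s)\<bar>" unfolding minus_complex.sel by linarith
    also have "\<dots> \<le> cmod (r - s)" by (rule abs_Im_le_cmod)
    finally have "(Im s / 2)\<^sup>2 \<le> (cmod (r - s))\<^sup>2" using Is by (intro power_mono) auto
    then have "(Im s / 2)\<^sup>2 / (Im r * Im s) \<le> ?H" unfolding hyp_gap_def using r Is by (intro divide_right_mono) auto
    then have "Im s / (4 * Im r) \<le> ?H" using r Is by (simp add: power2_eq_square field_simps)
    moreover have "h / (4 * Im r) \<le> Im s / (4 * Im r)" using s r by (intro divide_right_mono) auto
    ultimately have "h / (4 * Im r) \<le> 1 + ?H" by linarith
    then show ?thesis using h r by (simp add: field_simps)
  qed
  have 4: "1 / (Im r * Im s) \<le> B * (1 + ?H)"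
  proof -
    have "1 / Im s \<le> 1 / h" using s h by (simp add: field_simps)
    then have "1 / Im r * (1 / Im s) \<le> ((4 / h) * (1 + ?H)) * (1 / h)"
      using 3 r Is h H by (intro mult_mono) auto
    then show ?thesis by (simp add: B_def power2_eq_square)
  qed
  have "hyp_gap r s' = (cmod (r - s'))\<^sup>2 / Im r * (1 / Im s')" by (simp add: hyp_gap_def)
  also have "\<dots> \<le> ((1 + \<delta>) * ((cmod (r - s))\<^sup>2 + \<delta>)) / Im r * ((1 + \<delta> / h) / Im s)"
    using 1 2 r Is \<delta> h by (intro mult_mono divide_right_mono) auto
  also have "\<dots> = ((1 + \<delta>) * (1 + \<delta> / h)) * (?H + \<delta> * (1 / (Im r * Im s)))"
    using r Is h by (simp add: hyp_gap_def field_simps)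
  also have "\<dots> \<le> (1 + A * \<delta>) * (?H + \<delta> * (B * (1 + ?H)))"
  proof (intro mult_mono add_mono mult_left_mono order_refl 4)
    have "\<delta> * \<delta> \<le> \<delta> * 1" using \<delta> by (intro mult_left_mono) auto
    then have "\<delta> * \<delta> / h \<le> \<delta> / h" using h by (intro divide_right_mono) auto
    moreover have "(1 + \<delta>) * (1 + \<delta> / h) = 1 + \<delta> + \<delta> / h + \<delta> * \<delta> / h"
      by (simp add: algebra_simps add_divide_distrib)
    moreover have "A * \<delta> = \<delta> + \<delta> / h + \<delta> / h"
      by (simp add: A_def distrib_right)
    ultimately show "(1 + \<delta>) * (1 + \<delta> / h) \<le> 1 + A * \<delta>" by linarith
    show "0 \<le> ?H + \<delta> * (1 / (Im r * Im s))" using H \<delta> r Is by simp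
  qed (use \<delta> AB r Is in auto)
  also have "\<dots> = (1 + (A + B) * \<delta> + A * B * (\<delta> * \<delta>)) * ?H + (B * \<delta> + A * B * (\<delta> * \<delta>))"
    by (simp add: algebra_simps)
  also have "\<dots> \<le> (1 + (A + B) * \<delta> + A * B * \<delta>) * ?H + (A * \<delta> + B * \<delta> + A * B * \<delta>)"
  proof -
    have dd: "A * B * (\<delta> * \<delta>) \<le> A * B * \<delta>"
      using AB \<delta> by (intro mult_left_mono) (auto intro: mult_left_le)
    have "A * \<delta> \<ge> 0" using AB \<delta> by simp
    then show ?thesis using dd H \<delta>(1) by (intro add_mono mult_right_mono) auto
  qed
  also have "\<dots> = (1 + (A + B + A * B) * \<delta>) * ?H + (A + B + A * B) * \<delta>" by (simp add: algebra_simps)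
  finally show ?thesis unfolding \<delta>_def .
qed

lemma hyp_gap_tendsto_zero:
  assumes "\<And>k. Im (r k) > 0" "\<And>k. Im (s k) > 0" and h: "(\<lambda>k. hyp_gap (r k) (s k)) \<longlonglongrightarrow> 0"
    and s: "s \<longlonglongrightarrow> w"
  shows "r \<longlonglongrightarrow> w"
proof -
  define P where "P k = hyp_gap (r k) (s k) * Im (s k)" for k
  have P: "P \<longlonglongrightarrow> 0" using tendsto_mult[OF h tendsto_Im[OF s]] by (simp add: P_def[abs_def])
  have bound: "(cmod (r k - s k))\<^sup>2 \<le> 2 * (P k * Im (s k)) + (P k)\<^sup>2" for k
  proof -
    let ?x = "cmod (r k - s k)"
    have P0: "P k \<ge> 0" using assms(1,2)[of k] hyp_gap_nonneg by (auto simp: P_def intro!: mult_nonneg_nonneg less_imp_le)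
    have "?x\<^sup>2 = P k * Im (r k)" using assms(1,2)[of k] by (simp add: P_def hyp_gap_def)
    also have "\<dots> \<le> P k * (Im (s k) + ?x)"
      using P0 abs_Im_le_cmod[of "r k - s k"] by (intro mult_left_mono) auto
    finally have "?x\<^sup>2 \<le> P k * Im (s k) + P k * ?x" by (simp add: algebra_simps)
    moreover have "0 \<le> (?x - P k)\<^sup>2" by simp
    ultimately show ?thesis by (simp add: power2_eq_square algebra_simps)
  qed
  have "(\<lambda>k. 2 * (P k * Im (s k)) + (P k)\<^sup>2) \<longlonglongrightarrow> 2 * (0 * Im w) + 0\<^sup>2"
    by (intro tendsto_intros P s)
  then have upper: "(\<lambda>k. 2 * (P k * Im (s k)) + (P k)\<^sup>2) \<longlonglongrightarrow> 0" by simp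
  have "(\<lambda>k. (cmod (r k - s k))\<^sup>2) \<longlonglongrightarrow> 0"
    by (rule tendsto_sandwich[OF _ _ tendsto_const upper]) (simp_all add: bound)
  then have "(\<lambda>k. sqrt ((cmod (r k - s k))\<^sup>2)) \<longlonglongrightarrow> sqrt 0" by (rule tendsto_real_sqrt)
  then have "(\<lambda>k. r k - s k) \<longlonglongrightarrow> 0" by (simp add: tendsto_norm_zero_iff)
  from tendsto_add[OF this s] show ?thesis by simp
qed

text \<open>The coefficients are arbitrary because those of the recursion at a point of the upper half-plane are
complex and only asymptotically periodic.\<close>

primrec complex_transfer_prod :: "(nat \<Rightarrow> complex) \<Rightarrow> (nat \<Rightarrow> complex) \<Rightarrow> nat \<Rightarrow> nat \<Rightarrow> complex ^ 2 ^ 2" where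
  "complex_transfer_prod c d n 0 = Finite_Cartesian_Product.mat 1"
| "complex_transfer_prod c d n (Suc k) = vector [vector [0, 1], vector [- c (n + k), d (n + k)]] ** complex_transfer_prod c d n k"

lemma riccati_orbit_transfer_prod:
  fixes s :: "nat \<Rightarrow> complex"
  assumes s: "\<And>j. s (Suc j) = d (n + j) - c (n + j) / s j" and nz: "\<And>j. s j \<noteq> 0"
  defines "m \<equiv> \<lambda>j p q. vec_nth (vec_nth (complex_transfer_prod c d n j) p) q"
  shows "m j 1 1 + m j 1 2 * s 0 \<noteq> 0 \<and>
    m j 2 1 + m j 2 2 * s 0 = s j * (m j 1 1 + m j 1 2 * s 0)"
proof (induction j)
  case 0
  show ?case by (simp add: m_def Finite_Cartesian_Product.mat_def)
next
  case (Suc j)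
  define X Y where "X = m j 1 1 + m j 1 2 * s 0" and "Y = m j 2 1 + m j 2 2 * s 0"
  have next_col: "m (Suc j) 1 1 + m (Suc j) 1 2 * s 0 = Y"
      "m (Suc j) 2 1 + m (Suc j) 2 2 * s 0 = - c (n + j) * X + d (n + j) * Y"
    by (simp_all add: X_def Y_def m_def entries_2 algebra_simps)
  have XY: "X \<noteq> 0" "Y = s j * X" using Suc by (simp_all add: X_def Y_def)
  have "Y \<noteq> 0" using XY nz[of j] by simp
  moreover have "- c (n + j) * X + d (n + j) * Y = s (Suc j) * Y"
    unfolding XY(2) s using nz[of j] by (simp add: field_simps)
  ultimately show ?case unfolding next_col by blast
qed

text \<open>The quadratic equation says that \<open>(1, s\<^sub>0)\<close> is an eigenvector of the product matrix.\<close>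

lemma riccati_fixed_point:
  fixes s :: "nat \<Rightarrow> complex"
  assumes s: "\<And>j. s (Suc j) = d (n + j) - c (n + j) / s j" and nz: "\<And>j. s j \<noteq> 0"
    and root: "vec_nth (vec_nth (complex_transfer_prod c d n N) 1) 2 * (s 0)\<^sup>2
      + (vec_nth (vec_nth (complex_transfer_prod c d n N) 1) 1 - vec_nth (vec_nth (complex_transfer_prod c d n N) 2) 2) * s 0
      - vec_nth (vec_nth (complex_transfer_prod c d n N) 2) 1 = 0"
  shows "s N = s 0"
proof -
  let ?m = "\<lambda>p q. vec_nth (vec_nth (complex_transfer_prod c d n N) p) q"
  have 1: "?m 1 1 + ?m 1 2 * s 0 \<noteq> 0" "?m 2 1 + ?m 2 2 * s 0 = s N * (?m 1 1 + ?m 1 2 * s 0)"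
    using riccati_orbit_transfer_prod[where s = s and d = d and n = n and c = c and j = N, OF s nz] by auto
  have "?m 2 1 + ?m 2 2 * s 0 = s 0 * (?m 1 1 + ?m 1 2 * s 0)"
    using root by (simp add: algebra_simps power2_eq_square)
  with 1 show ?thesis by simp
qed

lemma bv_limit_transfer_prod:
  assumes c: "\<And>j. bv_limit (\<lambda>k. c (n k + j)) (of_real (\<alpha> (N + j - 1) / \<alpha> (N + j)))"
    and d: "\<And>j. bv_limit (\<lambda>k. d (n k + j)) (of_real (- \<beta> (N + j) / \<alpha> (N + j)))"
  shows "bv_limit (\<lambda>k. vec_nth (vec_nth (complex_transfer_prod c d (n k) m) p) q)
    (of_real (vec_nth (vec_nth (transfer_prod \<alpha> \<beta> N m 0) p) q))"
proof (induction m arbitrary: p q)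
  case 0
  show ?case by (cases "p = q") (simp_all add: Finite_Cartesian_Product.mat_def bv_limit_const)
next
  case (Suc m)
  have "p = 1 \<or> p = 2" by (rule exhaust_2)
  then show ?case
  proof
    assume "p = 1"
    then show ?thesis using Suc by (simp add: entries_2 transfer_mat_entries)
  next
    assume [simp]: "p = 2"
    have "bv_limit (\<lambda>k. - c (n k + m) * vec_nth (vec_nth (complex_transfer_prod c d (n k) m) 1) q
        + d (n k + m) * vec_nth (vec_nth (complex_transfer_prod c d (n k) m) 2) q)
      (- of_real (\<alpha> (N + m - 1) / \<alpha> (N + m)) * of_real (vec_nth (vec_nth (transfer_prod \<alpha> \<beta> N m 0) 1) q)
        + of_real (- \<beta> (N + m) / \<alpha> (N + m)) * of_real (vec_nth (vec_nth (transfer_prod \<alpha> \<beta> N m 0) 2) q))"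
      by (intro bv_limit_add bv_limit_mult bv_limit_minus c d Suc)
    then show ?thesis by (simp add: entries_2 transfer_mat_entries)
  qed
qed

text \<open>Carleman's condition concerns all indices, while the contraction over one period sees a single residue
class; bounded quotients of consecutive terms make the two comparable.\<close>

lemma summable_if_residue_summable:
  fixes u :: "nat \<Rightarrow> real"
  assumes u: "\<And>n. u n \<ge> 0" and K: "K \<ge> 0" "\<And>n. u (Suc n) \<le> K * u n" and N: "N \<ge> 1"
    and sum: "summable (\<lambda>k. u (m + k * N))"
  shows "summable u"
proof -
  have pow: "u (n + j) \<le> K ^ j * u n" for n j
  proof (induction j)
    case (Suc j)
    have "u (n + Suc j) \<le> K * u (n + j)" using K(2)[of "n + j"] by simp
    also have "\<dots> \<le> K * (K ^ j * u n)" using Suc K by (intro mult_left_mono) auto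
    finally show ?case by (simp add: mult_ac)
  qed simp
  define S where "S = (\<Sum>j<N. K ^ j) * (\<Sum>k. u (m + k * N))"
  have block: "(\<Sum>i<k * N. u (m + i)) \<le> S" for k
  proof -
    have "(\<Sum>i<k * N. u (m + i)) = (\<Sum>q<k. \<Sum>j<N. u (m + q * N + j))"
    proof -
      have "(\<Sum>i=q * N..<q * N + N. u (m + i)) = (\<Sum>j<N. u (m + q * N + j))" for q
        by (rule sum.reindex_bij_witness[of _ "\<lambda>j. q * N + j" "\<lambda>i. i - q * N"]) (auto simp: add_ac)
      then show ?thesis by (simp flip: sum.nat_group)
    qed
    also have "\<dots> \<le> (\<Sum>q<k. \<Sum>j<N. K ^ j * u (m + q * N))"
      by (intro sum_mono pow)
    also have "\<dots> = (\<Sum>j<N. K ^ j) * (\<Sum>q<k. u (m + q * N))"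
      by (simp add: sum_product sum.swap[of _ "{..<N}"])
    also have "\<dots> \<le> S"
      unfolding S_def using sum u K by (intro mult_left_mono sum_le_suminf sum_nonneg) auto
    finally show ?thesis .
  qed
  have "summable (\<lambda>i. u (m + i))"
  proof (rule bounded_imp_summable)
    show "(\<Sum>i\<le>n. u (m + i)) \<le> S" for n
    proof -
      have "n < Suc n * N" using N by (metis Suc_le_eq le_trans mult_le_mono2 mult.right_neutral order_refl)
      then have "(\<Sum>i\<le>n. u (m + i)) \<le> (\<Sum>i<Suc n * N. u (m + i))"
        by (intro sum_mono2) (auto simp: u)
      then show ?thesis using block[of "Suc n"] by linarith
    qed
  qed (rule u)
  then show ?thesis by (subst (asm) add.commute) (simp only: summable_iff_shift)
qed

text \<open>The fixed point \<open>\<omega>\<^sub>k\<close> of the \<open>k\<close>-th period of the Riccati recursion at the complex point \<open>z\<close> is used as the moving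
reference. With the fixed point for a real spectral parameter instead, the displacement in one period
would be of the order \<open>1 / a\<^sub>k\<close>, as large as the contraction. The recursion is followed
over whole periods starting at index \<open>N - 1\<close>; the other residue classes follow by continuity.\<close>

lemma ratio_asymptotically_periodic:
  fixes a b \<alpha> \<beta> :: "nat \<Rightarrow> real" and z :: complex
  assumes N: "N \<ge> 1" and a: "\<forall>n. a n > 0" and \<alpha>: "\<forall>n. \<alpha> n > 0"
    and per: "periodic_seq N \<alpha>" "periodic_seq N \<beta>"
    and modulated: "periodically_modulated \<alpha> \<beta> a b"
    and elliptic: "trace (monodromy N \<alpha> \<beta> N 0) \<in> {-2<..<2}"
    and D1: "(\<lambda>n. a (n - 1) / a n) \<in> D1 N" "(\<lambda>n. b n / a n) \<in> D1 N" "(\<lambda>n. 1 / a n) \<in> D1 N"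
    and carleman: "\<not> summable (\<lambda>n. 1 / a n)"
    and z: "Im z > 0"
  obtains s :: "nat \<Rightarrow> complex" where
    "\<And>j. Im (s j) > 0" "\<And>j. s (j + N) = s j"
    "\<And>j. s (Suc j) = of_real (- \<beta> (N + j) / \<alpha> (N + j)) - of_real (\<alpha> (N + j - 1) / \<alpha> (N + j)) / s j"
    "\<And>j. (\<lambda>k. ratio a b z (N - 1 + j + k * N)) \<longlonglongrightarrow> s j"
proof -
  define c where "c n = a (n - 1) / a n" for n
  define d where "d n = (z - of_real (b n)) / of_real (a n)" for n
  define R where "R k = ratio a b z (N - 1 + k * N)" for k
  have apos: "a n > 0" "a n \<noteq> 0" for n using a[rule_format, of n] by auto
  have cpos: "c n > 0" for n using apos by (simp add: c_def)
  have Imd: "Im (d n) = Im z / a n" for n by (simp add: d_def Im_divide_of_real)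
  have Imd_pos: "Im (d n) > 0" for n using z apos by (simp add: Imd)
  have ratio_upper: "Im (ratio a b z n) > 0" for n using Im_ratio_pos[OF a z] .
  have ratio_step: "ratio a b z (Suc n) = d (Suc n) - of_real (c (Suc n)) / ratio a b z n" for n
    using ratio_Suc[OF a z] by (simp add: d_def c_def)
  have per_mult: "\<alpha> (m + k * N) = \<alpha> m" "\<beta> (m + k * N) = \<beta> m" for m k
    using per by (auto intro: periodic_seq_mult)
  have inv_a: "(\<lambda>n. \<bar>1 / a n - 0\<bar>) \<longlonglongrightarrow> 0"
  proof -
    have "filterlim a at_infinity sequentially"
      using modulated by (auto simp: periodically_modulated_def intro: filterlim_at_top_imp_at_infinity)
    then have "(\<lambda>n. 1 / a n) \<longlonglongrightarrow> 0" by (rule tendsto_divide_0[OF tendsto_const])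
    then show ?thesis unfolding diff_zero by (rule tendsto_rabs_zero)
  qed
  have cbv: "bv_limit (\<lambda>k. of_real (c (m + k * N))) (of_real (\<alpha> (m - 1) / \<alpha> m))" if m: "m \<ge> 1" for m
    unfolding c_def
  proof (rule D1_bv_limit[where x = "\<lambda>n. a (n - 1) / a n" and y = "\<lambda>n. \<alpha> (n - 1) / \<alpha> n", OF D1(1) m N])
    show "(\<lambda>n. \<bar>a (n - 1) / a n - \<alpha> (n - 1) / \<alpha> n\<bar>) \<longlonglongrightarrow> 0"
      using modulated by (simp add: periodically_modulated_def)
    show "\<alpha> (m + k * N - 1) / \<alpha> (m + k * N) = \<alpha> (m - 1) / \<alpha> m" for k
      using m per_mult(1)[of "m - 1" k] per_mult(1)[of m k] by simp
  qed
  have dbv: "bv_limit (\<lambda>k. d (m + k * N)) (of_real (- \<beta> m / \<alpha> m))" if m: "m \<ge> 1" for m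
  proof -
    have "bv_limit (\<lambda>k. of_real (b (m + k * N) / a (m + k * N))) (of_real (\<beta> m / \<alpha> m))"
    proof (rule D1_bv_limit[where x = "\<lambda>n. b n / a n" and y = "\<lambda>n. \<beta> n / \<alpha> n", OF D1(2) m N])
      show "(\<lambda>n. \<bar>b n / a n - \<beta> n / \<alpha> n\<bar>) \<longlonglongrightarrow> 0"
        using modulated by (simp add: periodically_modulated_def)
    qed (simp add: per_mult)
    moreover have "bv_limit (\<lambda>k. of_real (1 / a (m + k * N))) (of_real 0)"
      by (rule D1_bv_limit[where x = "\<lambda>n. 1 / a n" and y = "\<lambda>n. 0", OF D1(3) m N inv_a]) simp
    ultimately have "bv_limit (\<lambda>k. z * of_real (1 / a (m + k * N)) + - of_real (b (m + k * N) / a (m + k * N)))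
        (z * of_real 0 + - of_real (\<beta> m / \<alpha> m))"
      by (intro bv_limit_add bv_limit_mult bv_limit_minus bv_limit_const)
    moreover have "z * of_real (1 / a (m + k * N)) + - of_real (b (m + k * N) / a (m + k * N)) = d (m + k * N)" for k
      by (simp add: d_def diff_divide_distrib)
    ultimately show ?thesis by simp
  qed
  define M where "M k p q = vec_nth (vec_nth (complex_transfer_prod (\<lambda>n. of_real (c n)) d (N + k * N) N) p) q" for k p q
  define T where "T p q = vec_nth (vec_nth (monodromy N \<alpha> \<beta> N 0) p) q" for p q
  have Mbv: "bv_limit (\<lambda>k. M k p q) (of_real (T p q))" for p q
    unfolding M_def T_def monodromy_def
  proof (rule bv_limit_transfer_prod)
    show "bv_limit (\<lambda>k. of_real (c (N + k * N + j))) (of_real (\<alpha> (N + j - 1) / \<alpha> (N + j)))" for j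
      using cbv[of "N + j"] N by (simp add: add_ac)
    show "bv_limit (\<lambda>k. d (N + k * N + j)) (of_real (- \<beta> (N + j) / \<alpha> (N + j)))" for j
      using dbv[of "N + j"] N by (simp add: add_ac)
  qed
  have neg: "(T 1 1 - T 2 2)\<^sup>2 + 4 * T 1 2 * T 2 1 < 0"
    using discr_monodromy_neg[OF N \<alpha> per(1) elliptic]
    by (simp add: discr_def trace_def sum_2 det_2 T_def power2_eq_square algebra_simps)
  have "bv_limit (\<lambda>k. M k 1 1 + - M k 2 2) (of_real (T 1 1) + - of_real (T 2 2))"
    by (intro bv_limit_add bv_limit_minus Mbv)
  then have Ebv: "bv_limit (\<lambda>k. M k 1 1 - M k 2 2) (of_real (T 1 1 - T 2 2))" by simp
  obtain \<omega> w where \<omega>: "bv_limit \<omega> w" and w: "Im w > 0"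
    and root: "\<forall>\<^sub>F k in sequentially. M k 1 2 * (\<omega> k)\<^sup>2 + (M k 1 1 - M k 2 2) * \<omega> k - M k 2 1 = 0"
    using quadratic_root_bv[OF Mbv[of 1 2] Ebv Mbv[of 2 1] neg] by blast
  define h where "h = Im w / 2"
  have h: "h > 0" using w by (simp add: h_def)
  have \<omega>lim: "\<omega> \<longlonglongrightarrow> w" using \<omega> by (simp add: bv_limit_def)
  have "\<forall>\<^sub>F k in sequentially. Im (\<omega> k) > h"
    using order_tendstoD(1)[OF tendsto_Im[OF \<omega>lim], of h] w by (simp add: h_def)
  moreover have "\<forall>\<^sub>F k in sequentially. Im (\<omega> k) < 2 * Im w"
    using order_tendstoD(2)[OF tendsto_Im[OF \<omega>lim], of "2 * Im w"] w by simp
  moreover have "\<forall>\<^sub>F k in sequentially. cmod (\<omega> (Suc k) - \<omega> k) < 1"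
    using \<omega> by (intro order_tendstoD(2)[OF summable_LIMSEQ_zero]) (auto simp: bv_limit_def)
  ultimately have "\<forall>\<^sub>F k in sequentially. Im (\<omega> k) > h \<and> Im (\<omega> k) < 2 * Im w \<and> cmod (\<omega> (Suc k) - \<omega> k) < 1
     \<and> M k 1 2 * (\<omega> k)\<^sup>2 + (M k 1 1 - M k 2 2) * \<omega> k - M k 2 1 = 0"
    using root by eventually_elim auto
  then obtain k0 where k0: "\<And>k. k \<ge> k0 \<Longrightarrow> Im (\<omega> k) > h" "\<And>k. k \<ge> k0 \<Longrightarrow> Im (\<omega> k) < 2 * Im w"
     "\<And>k. k \<ge> k0 \<Longrightarrow> cmod (\<omega> (Suc k) - \<omega> k) < 1"
     "\<And>k. k \<ge> k0 \<Longrightarrow> M k 1 2 * (\<omega> k)\<^sup>2 + (M k 1 1 - M k 2 2) * \<omega> k - M k 2 1 = 0"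
    unfolding eventually_sequentially by blast
  \<comment> \<open>The last of the \<open>N\<close> steps provides the contraction; the others do not increase the gap.\<close>
  define \<theta> where "\<theta> k = Im (d (N + k * N + (N - 1))) / Im (\<omega> k)" for k
  have contract: "hyp_gap (R (Suc k)) (\<omega> k) \<le> (1 - \<theta> k) * hyp_gap (R k) (\<omega> k)" "\<theta> k \<le> 1" if k: "k \<ge> k0" for k
  proof -
    \<comment> \<open>The fixed point itself is moved through the period, to be compared with the ratios step by step.\<close>
    define orb where "orb = rec_nat (\<omega> k) (\<lambda>j x. d (N + k * N + j) - of_real (c (N + k * N + j)) / x)"
    have o0: "orb 0 = \<omega> k" and oS: "orb (Suc j) = d (N + k * N + j) - of_real (c (N + k * N + j)) / orb j" for j
      by (simp_all add: orb_def)
    have o_up: "Im (orb j) > 0" for j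
    proof (induction j)
      case 0
      then show ?case using k0(1)[OF k] h by (simp add: o0)
    next
      case (Suc j)
      then show ?case unfolding oS using cpos Imd_pos by (intro riccati_upper) (auto intro: less_imp_le)
    qed
    have orb_nz: "orb j \<noteq> 0" for j using o_up[of j] by auto
    have "orb N = \<omega> k"
      unfolding o0[symmetric]
      by (rule riccati_fixed_point[where c = "\<lambda>n. of_real (c n)" and d = d and n = "N + k * N", OF oS])
        (use orb_nz k0(4)[OF k] in \<open>simp_all add: M_def o0\<close>)
    let ?r = "\<lambda>j. ratio a b z (N - 1 + k * N + j)"
    have rS: "?r (Suc j) = d (N + k * N + j) - of_real (c (N + k * N + j)) / ?r j" for j
      using ratio_step[of "N - 1 + k * N + j"] N by simp
    have one_step: "hyp_gap (?r (Suc j)) (orb (Suc j)) \<le> (1 - Im (d (N + k * N + j)) / Im (orb (Suc j))) * hyp_gap (?r j) (orb j)" for j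
      unfolding rS oS
      by (rule hyp_gap_riccati_contraction) (use ratio_upper o_up cpos Imd_pos in \<open>auto intro: less_imp_le\<close>)
    have lt: "Im (d (N + k * N + j)) < Im (orb (Suc j))" for j
      unfolding oS using o_up cpos Imd_pos by (intro riccati_upper) (auto intro: less_imp_le)
    have mono: "hyp_gap (?r j) (orb j) \<le> hyp_gap (R k) (\<omega> k)" for j
    proof (induction j)
      case (Suc j)
      have "0 \<le> Im (d (N + k * N + j)) / Im (orb (Suc j))" "Im (d (N + k * N + j)) / Im (orb (Suc j)) \<le> 1"
        using Imd_pos[of "N + k * N + j"] o_up[of "Suc j"] lt[of j] by (simp_all only: divide_nonneg_pos divide_le_eq_1_pos less_imp_le)
      then have "(1 - Im (d (N + k * N + j)) / Im (orb (Suc j))) * hyp_gap (?r j) (orb j) \<le> hyp_gap (?r j) (orb j)"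
        using hyp_gap_nonneg[OF ratio_upper o_up[of j]] by (intro mult_left_le_one_le) auto
      then show ?case using one_step[of j] Suc by linarith
    qed (simp add: R_def o0)
    have NN: "Suc (N - 1) = N" using N by simp
    have \<theta>1: "\<theta> k \<le> 1" using lt[of "N - 1"] k0(1)[OF k] h unfolding NN \<open>orb N = \<omega> k\<close> \<theta>_def by (simp add: divide_le_eq)
    then show "\<theta> k \<le> 1" .
    have "R (Suc k) = ?r N" using N by (simp add: R_def add_ac)
    then have "hyp_gap (R (Suc k)) (\<omega> k) \<le> (1 - \<theta> k) * hyp_gap (?r (N - 1)) (orb (N - 1))"
      using one_step[of "N - 1"] unfolding NN \<open>orb N = \<omega> k\<close> \<theta>_def by simp
    also have "\<dots> \<le> (1 - \<theta> k) * hyp_gap (R k) (\<omega> k)"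
      using mono \<theta>1 by (intro mult_left_mono) auto
    finally show "hyp_gap (R (Suc k)) (\<omega> k) \<le> (1 - \<theta> k) * hyp_gap (R k) (\<omega> k)" .
  qed
  define C where "C = (1 + 2 / h) + 4 / h\<^sup>2 + (1 + 2 / h) * (4 / h\<^sup>2)"
  have C: "C \<ge> 0" using h by (simp add: C_def)
  define e where "e k = C * cmod (\<omega> (Suc k) - \<omega> k)" for k
  have \<omega>_up: "Im (\<omega> k) > 0" if "k \<ge> k0" for k using k0(1)[OF that] h by linarith
  have R_up: "Im (R k) > 0" for k by (simp add: R_def ratio_upper)
  have "(\<lambda>k. hyp_gap (R (k + k0)) (\<omega> (k + k0))) \<longlonglongrightarrow> 0"
  proof (rule perturbed_contraction_tendsto_zero[where \<theta> = "\<lambda>k. \<theta> (k + k0)" and e = "\<lambda>k. e (k + k0)"])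
    fix k
    let ?k = "k + k0"
    have k: "?k \<ge> k0" "Suc ?k \<ge> k0" by auto
    show "0 \<le> hyp_gap (R ?k) (\<omega> ?k)" using hyp_gap_nonneg R_up \<omega>_up by simp
    show "0 \<le> \<theta> ?k" using Imd_pos \<omega>_up[OF k(1)] by (simp add: \<theta>_def less_imp_le)
    show "\<theta> ?k \<le> 1" by (rule contract(2)[OF k(1)])
    show "0 \<le> e ?k" using C by (simp add: e_def)
    have sw: "cmod (\<omega> ?k - \<omega> (Suc ?k)) = cmod (\<omega> (Suc ?k) - \<omega> ?k)" by (rule norm_minus_commute)
    have "hyp_gap (R (Suc ?k)) (\<omega> (Suc ?k)) \<le> (1 + e ?k) * hyp_gap (R (Suc ?k)) (\<omega> ?k) + e ?k"
      using hyp_gap_change_reference[OF R_up h less_imp_le[OF k0(1)[OF k(1)]] less_imp_le[OF k0(1)[OF k(2)]], of "Suc ?k"]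
        k0(3)[OF k(1)] unfolding e_def C_def sw by simp
    also have "\<dots> \<le> (1 + e ?k) * ((1 - \<theta> ?k) * hyp_gap (R ?k) (\<omega> ?k)) + e ?k"
      using contract(1)[OF k(1)] \<open>0 \<le> e ?k\<close> by (intro add_right_mono mult_left_mono) auto
    finally show "hyp_gap (R (Suc k + k0)) (\<omega> (Suc k + k0)) \<le> (1 + e ?k) * ((1 - \<theta> ?k) * hyp_gap (R ?k) (\<omega> ?k)) + e ?k"
      by simp
  next
    have "summable e" unfolding e_def[abs_def] using \<omega> by (auto simp: bv_limit_def intro: summable_mult)
    then show "summable (\<lambda>k. e (k + k0))" by (simp only: summable_iff_shift)
    show "\<not> summable (\<lambda>k. \<theta> (k + k0))"
    proof
      assume "summable (\<lambda>k. \<theta> (k + k0))"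
      then have "summable (\<lambda>k. (2 * Im w / Im z) * \<theta> (k + k0))" by (rule summable_mult)
      \<comment> \<open>The height of \<open>\<omega>\<close> is bounded, so \<open>\<theta>\<close> is at least a constant times \<open>1 / a\<close>.\<close>
      then have "summable (\<lambda>k. 1 / a (N + N - 1 + (k + k0) * N))"
      proof (rule summable_comparison_test')
        fix k
        let ?n = "N + (k + k0) * N + (N - 1)"
        have n: "?n = N + N - 1 + (k + k0) * N" using N by simp
        have "1 \<le> 2 * Im w / Im (\<omega> (k + k0))"
          using k0(2)[of "k + k0"] \<omega>_up[of "k + k0"] by simp
        then have "1 * (1 / a ?n) \<le> (2 * Im w / Im (\<omega> (k + k0))) * (1 / a ?n)"
          using apos(1)[of ?n] by (intro mult_right_mono) auto
        also have "\<dots> = (2 * Im w / Im z) * \<theta> (k + k0)"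
          unfolding \<theta>_def Imd using z by simp
        finally show "norm (1 / a (N + N - 1 + (k + k0) * N)) \<le> (2 * Im w / Im z) * \<theta> (k + k0)"
          unfolding n using apos(1)[of "N + N - 1 + (k + k0) * N"] by simp
      qed
      then have "summable (\<lambda>k. 1 / a (N + N - 1 + k * N))" by (subst (asm) summable_iff_shift)
      moreover obtain K where K: "\<And>n. c n \<le> K"
      proof -
        define q where "q n = \<alpha> n / \<alpha> (Suc n)" for n
        have "q (n + N) = q n" for n using per by (simp add: q_def periodic_seq_def flip: add_Suc)
        then obtain B where B: "\<And>n. \<bar>q n\<bar> \<le> B" using periodic_bounded[of N q] N by auto
        have "(\<lambda>n. \<bar>c n - \<alpha> (n - 1) / \<alpha> n\<bar>) \<longlonglongrightarrow> 0"
          using modulated by (simp add: periodically_modulated_def c_def)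
        then obtain B' where B': "\<And>n. \<bar>\<bar>c n - \<alpha> (n - 1) / \<alpha> n\<bar>\<bar> \<le> B'"
          by (rule tendsto_imp_abs_bounded) blast
        have "c n \<le> max 1 (B + B')" for n
        proof (cases n)
          case 0
          then show ?thesis using apos by (simp add: c_def)
        next
          case (Suc m)
          have "\<alpha> m / \<alpha> (Suc m) \<le> B" using order_trans[OF abs_ge_self B[of m]] unfolding q_def .
          then have "c n \<le> B + B'" using B'[of n] Suc by simp
          then show ?thesis by simp
        qed
        then show ?thesis by (rule that)
      qed
      ultimately have "summable (\<lambda>n. 1 / a n)"
      proof (intro summable_if_residue_summable[where u = "\<lambda>n. 1 / a n" and K = K and N = N and m = "N + N - 1"])
        show "0 \<le> K" using K[of 0] cpos[of 0] by linarith
        show "1 / a (Suc n) \<le> K * (1 / a n)" for n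
          using K[of "Suc n"] apos(1)[of n] apos(1)[of "Suc n"] by (simp add: c_def field_simps)
      qed (use apos(1) N in \<open>auto intro: less_imp_le\<close>)
      with carleman show False by simp
    qed
  qed
  then have "(\<lambda>k. R (k + k0)) \<longlonglongrightarrow> w"
    by (rule hyp_gap_tendsto_zero[rotated 2]) (use R_up \<omega>_up \<omega>lim in \<open>auto intro: LIMSEQ_ignore_initial_segment\<close>)
  then have Rlim: "R \<longlonglongrightarrow> w" by (rule LIMSEQ_offset)
  define s where "s = rec_nat w (\<lambda>j x. of_real (- \<beta> (N + j) / \<alpha> (N + j)) - of_real (\<alpha> (N + j - 1) / \<alpha> (N + j)) / x)"
  have s0: "s 0 = w" and sS: "s (Suc j) = of_real (- \<beta> (N + j) / \<alpha> (N + j)) - of_real (\<alpha> (N + j - 1) / \<alpha> (N + j)) / s j" for j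
    by (simp_all add: s_def)
  have s_up: "Im (s j) > 0" for j
  proof (induction j)
    case (Suc j)
    then show ?case unfolding sS
      using \<alpha>[rule_format, of "N + j"] \<alpha>[rule_format, of "N + j - 1"] by (intro riccati_upper) auto
  qed (simp add: s0 w)
  have slim: "(\<lambda>k. ratio a b z (N - 1 + j + k * N)) \<longlonglongrightarrow> s j" for j
  proof (induction j)
    case 0
    then show ?case using Rlim by (simp add: s0 R_def[abs_def])
  next
    case (Suc j)
    have "ratio a b z (N - 1 + Suc j + k * N) =
        d (N + j + k * N) - of_real (c (N + j + k * N)) / ratio a b z (N - 1 + j + k * N)" for k
      using ratio_step[of "N - 1 + j + k * N"] N by simp
    moreover have "(\<lambda>k. d (N + j + k * N) - of_real (c (N + j + k * N)) / ratio a b z (N - 1 + j + k * N)) \<longlonglongrightarrow> s (Suc j)"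
      unfolding sS using cbv[of "N + j"] dbv[of "N + j"] N s_up[of j]
      by (intro tendsto_diff tendsto_divide Suc) (auto simp: bv_limit_def)
    ultimately show ?case by simp
  qed
  have "s N = s 0"
  proof (rule LIMSEQ_unique[OF slim])
    have "(\<lambda>k. R (Suc k)) \<longlonglongrightarrow> s 0" unfolding s0 using Rlim by (rule LIMSEQ_Suc)
    then show "(\<lambda>k. ratio a b z (N - 1 + N + k * N)) \<longlonglongrightarrow> s 0" by (simp add: R_def add_ac)
  qed
  then have sper: "s (j + N) = s j" for j
  proof (induction j)
    case (Suc j)
    have "\<alpha> (N + (j + N)) = \<alpha> (N + j)" "\<beta> (N + (j + N)) = \<beta> (N + j)" "\<alpha> (N + (j + N) - 1) = \<alpha> (N + j - 1)"
      using per_mult(1)[of "N + j" 1] per_mult(2)[of "N + j" 1] per_mult(1)[of "N + j - 1" 1] N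
      by (simp_all add: add_ac)
    then show ?case using Suc sS[of "j + N"] sS[of j] by simp
  qed simp
  show ?thesis by (rule that[OF s_up sper sS slim])
qed

section \<open>Growth of the orthonormal polynomials off the real axis\<close>

text \<open>Taking logarithms in the product formula leaves a sum of \<open>ln (1 + y\<^sub>k)\<close> with \<open>y\<^sub>k\<close> asymptotic to
the weight \<open>\<alpha>\<^sub>k / a\<^sub>k\<close> times an \<open>N\<close>-periodic sequence. The term \<open>ln a\<^sub>n\<close> is not small compared with
\<open>\<rho>\<^sub>n\<close> in general, but it does not depend on \<open>z\<close>.\<close>

lemma log_orth_asymptotics:
  fixes a b \<alpha> :: "nat \<Rightarrow> real" and z :: complex and s :: "nat \<Rightarrow> complex"
  assumes N: "N \<ge> 1" and a: "\<forall>n. a n > 0" and \<alpha>: "\<forall>n. \<alpha> n > 0" and per: "periodic_seq N \<alpha>"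
    and a_ratio: "(\<lambda>n. \<bar>a (n - 1) / a n - \<alpha> (n - 1) / \<alpha> n\<bar>) \<longlonglongrightarrow> 0"
    and a_top: "filterlim a at_top sequentially"
    and carleman: "\<not> summable (\<lambda>n. 1 / a n)"
    and z: "Im z > 0"
    and s_up: "\<And>j. Im (s j) > 0" and s_per: "\<And>j. s (j + N) = s j"
    and slim: "\<And>j. (\<lambda>k. ratio a b z (N - 1 + j + k * N)) \<longlonglongrightarrow> s j"
  shows "filterlim (rho \<alpha> a) at_top sequentially"
    and "(\<lambda>n. (ln ((cmod (orthonormal a b z (Suc n)))\<^sup>2) + ln (a n)) / rho \<alpha> a n)
      \<longlonglongrightarrow> Im z * (\<Sum>j<N. recip_height (s j) / \<alpha> (N + j - 1)) / N"
proof -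
  define v where "v = Im z"
  define w where "w k = \<alpha> k / a k" for k
  define \<kappa> where "\<kappa> k = recip_height (ratio a b z k)" for k
  define y where "y k = v * \<kappa> k / a k" for k
  \<comment> \<open>The ratio with index \<open>N - 1 + j\<close> belongs to \<open>s j\<close>; by periodicity index \<open>k\<close> belongs to \<open>s (k + 1)\<close>.\<close>
  define l where "l k = recip_height (s (Suc k))" for k
  have apos: "a n > 0" "a n \<noteq> 0" "\<alpha> n > 0" "\<alpha> n \<noteq> 0" for n
    using a[rule_format, of n] \<alpha>[rule_format, of n] by auto
  have v: "v > 0" using z by (simp add: v_def)
  have \<kappa>: "\<kappa> k > 0" for k using recip_height_pos[OF Im_ratio_pos[OF a z]] by (simp add: \<kappa>_def)
  have y: "y k > 0" for k using v \<kappa> apos by (simp add: y_def)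
  have w: "w k > 0" for k using apos by (simp add: w_def)
  have l: "l k > 0" for k using recip_height_pos[OF s_up] by (simp add: l_def)
  have l_per: "l (k + N) = l k" for k using s_per[of "Suc k"] by (simp add: l_def)
  have \<alpha>_per: "\<alpha> (k + N) = \<alpha> k" for k using per by (simp add: periodic_seq_def)
  obtain A where A: "\<And>k. \<alpha> k \<le> A" "\<And>k. 1 / \<alpha> k \<le> A"
  proof -
    obtain B1 where B1: "\<And>k. \<bar>\<alpha> k\<bar> \<le> B1" using periodic_bounded[of N \<alpha>] N \<alpha>_per by auto
    obtain B2 where B2: "\<And>k. \<bar>1 / \<alpha> k\<bar> \<le> B2" using periodic_bounded[of N "\<lambda>k. 1 / \<alpha> k"] N \<alpha>_per by auto
    show ?thesis
    proof (rule that[of "max B1 B2"])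
      show "\<alpha> k \<le> max B1 B2" "1 / \<alpha> k \<le> max B1 B2" for k
        using order_trans[OF abs_ge_self B1[of k]] order_trans[OF abs_ge_self B2[of k]]
        by (simp_all only: le_max_iff_disj) blast+
    qed
  qed
  have A0: "A > 0" using A(1)[of 0] apos(3)[of 0] by linarith
  have inv_a: "(\<lambda>n. 1 / a n) \<longlonglongrightarrow> 0"
    by (rule tendsto_divide_0[OF tendsto_const filterlim_at_top_imp_at_infinity[OF a_top]])
  have w_lim: "w \<longlonglongrightarrow> 0"
  proof (rule tendsto_0_le[OF inv_a, where K = A])
    have "norm (w k) \<le> norm (1 / a k) * A" for k
      using divide_right_mono[OF A(1)[of k], of "a k"] apos(1,3)[of k] by (simp add: w_def)
    then show "\<forall>\<^sub>F k in sequentially. norm (w k) \<le> norm (1 / a k) * A" by simp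
  qed
  then obtain W where W: "\<And>k. w k \<le> W"
    by (meson abs_le_D1 tendsto_imp_abs_bounded)
  have w_div: "\<not> summable w"
  proof
    assume "summable w"
    then have "summable (\<lambda>k. A * w k)" by (rule summable_mult)
    then have "summable (\<lambda>n. 1 / a n)"
    proof (rule summable_comparison_test')
      fix n
      have "1 \<le> A * \<alpha> n" using A(2)[of n] apos(3)[of n] by (simp add: field_simps)
      then have "1 / a n \<le> A * \<alpha> n / a n" using apos(1)[of n] by (intro divide_right_mono) auto
      then show "norm (1 / a n) \<le> A * w n" using apos(1)[of n] by (simp add: w_def)
    qed
    with carleman show False by simp
  qed
  have div: "filterlim (\<lambda>n. \<Sum>k<n. w k) at_top sequentially"
    using w by (intro filterlim_sum_at_top w_div) (auto intro: less_imp_le)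
  have rho: "rho \<alpha> a n = (\<Sum>k<Suc n. w k)" for n
    by (simp add: rho_def w_def atLeast0AtMost lessThan_Suc_atMost)
  have divS: "filterlim (\<lambda>n. \<Sum>k<Suc n. w k) at_top sequentially"
    by (rule filterlim_compose[OF div filterlim_Suc])
  then show rho_top: "filterlim (rho \<alpha> a) at_top sequentially" by (simp add: rho[abs_def])
  have slow: "(\<lambda>k. w (Suc k) / w k) \<longlonglongrightarrow> 1"
  proof -
    have "(\<lambda>n. a (n - 1) / a n - \<alpha> (n - 1) / \<alpha> n) \<longlonglongrightarrow> 0" using a_ratio by (simp add: tendsto_rabs_zero_iff)
    from LIMSEQ_Suc[OF this] have 0: "(\<lambda>n. a n / a (Suc n) - \<alpha> n / \<alpha> (Suc n)) \<longlonglongrightarrow> 0" by simp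
    have "(\<lambda>k. w (Suc k) / w k - 1) \<longlonglongrightarrow> 0"
    proof (rule tendsto_0_le[OF 0, where K = "A * A"])
      have "norm (w (Suc k) / w k - 1) \<le> norm (a k / a (Suc k) - \<alpha> k / \<alpha> (Suc k)) * (A * A)" for k
      proof -
        have eq: "w (Suc k) / w k - 1 = (a k / a (Suc k) - \<alpha> k / \<alpha> (Suc k)) * (\<alpha> (Suc k) * (1 / \<alpha> k))"
          using apos[of k] apos[of "Suc k"] by (simp add: w_def field_simps)
        have le: "\<alpha> (Suc k) * (1 / \<alpha> k) \<le> A * A"
          using A apos A0 by (intro mult_mono) (auto intro: less_imp_le)
        have nn: "\<alpha> (Suc k) * (1 / \<alpha> k) \<ge> 0" using apos[of k] apos[of "Suc k"] by simp
        have "norm (w (Suc k) / w k - 1) =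
            norm (a k / a (Suc k) - \<alpha> k / \<alpha> (Suc k)) * (\<alpha> (Suc k) * (1 / \<alpha> k))"
          unfolding eq real_norm_def abs_mult[of "_ - _"] abs_of_nonneg[OF nn] ..
        also have "\<dots> \<le> norm (a k / a (Suc k) - \<alpha> k / \<alpha> (Suc k)) * (A * A)"
          using le by (intro mult_left_mono) auto
        finally show ?thesis .
      qed
      then show "\<forall>\<^sub>F k in sequentially. norm (w (Suc k) / w k - 1) \<le> norm (a k / a (Suc k) - \<alpha> k / \<alpha> (Suc k)) * (A * A)"
        by simp
    qed
    then show ?thesis by (simp add: LIM_zero_iff)
  qed
  have l_res: "l (N - 1 + j + k * N) = recip_height (s j)" for j k
  proof -
    have sk: "s (j + k * N) = s j" for k
    proof (induction k)
      case (Suc k)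
      have "j + Suc k * N = j + k * N + N" by simp
      then show ?case using s_per[of "j + k * N"] Suc by (simp only:)
    qed simp
    have "Suc (N - 1 + j + k * N) = j + Suc k * N" using N by simp
    then show ?thesis unfolding l_def using sk[of "Suc k"] by (simp only:)
  qed
  have kap_lim: "(\<lambda>k. \<kappa> (N - 1 + j + k * N)) \<longlonglongrightarrow> recip_height (s j)" for j
    unfolding \<kappa>_def recip_height_def using slim[of j] s_up[of j] by (intro tendsto_intros) auto
  have \<kappa>_l: "(\<lambda>k. \<kappa> k - l k) \<longlonglongrightarrow> 0"
  proof (rule tendsto_zero_if_residues[of N _ "N - 1"])
    show "(\<lambda>k. \<kappa> (N - 1 + j + k * N) - l (N - 1 + j + k * N)) \<longlonglongrightarrow> 0" for j
      unfolding l_res using kap_lim[of j] by (simp add: LIM_zero_iff)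
  qed (use N in simp)
  have ln_\<kappa>_l: "(\<lambda>k. ln (\<kappa> k) - ln (l k)) \<longlonglongrightarrow> 0"
  proof (rule tendsto_zero_if_residues[of N _ "N - 1"])
    fix j
    have "(\<lambda>k. ln (\<kappa> (N - 1 + j + k * N))) \<longlonglongrightarrow> ln (recip_height (s j))"
      using kap_lim[of j] recip_height_pos[OF s_up[of j]] by (intro tendsto_ln) auto
    then show "(\<lambda>k. ln (\<kappa> (N - 1 + j + k * N)) - ln (l (N - 1 + j + k * N))) \<longlonglongrightarrow> 0"
      unfolding l_res by (simp add: LIM_zero_iff)
  qed (use N in simp)
  obtain L where L: "\<And>k. \<bar>l k\<bar> \<le> L" using periodic_bounded[of N l] N l_per by auto
  obtain L' where L': "\<And>k. \<bar>ln (l k)\<bar> \<le> L'" using periodic_bounded[of N "\<lambda>k. ln (l k)"] N l_per by auto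
  obtain E where E: "\<And>k. \<bar>\<kappa> k - l k\<bar> \<le> E" using tendsto_imp_abs_bounded[OF \<kappa>_l] by blast
  obtain E' where E': "\<And>k. \<bar>ln (\<kappa> k) - ln (l k)\<bar> \<le> E'" using tendsto_imp_abs_bounded[OF ln_\<kappa>_l] by blast
  have \<kappa>_bd: "\<kappa> k \<le> L + E" for k using L[of k] E[of k] by linarith
  have ln_\<kappa>_bd: "\<bar>ln (\<kappa> k)\<bar> \<le> L' + E'" for k using L'[of k] E'[of k] by linarith
  have y_lim: "y \<longlonglongrightarrow> 0"
  proof (rule tendsto_0_le[OF inv_a, where K = "v * (L + E)"])
    have "norm (y k) \<le> norm (1 / a k) * (v * (L + E))" for k
      using \<kappa>_bd[of k] \<kappa>[of k] v apos(1)[of k] by (simp add: y_def divide_right_mono)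
    then show "\<forall>\<^sub>F k in sequentially. norm (y k) \<le> norm (1 / a k) * (v * (L + E))" by simp
  qed
  define x where "x k = ln (1 + y k) / w k" for k
  have x_lim: "(\<lambda>k. x k - v * l k / \<alpha> k) \<longlonglongrightarrow> 0"
  proof -
    have "(\<lambda>k. x k - v * \<kappa> k / \<alpha> k) \<longlonglongrightarrow> 0"
    proof (rule tendsto_0_le[OF y_lim, where K = "v * (L + E) * A"])
      have "\<forall>\<^sub>F k in sequentially. y k < 1" using order_tendstoD(2)[OF y_lim] by simp
      then show "\<forall>\<^sub>F k in sequentially. norm (x k - v * \<kappa> k / \<alpha> k) \<le> norm (y k) * (v * (L + E) * A)"
      proof eventually_elim
        case (elim k)
        have "\<bar>ln (1 + y k) - y k\<bar> \<le> (y k)\<^sup>2"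
          using ln_one_plus_pos_lower_bound[of "y k"] ln_add_one_self_le_self[of "y k"] y[of k] elim by auto
        then have "\<bar>ln (1 + y k) - y k\<bar> / w k \<le> (y k)\<^sup>2 / w k" using w[of k] by (intro divide_right_mono) auto
        moreover have "x k - v * \<kappa> k / \<alpha> k = (ln (1 + y k) - y k) / w k"
          using apos[of k] by (simp add: x_def y_def w_def field_simps)
        moreover have "(y k)\<^sup>2 / w k = y k * (v * \<kappa> k * (1 / \<alpha> k))"
          using apos[of k] by (simp add: y_def w_def power2_eq_square field_simps)
        moreover have "y k * (v * \<kappa> k * (1 / \<alpha> k)) \<le> y k * (v * (L + E) * A)"
          using y[of k] v \<kappa>_bd[of k] A(2)[of k] \<kappa>[of k] apos[of k] by (intro mult_left_mono mult_mono) auto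
        ultimately show ?case using w[of k] y[of k] by (simp add: abs_divide)
      qed
    qed
    moreover have "(\<lambda>k. v * \<kappa> k / \<alpha> k - v * l k / \<alpha> k) \<longlonglongrightarrow> 0"
    proof (rule tendsto_0_le[OF \<kappa>_l, where K = "v * A"])
      have "norm (v * \<kappa> k / \<alpha> k - v * l k / \<alpha> k) \<le> norm (\<kappa> k - l k) * (v * A)" for k
      proof -
        have "v * \<kappa> k / \<alpha> k - v * l k / \<alpha> k = (\<kappa> k - l k) * (v * (1 / \<alpha> k))"
            by (simp add: algebra_simps diff_divide_distrib)
        then have "norm (v * \<kappa> k / \<alpha> k - v * l k / \<alpha> k) = norm (\<kappa> k - l k) * (v * (1 / \<alpha> k))"
          using v apos[of k] by (simp add: abs_mult)
        also have "\<dots> \<le> norm (\<kappa> k - l k) * (v * A)"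
          using A(2)[of k] v by (intro mult_left_mono) auto
        finally show ?thesis .
      qed
      then show "\<forall>\<^sub>F k in sequentially. norm (v * \<kappa> k / \<alpha> k - v * l k / \<alpha> k) \<le> norm (\<kappa> k - l k) * (v * A)"
        by simp
    qed
    ultimately have "(\<lambda>k. (x k - v * \<kappa> k / \<alpha> k) + (v * \<kappa> k / \<alpha> k - v * l k / \<alpha> k)) \<longlonglongrightarrow> 0 + 0"
      by (rule tendsto_add)
    then show ?thesis by simp
  qed
  have "(\<lambda>n. (\<Sum>k<n. w k * x k) / (\<Sum>k<n. w k)) \<longlonglongrightarrow> (\<Sum>k<N. v * l k / \<alpha> k) / N"
    by (rule weighted_average_asymptotically_periodic[where W = W])
      (use N w div slow W x_lim l_per \<alpha>_per in auto)
  from LIMSEQ_Suc[OF this]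
  have main: "(\<lambda>n. (\<Sum>k<Suc n. w k * x k) / rho \<alpha> a n) \<longlonglongrightarrow> (\<Sum>k<N. v * l k / \<alpha> k) / N"
    unfolding rho .
  have mean: "(\<Sum>k<N. v * l k / \<alpha> k) = v * (\<Sum>j<N. recip_height (s j) / \<alpha> (N + j - 1))"
  proof -
    define g where "g j = recip_height (s j) / \<alpha> (N + j - 1)" for j
    have "(\<Sum>k<N. v * l k / \<alpha> k) = v * (\<Sum>k<N. g (Suc k))"
      using \<alpha>_per by (simp add: g_def l_def sum_distrib_left add.commute[of N])
    also have "(\<Sum>k<N. g (Suc k)) = (\<Sum>k<Suc N. g k) - g 0"
      by (subst sum.lessThan_Suc_shift) simp
    also have "\<dots> = (\<Sum>k<N. g k)"
      using s_per[of 0] \<alpha>_per[of "N - 1"] N by (simp add: g_def)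
    finally show ?thesis by (simp add: g_def)
  qed
  \<comment> \<open>The prefactor of the product formula, without its factor \<open>1 / a\<^sub>n\<close>. The subtracted term extends the
    sum to the index \<open>n\<close>, the range of summation of \<^const>\<open>rho\<close>.\<close>
  define b0 where "b0 n = ln v + ln (\<kappa> n) - ln (1 + y n)" for n
  have form: "ln ((cmod (orthonormal a b z (Suc n)))\<^sup>2) + ln (a n) = b0 n + (\<Sum>k<Suc n. w k * x k)" for n
  proof -
    have wx: "w k * x k = ln (1 + y k)" for k using w[of k] by (simp add: x_def)
    have pos: "1 + y k > 0" for k using y[of k] by simp
    have "(cmod (orthonormal a b z (Suc n)))\<^sup>2 = v * \<kappa> n / a n * (\<Prod>k<n. 1 + y k)"
      unfolding cmod_orth_product[OF a z] by (simp add: v_def \<kappa>_def y_def)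
    then have "ln ((cmod (orthonormal a b z (Suc n)))\<^sup>2) = ln (v * \<kappa> n / a n) + ln (\<Prod>k<n. 1 + y k)"
      by (simp only:) (rule ln_mult_pos, use v \<kappa>[of n] apos(1)[of n] pos in \<open>auto intro: prod_pos\<close>)
    also have "ln (\<Prod>k<n. 1 + y k) = (\<Sum>k<n. ln (1 + y k))" by (intro ln_prod) (simp, metis pos less_irrefl)
    also have "ln (v * \<kappa> n / a n) = ln v + ln (\<kappa> n) - ln (a n)"
      using v \<kappa>[of n] apos(1)[of n] by (simp add: ln_mult ln_div)
    finally show ?thesis by (simp add: wx b0_def)
  qed
  have b0_lim: "(\<lambda>n. b0 n / rho \<alpha> a n) \<longlonglongrightarrow> 0"
  proof (rule tendsto_0_le)
    show "(\<lambda>n. 1 / rho \<alpha> a n) \<longlonglongrightarrow> 0"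
      by (rule tendsto_divide_0[OF tendsto_const filterlim_at_top_imp_at_infinity[OF rho_top]])
    have "\<forall>\<^sub>F k in sequentially. y k < 1" using order_tendstoD(2)[OF y_lim] by simp
    then show "\<forall>\<^sub>F n in sequentially. norm (b0 n / rho \<alpha> a n) \<le> norm (1 / rho \<alpha> a n) * (\<bar>ln v\<bar> + (L' + E') + 1)"
    proof eventually_elim
      case (elim n)
      have "0 \<le> ln (1 + y n)" "ln (1 + y n) \<le> 1"
        using ln_add_one_self_le_self[of "y n"] y[of n] elim by auto
      then have "\<bar>b0 n\<bar> \<le> \<bar>ln v\<bar> + (L' + E') + 1" using ln_\<kappa>_bd[of n] unfolding b0_def by linarith
      then have "\<bar>b0 n\<bar> / \<bar>rho \<alpha> a n\<bar> \<le> (\<bar>ln v\<bar> + (L' + E') + 1) / \<bar>rho \<alpha> a n\<bar>"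
        by (rule divide_right_mono) simp
      then show ?case by (simp add: abs_divide)
    qed
  qed
  have "(\<lambda>n. b0 n / rho \<alpha> a n + (\<Sum>k<Suc n. w k * x k) / rho \<alpha> a n) \<longlonglongrightarrow> 0 + (\<Sum>k<N. v * l k / \<alpha> k) / N"
    by (rule tendsto_add[OF b0_lim main])
  then show "(\<lambda>n. (ln ((cmod (orthonormal a b z (Suc n)))\<^sup>2) + ln (a n)) / rho \<alpha> a n)
      \<longlonglongrightarrow> Im z * (\<Sum>j<N. recip_height (s j) / \<alpha> (N + j - 1)) / N"
    unfolding form mean v_def[symmetric] by (simp add: add_divide_distrib)
qed

section \<open>The limit of the eigenvalue distributions\<close>

theorem theorem1:
  fixes N :: nat
    and a b \<alpha> \<beta> :: "nat \<Rightarrow> real"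
    and f :: "real \<Rightarrow> complex"
  assumes "N \<ge> 1"
    and "\<And>n. a n > 0"
    and "\<And>n. \<alpha> n > 0"
    and "periodic_seq N \<alpha>"
    and "periodic_seq N \<beta>"
    and "periodically_modulated \<alpha> \<beta> a b"
    and "trace (monodromy N \<alpha> \<beta> N 0) \<in> {-2<..<2}"
    and "(\<lambda>n. a (n - 1) / a n) \<in> D1 N"
    and "(\<lambda>n. b n / a n) \<in> D1 N"
    and "(\<lambda>n. 1 / a n) \<in> D1 N"
    and "\<not> summable (\<lambda>n. 1 / a n)"
    and "continuous_on UNIV f"
    and "bounded (range f)"
    and "bdd_above (range (\<lambda>x. (1 + x\<^sup>2) * norm (f x)))"
  shows "(\<lambda>n. (1 / rho \<alpha> a n) *\<^sub>R integral\<^sup>L (eig_measure a b n) f)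
           \<longlonglongrightarrow> integral\<^sup>L (limit_measure N \<alpha> \<beta>) f"
proof -
  note N = assms(1) and modulated = assms(6) and elliptic = assms(7)
  have a: "\<forall>n. a n > 0" and \<alpha>: "\<forall>n. \<alpha> n > 0" using assms(2,3) by auto
  define q where "q = \<bar>trace (vector_derivative (monodromy N \<alpha> \<beta> N) (at 0))\<bar> /
     sqrt (- discr (monodromy N \<alpha> \<beta> N 0))"
  define d where "d = 1 / (pi * real N) * q"
  define S where "S n = spectrum (jacobi_trunc a b (Suc n))" for n
  have fin: "finite (S n)" for n
    unfolding S_def by (rule card_finite_spectrum(1)[of _ "Suc n"]) (simp add: jacobi_trunc_def)
  have \<rho>_pos: "rho \<alpha> a n > 0" for n
    unfolding rho_def using a \<alpha> by (intro sum_pos) auto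
  have logs: "(\<lambda>n. (ln ((cmod (orthonormal a b z (Suc n)))\<^sup>2) + ln (a n)) / rho \<alpha> a n) \<longlonglongrightarrow> Im z * (2 * (pi * d))"
    if z: "Im z > 0" for z
  proof -
    obtain s where s: "\<And>j. Im (s j) > 0" "\<And>j. s (j + N) = s j"
      "\<And>j. s (Suc j) = of_real (- \<beta> (N + j) / \<alpha> (N + j)) - of_real (\<alpha> (N + j - 1) / \<alpha> (N + j)) / s j"
      "\<And>j. (\<lambda>k. ratio a b z (N - 1 + j + k * N)) \<longlonglongrightarrow> s j"
      using ratio_asymptotically_periodic[OF N a \<alpha> assms(4,5) modulated elliptic assms(8-11) z] by blast
    have \<alpha>N: "\<alpha> (N + N - 1) = \<alpha> (N - 1)" using periodic_seq_mult[OF assms(4), of "N - 1" 1] N by simp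
    have q: "q = (\<Sum>j<N. recip_height (s j) / \<alpha> (N + j - 1)) / 2"
      unfolding q_def
      by (rule trace_monodromy_deriv[OF \<alpha> N \<alpha>N s(1) _ s(3) discr_monodromy_neg[OF N \<alpha> assms(4) elliptic]])
        (use s(2)[of 0] in simp)
    have "(\<lambda>n. (ln ((cmod (orthonormal a b z (Suc n)))\<^sup>2) + ln (a n)) / rho \<alpha> a n)
      \<longlonglongrightarrow> Im z * (\<Sum>j<N. recip_height (s j) / \<alpha> (N + j - 1)) / N"
      using modulated unfolding periodically_modulated_def
      by (intro log_orth_asymptotics(2)[OF N a \<alpha> assms(4) _ _ assms(11) z s(1,2,4)]) auto
    moreover have "(\<Sum>j<N. recip_height (s j) / \<alpha> (N + j - 1)) = 2 * q" using q by simp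
    ultimately show ?thesis using N by (simp only:) (simp add: d_def)
  qed
  interpret poisson_means S "rho \<alpha> a" d
  proof
    fix u v :: real assume v: "v > 0"
    show "(\<lambda>n. (\<Sum>y\<in>S n. poisson u v y) / rho \<alpha> a n) \<longlonglongrightarrow> pi * d"
    proof (rule poisson_means_from_log_means[OF fin \<rho>_pos _ v])
      fix t t' :: real assume t: "t > 0" "t' > 0"
      have "(\<lambda>n. (ln ((cmod (orthonormal a b (Complex u t) (Suc n)))\<^sup>2) + ln (a n)) / rho \<alpha> a n
          - (ln ((cmod (orthonormal a b (Complex u t') (Suc n)))\<^sup>2) + ln (a n)) / rho \<alpha> a n)
        \<longlonglongrightarrow> t * (2 * (pi * d)) - t' * (2 * (pi * d))"
        using logs[of "Complex u t"] logs[of "Complex u t'"] t by (intro tendsto_diff) auto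
      then show "(\<lambda>n. (\<Sum>y\<in>S n. ln (((y - u)\<^sup>2 + t\<^sup>2) / ((y - u)\<^sup>2 + t'\<^sup>2))) / rho \<alpha> a n)
        \<longlonglongrightarrow> (t - t') * (2 * (pi * d))"
        unfolding S_def log_orth_quotient[OF a t, symmetric] by (simp add: diff_divide_distrib[symmetric] left_diff_distrib del: orthonormal.simps)
    qed
  qed (use fin \<rho>_pos in auto)
  obtain C where C: "\<And>x. (1 + x\<^sup>2) * norm (f x) \<le> C"
    using assms(14) by (auto simp: bdd_above_def)
  have [measurable]: "f \<in> borel_measurable borel" using assms(12) by (rule borel_measurable_continuous_onI)
  have Re_bound: "(1 + x\<^sup>2) * \<bar>Re (f x)\<bar> \<le> C" and Im_bound: "(1 + x\<^sup>2) * \<bar>Im (f x)\<bar> \<le> C" for x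
    using C[of x] mult_left_mono[OF abs_Re_le_cmod[of "f x"], of "1 + x\<^sup>2"]
      mult_left_mono[OF abs_Im_le_cmod[of "f x"], of "1 + x\<^sup>2"] by auto
  have contRI: "continuous_on UNIV (\<lambda>x. Re (f x))" "continuous_on UNIV (\<lambda>x. Im (f x))"
    using assms(12) by (auto intro: continuous_intros)
  note convRe = weighted_convergence[OF contRI(1) Re_bound] and convIm = weighted_convergence[OF contRI(2) Im_bound]
  have fint: "integrable lborel f"
  proof -
    have "integrable lborel (\<lambda>x. complex_of_real (Re (f x)) + \<i> * complex_of_real (Im (f x)))"
      using convRe(1) convIm(1)
      by (intro Bochner_Integration.integrable_add integrable_mult_right integrable_of_real)
    then show ?thesis by (simp only: complex_eq[symmetric])
  qed
  have "(\<lambda>n. (\<Sum>y\<in>S n. f y) / of_real (rho \<alpha> a n)) \<longlonglongrightarrow> of_real d * (LINT x|lborel. f x)"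
    using convRe(2) convIm(2) fint
    by (simp add: tendsto_complex_iff Re_divide_of_real Im_divide_of_real)
  moreover have "integral\<^sup>L (limit_measure N \<alpha> \<beta>) f = of_real d * (LINT x|lborel. f x)"
  proof -
    have "limit_measure N \<alpha> \<beta> = density lborel (\<lambda>_. ennreal d)"
      by (simp add: limit_measure_def d_def q_def)
    then show ?thesis
      using density_nonneg by (simp add: integral_density scaleR_conv_of_real)
  qed
  moreover have "(1 / rho \<alpha> a n) *\<^sub>R integral\<^sup>L (eig_measure a b n) f = (\<Sum>y\<in>S n. f y) / of_real (rho \<alpha> a n)" for n
    by (simp add: integral_eig_measure S_def scaleR_conv_of_real)
  ultimately show ?thesis by simp
qed

end
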